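(* Let $n\in\mathbb N$. For each $q\in(0,1)$ and each $r\in(0,+\infty]$, the completion of the algebra $\mathcal O_q^{\mathrm{reg}}(\mathbb C^n)$ with respect to the family of norms $\{\|\cdot\|^\infty_\rho : 0<\rho<r\}$ is topologically isomorphic to $\mathcal O_q(\mathbb B^n_r)$.
   Context: All algebras are complex, associative and unital. Two topological algebras are topologically isomorphic if there is an algebra isomorphism between them that is a homeomorphism. $\mathbb Z_+=\{0,1,2,\dots\}$. For $q\in(0,1)$, $\mathrm{Pol}_q(\mathbb C^n)$ is the $*$-algebra generated (as a $*$-algebra) by $x_1,\dots,x_n$ subject to the relations $$x_ix_j=q\,x_jx_i\ (i<j);\qquad x_i^*x_j=q\,x_jx_i^*\ (i\ne j);\qquad x_i^*x_i=q^2x_ix_i^*+(1-q^2)\Bigl(1-\sum_{k>i}x_kx_k^*\Bigr).$$ The subalgebra generated (as an algebra) by $x_1,\dots,x_n$ is $\mathcal O_q^{\mathrm{reg}}(\mathbb C^n)$, the algebra generated by $x_1,\dots,x_n$ subject to the relations $x_ix_j=q\,x_jx_i$ ($i<j$); the monomials $x^k=x_1^{k_1}\cdots x_n^{k_n}$, $k\in\mathbb Z_+^n$, form a basis of it. Let $H$ be a Hilbert space with orthonormal basis $\{e_k : k\in\mathbb Z_+^n\}$, $e_k$ being also written $|k_1,\dots,k_n\rangle$. For $t>0$ and $m\in\mathbb N$ let $[m]_t=1+t+\cdots+t^{m-1}$, $[m]_t!=[1]_t\cdots[m]_t$, $[0]_t!=1$, and $[k]_t!=[k_1]_t!\cdots[k_n]_t!$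 for $k\in\mathbb Z_+^n$. It is known (Pusz–Woronowicz) that there is a faithful irreducible $*$-representation $\pi\colon\mathrm{Pol}_q(\mathbb C^n)\to\mathcal B(H)$ by bounded operators uniquely determined by $$\pi(x_j)e_k=\sqrt{1-q^2}\,\sqrt{[k_j+1]_{q^2}}\;q^{\sum_{i>j}k_i}\,|k_1,\dots,k_j+1,\dots,k_n\rangle\qquad(j=1,\dots,n,\ k\in\mathbb Z_+^n).$$ Put $\|a\|_{\mathrm{op}}=\|\pi(a)\|$. For $\rho>0$ let $\gamma_\rho$ be the automorphism of $\mathcal O_q^{\mathrm{reg}}(\mathbb C^n)$ with $\gamma_\rho(x_i)=\rho x_i$ for $i=1,\dots,n$, and define $\|a\|^\infty_\rho=\|\gamma_\rho(a)\|_{\mathrm{op}}$ for $a\in\mathcal O_q^{\mathrm{reg}}(\mathbb C^n)$. Quantum ball: with $|k|=k_1+\cdots+k_n$, $$\mathcal O_q(\mathbb B^n_r)=\Bigl\{a=\sum_{k\in\mathbb Z_+^n}c_kx^k : \|a\|_\rho=\sum_{k}|c_k|\Bigl(\frac{[k]_{|q|^{-2}}!}{[\,|k|\,]_{|q|^{-2}}!}\Bigr)^{1/2}\rho^{|k|}<\infty\ \ \forall\rho\in(0,r)\Bigr\}$$ (formal series with complex coefficients), topologized by the norms $\|\cdot\|_\rho$ ($0<\rho<r$), with the continuous multiplication uniquely determined by $x_ix_j=q\,x_jx_i$ for $i<j$; it is a Fréchet algebra. *)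

theory Defs
  imports "HOL-Analysis.Analysis" "HOL-Algebra.QuotRing" "HOL-Algebra.Module"
    "HOL-Library.Poly_Mapping"
begin

text \<open>
  The index set \<open>{1,\<dots>,n}\<close> is a type \<open>'n\<close> of classes \<open>finite\<close> and \<open>linorder\<close>, so that
  \<open>n = CARD('n) \<ge> 1\<close>; multi-indices are functions \<open>'n \<Rightarrow> nat\<close>.
\<close>

section \<open>Complex algebras whose topology is given by a family of seminorms\<close>

text \<open>
  The HOL-Algebra record \<open>module\<close> carries the operations of a unital ring together with a
  scalar multiplication, i.e. the operations of a complex unital algebra.
\<close>

definition alg_hom ::
  "(complex, 'a, 'r) module_scheme \<Rightarrow> (complex, 'b, 's) module_scheme \<Rightarrow> ('a \<Rightarrow> 'b) set"
  where "alg_hom A B =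
    {h \<in> ring_hom A B. \<forall>c. \<forall>a \<in> carrier A. h (c \<odot>\<^bsub>A\<^esub> a) = c \<odot>\<^bsub>B\<^esub> h a}"

inductive_set subalg_generated :: "(complex, 'a, 'r) module_scheme \<Rightarrow> 'a set \<Rightarrow> 'a set"
  for A :: "(complex, 'a, 'r) module_scheme" (structure) and S :: "'a set"
  where
    one: "\<one> \<in> subalg_generated A S"
  | incl: "a \<in> S \<Longrightarrow> a \<in> subalg_generated A S"
  | add: "a \<in> subalg_generated A S \<Longrightarrow> b \<in> subalg_generated A S \<Longrightarrow> a \<oplus> b \<in> subalg_generated A S"
  | mult: "a \<in> subalg_generated A S \<Longrightarrow> b \<in> subalg_generated A S \<Longrightarrow> a \<otimes> b \<in> subalg_generated A S"
  | smult: "a \<in> subalg_generated A S \<Longrightarrow> c \<odot> a \<in> subalg_generated A S"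

record 'a seminormed_alg = "(complex, 'a) module" +
  idx :: "real set"
  nrm :: "real \<Rightarrow> 'a \<Rightarrow> real"

definition alg_diff :: "(complex, 'a, 'r) module_scheme \<Rightarrow> 'a \<Rightarrow> 'a \<Rightarrow> 'a"
  where "alg_diff A a b = a \<oplus>\<^bsub>A\<^esub> ((-1) \<odot>\<^bsub>A\<^esub> b)"

definition alg_topology :: "'a seminormed_alg \<Rightarrow> 'a topology"
  where "alg_topology A = topology_generated_by
    {{b \<in> carrier A. nrm A \<rho> (alg_diff A b a) < \<epsilon>} | a \<rho> \<epsilon>. a \<in> carrier A \<and> \<rho> \<in> idx A \<and> \<epsilon> > 0}"

definition topologically_isomorphic :: "'a seminormed_alg \<Rightarrow> 'b seminormed_alg \<Rightarrow> bool"
  where "topologically_isomorphic A B \<longleftrightarrow>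
    (\<exists>h \<in> alg_hom A B. homeomorphic_map (alg_topology A) (alg_topology B) h)"

section \<open>Completion\<close>

text \<open>
  The Hausdorff completion with respect to the uniformity of the seminorms: Cauchy filters on the
  carrier, two filters being identified when they are arbitrarily close to each other. The
  algebra operations are applied to filters elementwise, and each seminorm is extended by
  continuity.
\<close>

definition Cauchy_filters :: "'a seminormed_alg \<Rightarrow> 'a filter set"
  where "Cauchy_filters A = {F. F \<noteq> bot \<and> F \<le> principal (carrier A) \<and>
    (\<forall>\<rho> \<in> idx A. \<forall>\<epsilon> > 0. eventually (\<lambda>(a, b). nrm A \<rho> (alg_diff A a b) < \<epsilon>) (F \<times>\<^sub>F F))}"

definition Cauchy_rel :: "'a seminormed_alg \<Rightarrow> ('a filter \<times> 'a filter) set"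
  where "Cauchy_rel A = {(F, G). F \<in> Cauchy_filters A \<and> G \<in> Cauchy_filters A \<and>
    (\<forall>\<rho> \<in> idx A. \<forall>\<epsilon> > 0. eventually (\<lambda>(a, b). nrm A \<rho> (alg_diff A a b) < \<epsilon>) (F \<times>\<^sub>F G))}"

definition alg_completion :: "'a seminormed_alg \<Rightarrow> 'a filter set seminormed_alg"
  where "alg_completion A =
    \<lparr>carrier = Cauchy_filters A // Cauchy_rel A,
     mult = (\<lambda>U V. \<Union>F\<in>U. \<Union>G\<in>V. Cauchy_rel A `` {filtermap (\<lambda>(a, b). a \<otimes>\<^bsub>A\<^esub> b) (F \<times>\<^sub>F G)}),
     one = Cauchy_rel A `` {principal {\<one>\<^bsub>A\<^esub>}},
     zero = Cauchy_rel A `` {principal {\<zero>\<^bsub>A\<^esub>}},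
     add = (\<lambda>U V. \<Union>F\<in>U. \<Union>G\<in>V. Cauchy_rel A `` {filtermap (\<lambda>(a, b). a \<oplus>\<^bsub>A\<^esub> b) (F \<times>\<^sub>F G)}),
     smult = (\<lambda>c U. \<Union>F\<in>U. Cauchy_rel A `` {filtermap (\<lambda>a. c \<odot>\<^bsub>A\<^esub> a) F}),
     idx = idx A,
     nrm = (\<lambda>\<rho> U. Lim (SOME F. F \<in> U) (nrm A \<rho>))\<rparr>"

section \<open>The free complex $*$-algebra\<close>

datatype 'n gen = Gen 'n | Gen_star 'n

primrec gen_star :: "'n gen \<Rightarrow> 'n gen"
  where
    "gen_star (Gen i) = Gen_star i"
  | "gen_star (Gen_star i) = Gen i"

text \<open>
  Words form the free monoid, written additively so that \<open>'a word \<Rightarrow>\<^sub>0 complex\<close> with its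
  convolution product is the monoid algebra, i.e. the free algebra.
\<close>

datatype 'a word = Word (letters: "'a list")

instantiation word :: (type) monoid_add
begin
definition zero_word :: "'a word" where "zero_word = Word []"
definition plus_word :: "'a word \<Rightarrow> 'a word \<Rightarrow> 'a word"
  where "plus_word u v = Word (letters u @ letters v)"
instance by standard (auto simp: zero_word_def plus_word_def)
end

type_synonym 'n free = "'n gen word \<Rightarrow>\<^sub>0 complex"

definition scal :: "complex \<Rightarrow> 'n free \<Rightarrow> 'n free"
  where "scal c a = Poly_Mapping.single 0 c * a"

definition free_alg :: "(complex, 'n free) module"
  where "free_alg = \<lparr>carrier = UNIV, mult = (*), one = 1, zero = 0, add = (+), smult = scal\<rparr>"

definition free_star :: "'n free \<Rightarrow> 'n free"
  where "free_star a = (\<Sum>w\<in>Poly_Mapping.keys a.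
    Poly_Mapping.single (Word (rev (map gen_star (letters w)))) (cnj (Poly_Mapping.lookup a w)))"

definition fX :: "'n \<Rightarrow> 'n free"
  where "fX i = Poly_Mapping.single (Word [Gen i]) 1"

definition fXs :: "'n \<Rightarrow> 'n free"
  where "fXs i = Poly_Mapping.single (Word [Gen_star i]) 1"

section \<open>\<open>Pol\<^sub>q(\<complex>\<^sup>n)\<close> and \<open>O\<^sub>q\<^sup>r\<^sup>e\<^sup>g(\<complex>\<^sup>n)\<close>\<close>

definition pol_relations :: "real \<Rightarrow> 'n::{finite,linorder} free set"
  where "pol_relations q =
    {fX i * fX j - scal (of_real q) (fX j * fX i) | i j. i < j} \<union>
    {fXs i * fX j - scal (of_real q) (fX j * fXs i) | i j. i \<noteq> j} \<union>
    {fXs i * fX i - (scal (of_real (q^2)) (fX i * fXs i)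
        + scal (of_real (1 - q^2)) (1 - (\<Sum>k | k > i. fX k * fXs k))) | i. True}"

text \<open>Relations of a $*$-algebra hold together with their adjoints.\<close>

definition pol_ideal :: "real \<Rightarrow> 'n::{finite,linorder} free set"
  where "pol_ideal q = Idl\<^bsub>free_alg\<^esub> (pol_relations q \<union> free_star ` pol_relations q)"

definition pol_class :: "real \<Rightarrow> 'n::{finite,linorder} free \<Rightarrow> 'n free set"
  where "pol_class q a = pol_ideal q +>\<^bsub>free_alg\<^esub> a"

definition pol :: "real \<Rightarrow> (complex, 'n::{finite,linorder} free set) module"
  where "pol q =
    (let Q = free_alg Quot pol_ideal q in
     \<lparr>carrier = carrier Q, mult = mult Q, one = one Q, zero = zero Q, add = add Q,
      smult = (\<lambda>c A. \<Union>a\<in>A. pol_class q (scal c a))\<rparr>)"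

definition pol_star :: "'n::{finite,linorder} free set \<Rightarrow> 'n free set"
  where "pol_star A = free_star ` A"

definition px :: "real \<Rightarrow> 'n::{finite,linorder} \<Rightarrow> 'n free set"
  where "px q i = pol_class q (fX i)"

definition oreg :: "real \<Rightarrow> (complex, 'n::{finite,linorder} free set) module"
  where "oreg q = (pol q)\<lparr>carrier := subalg_generated (pol q) (range (px q))\<rparr>"

section \<open>Bounded operators on \<open>\<ell>\<^sup>2\<close> and the Pusz--Woronowicz representation\<close>

definition l2 :: "('k \<Rightarrow> complex) set"
  where "l2 = {f. (\<lambda>k. (cmod (f k))^2) summable_on UNIV}"

definition l2_norm :: "('k \<Rightarrow> complex) \<Rightarrow> real"
  where "l2_norm f = sqrt (infsum (\<lambda>k. (cmod (f k))^2) UNIV)"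

definition l2_inner :: "('k \<Rightarrow> complex) \<Rightarrow> ('k \<Rightarrow> complex) \<Rightarrow> complex"
  where "l2_inner f g = infsum (\<lambda>k. f k * cnj (g k)) UNIV"

definition l2_basis :: "'k \<Rightarrow> 'k \<Rightarrow> complex"
  where "l2_basis k = (\<lambda>m. if m = k then 1 else 0)"

text \<open>Operators are only considered on \<^const>\<open>l2\<close>; their values elsewhere are irrelevant.\<close>

type_synonym 'k l2_op = "('k \<Rightarrow> complex) \<Rightarrow> ('k \<Rightarrow> complex)"

definition l2_bounded_op :: "'k l2_op \<Rightarrow> bool"
  where "l2_bounded_op T \<longleftrightarrow>
    (\<forall>f\<in>l2. T f \<in> l2) \<and>
    (\<forall>f\<in>l2. \<forall>g\<in>l2. T (\<lambda>k. f k + g k) = (\<lambda>k. T f k + T g k)) \<and>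
    (\<forall>f\<in>l2. \<forall>c. T (\<lambda>k. c * f k) = (\<lambda>k. c * T f k)) \<and>
    (\<exists>B. \<forall>f\<in>l2. l2_norm (T f) \<le> B * l2_norm f)"

definition l2_opnorm :: "'k l2_op \<Rightarrow> real"
  where "l2_opnorm T = (SUP f\<in>{f \<in> l2. l2_norm f \<le> 1}. l2_norm (T f))"

definition l2_star_rep ::
  "(complex, 'a, 'r) module_scheme \<Rightarrow> ('a \<Rightarrow> 'a) \<Rightarrow> ('a \<Rightarrow> 'k l2_op) \<Rightarrow> bool"
  where "l2_star_rep A star \<pi> \<longleftrightarrow>
    (\<forall>a\<in>carrier A. l2_bounded_op (\<pi> a)) \<and>
    (\<forall>f\<in>l2. \<pi> \<one>\<^bsub>A\<^esub> f = f) \<and>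
    (\<forall>a\<in>carrier A. \<forall>b\<in>carrier A. \<forall>f\<in>l2. \<pi> (a \<oplus>\<^bsub>A\<^esub> b) f = (\<lambda>k. \<pi> a f k + \<pi> b f k)) \<and>
    (\<forall>a\<in>carrier A. \<forall>b\<in>carrier A. \<forall>f\<in>l2. \<pi> (a \<otimes>\<^bsub>A\<^esub> b) f = \<pi> a (\<pi> b f)) \<and>
    (\<forall>c. \<forall>a\<in>carrier A. \<forall>f\<in>l2. \<pi> (c \<odot>\<^bsub>A\<^esub> a) f = (\<lambda>k. c * \<pi> a f k)) \<and>
    (\<forall>a\<in>carrier A. \<forall>f\<in>l2. \<forall>g\<in>l2. l2_inner (\<pi> a f) g = l2_inner f (\<pi> (star a) g))"

definition qint :: "real \<Rightarrow> nat \<Rightarrow> real"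
  where "qint t m = (\<Sum>i<m. t ^ i)"

definition qfact :: "real \<Rightarrow> nat \<Rightarrow> real"
  where "qfact t m = (\<Prod>i=1..m. qint t i)"

definition qfact_multi :: "real \<Rightarrow> ('n::finite \<Rightarrow> nat) \<Rightarrow> real"
  where "qfact_multi t k = (\<Prod>i\<in>UNIV. qfact t (k i))"

text \<open>
  The formula determines a $*$-representation by bounded operators on \<^const>\<open>l2\<close> uniquely, so the
  choice in \<open>pw_rep\<close> only affects values outside \<^const>\<open>l2\<close> and outside the carrier. Faithfulness
  and irreducibility are properties of this representation and need not be imposed.
\<close>

definition is_pw_rep ::
  "real \<Rightarrow> ('n::{finite,linorder} free set \<Rightarrow> ('n \<Rightarrow> nat) l2_op) \<Rightarrow> bool"
  where "is_pw_rep q \<pi> \<longleftrightarrow> l2_star_rep (pol q) pol_star \<pi> \<and>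
    (\<forall>j k. \<pi> (px q j) (l2_basis k) =
      (\<lambda>m. of_real (sqrt (1 - q^2) * sqrt (qint (q^2) (k j + 1)) * q ^ (\<Sum>i | i > j. k i))
            * l2_basis (k(j := k j + 1)) m))"

definition pw_rep :: "real \<Rightarrow> 'n::{finite,linorder} free set \<Rightarrow> ('n \<Rightarrow> nat) l2_op"
  where "pw_rep q = (SOME \<pi>. is_pw_rep q \<pi>)"

definition op_norm :: "real \<Rightarrow> 'n::{finite,linorder} free set \<Rightarrow> real"
  where "op_norm q a = l2_opnorm (pw_rep q a)"

text \<open>Likewise \<open>gamma q \<rho>\<close> is determined on the carrier of \<^const>\<open>oreg\<close> by its values on generators.\<close>

definition gamma :: "real \<Rightarrow> real \<Rightarrow> 'n::{finite,linorder} free set \<Rightarrow> 'n free set"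
  where "gamma q \<rho> = (SOME g. g \<in> alg_hom (oreg q) (oreg q) \<and>
    bij_betw g (carrier (oreg q)) (carrier (oreg q)) \<and>
    (\<forall>i. g (px q i) = of_real \<rho> \<odot>\<^bsub>oreg q\<^esub> px q i))"

definition norm_inf :: "real \<Rightarrow> real \<Rightarrow> 'n::{finite,linorder} free set \<Rightarrow> real"
  where "norm_inf q \<rho> a = op_norm q (gamma q \<rho> a)"

definition oreg_normed ::
  "real \<Rightarrow> ereal \<Rightarrow> 'n::{finite,linorder} free set seminormed_alg"
  where "oreg_normed q r =
    \<lparr>carrier = carrier (oreg q), mult = mult (oreg q), one = one (oreg q),
     zero = zero (oreg q), add = add (oreg q), smult = smult (oreg q),
     idx = {\<rho>. 0 < \<rho> \<and> ereal \<rho> < r}, nrm = norm_inf q\<rparr>"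

section \<open>The algebra of functions on the quantum ball\<close>

text \<open>A formal series \<open>\<Sum>\<^sub>k c\<^sub>k x\<^sup>k\<close> is represented by its coefficient function.\<close>

definition ball_weight :: "real \<Rightarrow> ('n::finite \<Rightarrow> nat) \<Rightarrow> real"
  where "ball_weight q k =
    sqrt (qfact_multi (\<bar>q\<bar> powi (-2)) k / qfact (\<bar>q\<bar> powi (-2)) (\<Sum>i\<in>UNIV. k i))"

definition ball_norm :: "real \<Rightarrow> real \<Rightarrow> (('n::finite \<Rightarrow> nat) \<Rightarrow> complex) \<Rightarrow> real"
  where "ball_norm q \<rho> c =
    infsum (\<lambda>k. cmod (c k) * ball_weight q k * \<rho> ^ (\<Sum>i\<in>UNIV. k i)) UNIV"

definition ball_carrier :: "real \<Rightarrow> ereal \<Rightarrow> (('n::finite \<Rightarrow> nat) \<Rightarrow> complex) set"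
  where "ball_carrier q r = {c. \<forall>\<rho>. 0 < \<rho> \<and> ereal \<rho> < r \<longrightarrow>
    (\<lambda>k. cmod (c k) * ball_weight q k * \<rho> ^ (\<Sum>i\<in>UNIV. k i)) summable_on UNIV}"

text \<open>
  Reordering by \<open>x\<^sub>j x\<^sub>i = q\<^sup>-\<^sup>1 x\<^sub>i x\<^sub>j\<close> for \<open>i < j\<close> gives
  \<open>x\<^sup>k x\<^sup>l = q\<^sup>-\<^sup>s x\<^sup>k\<^sup>+\<^sup>l\<close> with \<open>s = \<Sum>\<^sub>i\<^sub><\<^sub>j l\<^sub>i k\<^sub>j\<close>; by continuity this determines the product.
\<close>

definition reorder_exp :: "('n::{finite,linorder} \<Rightarrow> nat) \<Rightarrow> ('n \<Rightarrow> nat) \<Rightarrow> nat"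
  where "reorder_exp k l = (\<Sum>(i, j) | i < j. l i * k j)"

definition ball_mult ::
  "real \<Rightarrow> (('n::{finite,linorder} \<Rightarrow> nat) \<Rightarrow> complex) \<Rightarrow> (('n \<Rightarrow> nat) \<Rightarrow> complex)
    \<Rightarrow> ('n \<Rightarrow> nat) \<Rightarrow> complex"
  where "ball_mult q c d = (\<lambda>m. \<Sum>(k, l) | (\<lambda>i. k i + l i) = m.
    c k * d l * of_real (q powi (- int (reorder_exp k l))))"

definition ball_monom :: "('n \<Rightarrow> nat) \<Rightarrow> ('n \<Rightarrow> nat) \<Rightarrow> complex"
  where "ball_monom k = (\<lambda>m. if m = k then 1 else 0)"

definition quantum_ball ::
  "real \<Rightarrow> ereal \<Rightarrow> (('n::{finite,linorder} \<Rightarrow> nat) \<Rightarrow> complex) seminormed_alg"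
  where "quantum_ball q r =
    \<lparr>carrier = ball_carrier q r, mult = ball_mult q, one = ball_monom (\<lambda>i. 0),
     zero = (\<lambda>k. 0), add = (\<lambda>c d k. c k + d k), smult = (\<lambda>a c k. a * c k),
     idx = {\<rho>. 0 < \<rho> \<and> ereal \<rho> < r}, nrm = ball_norm q\<rparr>"

lemma finite_index_splittings:
  "finite {(k, l). (\<lambda>i::'n::finite. k i + l i) = (m :: 'n \<Rightarrow> nat)}"
proof (rule finite_subset)
  let ?P = "Pi\<^sub>E UNIV (\<lambda>i. {..m i})"
  show "{(k, l). (\<lambda>i. k i + l i) = m} \<subseteq> ?P \<times> ?P"
    by (auto simp: PiE_def)
  show "finite (?P \<times> ?P)"
    by (intro finite_cartesian_product finite_PiE) auto
qed

lemma ball_mult_monom: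
  fixes k l :: "'n::{finite,linorder} \<Rightarrow> nat"
  shows "ball_mult q (ball_monom k) (ball_monom l) =
    (\<lambda>m. of_real (q powi (- int (reorder_exp k l))) * ball_monom (\<lambda>i. k i + l i) m)"
proof
  fix m :: "'n \<Rightarrow> nat"
  let ?S = "{(k, l). (\<lambda>i. k i + l i) = m}"
  have "ball_mult q (ball_monom k) (ball_monom l) m =
    (\<Sum>p\<in>?S. if p = (k, l) then of_real (q powi (- int (reorder_exp k l))) else 0)"
    unfolding ball_mult_def ball_monom_def by (rule sum.cong) (auto split: if_splits)
  also have "\<dots> = of_real (q powi (- int (reorder_exp k l))) * ball_monom (\<lambda>i. k i + l i) m"
    by (subst sum.delta[OF finite_index_splittings]) (auto simp: ball_monom_def)
  finally show "ball_mult q (ball_monom k) (ball_monom l) m =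
    of_real (q powi (- int (reorder_exp k l))) * ball_monom (\<lambda>i. k i + l i) m" .
qed

lemma reorder_exp_single:
  "reorder_exp ((\<lambda>i. 0)(a := 1)) ((\<lambda>i. 0)(b := 1)) = (if b < a then 1 else 0)"
proof -
  have "reorder_exp ((\<lambda>i. 0)(a := 1)) ((\<lambda>i. 0)(b := 1)) =
    (\<Sum>p | fst p < snd p. if p = (b, a) then 1 else 0)"
    unfolding reorder_exp_def by (rule sum.cong) (auto split: if_splits)
  then show ?thesis by simp
qed

lemma ball_relation:
  fixes i j :: "'n::{finite,linorder}"
  assumes "i < j" "q \<noteq> 0"
  defines "x \<equiv> \<lambda>i. ball_monom ((\<lambda>_. 0)(i := 1))"
  shows "ball_mult q (x i) (x j) = (\<lambda>m. of_real q * ball_mult q (x j) (x i) m)"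
  using assms
  by (auto simp: x_def ball_mult_monom reorder_exp_single[simplified] add.commute fun_eq_iff
      power_int_minus)

end

theory Submission
  imports Defs "HOL-Library.Function_Algebras"
begin

text \<open>
  Write \<open>x\<^sup>k\<close> for the ordered monomials, \<open>u(k)\<close> for \<open>q\<close> to the power \<open>\<Sum>\<^sub>i\<^sub><\<^sub>j k\<^sub>i k\<^sub>j\<close>, and
  \<open>(t;t)\<^sub>m = (1 - t)\<dots>(1 - t\<^sup>m)\<close>. The weight of \<open>x\<^sup>k\<close> in the quantum ball is \<open>u(k)\<close> times the square
  root of a quotient of factors \<open>(q\<^sup>2;q\<^sup>2)\<^sub>m\<close>, all of which lie in an interval \<open>[P, 1]\<close> with \<open>P > 0\<close>;
  hence it is comparable to \<open>u(k)\<close>. On the other hand \<open>\<pi>(x\<^sup>k)\<close> is a weighted shift whose weights are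
  at most \<open>u(k)\<close>, which bounds the operator norms by the ball norms. The weight of this shift at
  \<open>e\<^sub>0\<close> is comparable to \<open>u(k)\<close>, and the vectors \<open>\<pi>(x\<^sup>k) e\<^sub>0\<close> are orthogonal, so every coefficient of
  \<open>a\<close> is controlled by \<open>\<parallel>a\<parallel>\<^sup>\<infinity>\<^sub>\<sigma>\<close>; summing a geometric series bounds \<open>\<parallel>a\<parallel>\<^sub>\<rho>\<close> by \<open>\<parallel>a\<parallel>\<^sup>\<infinity>\<^sub>\<sigma>\<close> for
  \<open>\<rho> < \<sigma>\<close>. The two families of norms on the regular functions are therefore equivalent, and the
  quantum ball is complete and contains the ordered polynomials densely.
\<close>

section \<open>Completions of dense subalgebras\<close>

text \<open>At one fixed radius the operator norm only controls the largest weighted coefficient,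
  whereas the ball norm is the sum of all of them. Shrinking the radius from \<sigma> to \<rho>
  gains a factor (\<rho>/\<sigma>)^|k|, and the open range of radii leaves room for such a \<sigma>.
  Hence families of norms are compared, not single norms.

  Neither \<open>pw_rep\<close> nor \<open>gamma\<close> is given by a formula; both are choices.
  The explicit action of free words proves that a representation exists, after which the chosen one
  is evaluated from its specification alone; \<open>gamma\<close> is pinned down by its values on
  generators.

  Linear independence of the ordered monomials is not presupposed. It follows from the same action,
  since they send the vacuum vector to nonzero multiples of distinct basis vectors. Coefficients are
  therefore well defined, and \<open>coeffs_of\<close> is the dense embedding.

  The completion consists of classes of Cauchy filters, with seminorms that are limits along a
  chosen filter. This side is isolated in the locale \<open>dense_embedding\<close>, which turns
  mutual domination of two families of seminorms into the isomorphism.\<close>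

lemma continuous_map_alg_topology:
  assumes f: "f \<in> carrier A \<rightarrow> carrier B" and ne: "idx A \<noteq> {}" "idx B \<noteq> {}"
    and reflA: "\<And>\<rho> a. \<rho> \<in> idx A \<Longrightarrow> a \<in> carrier A \<Longrightarrow> nrm A \<rho> (alg_diff A a a) = 0"
    and reflB: "\<And>\<rho> a. \<rho> \<in> idx B \<Longrightarrow> a \<in> carrier B \<Longrightarrow> nrm B \<rho> (alg_diff B a a) = 0"
    and triangleB: "\<And>\<rho> a b c. \<rho> \<in> idx B \<Longrightarrow> a \<in> carrier B \<Longrightarrow> b \<in> carrier B \<Longrightarrow> c \<in> carrier B \<Longrightarrow>
      nrm B \<rho> (alg_diff B a c) \<le> nrm B \<rho> (alg_diff B a b) + nrm B \<rho> (alg_diff B b c)"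
    and bound: "\<And>\<rho>. \<rho> \<in> idx B \<Longrightarrow> \<exists>\<sigma>\<in>idx A. \<exists>C>0. \<forall>a\<in>carrier A. \<forall>b\<in>carrier A.
      nrm B \<rho> (alg_diff B (f a) (f b)) \<le> C * nrm A \<sigma> (alg_diff A a b)"
  shows "continuous_map (alg_topology A) (alg_topology B) f"
proof -
  \<comment> \<open>Every ball contains its centre, so the balls of a single seminorm already cover
    the carrier.\<close>
  have top: "topspace (alg_topology X) = carrier X"
    if ne: "idx X \<noteq> {}" and
      reflX: "\<And>\<rho> a. \<rho> \<in> idx X \<Longrightarrow> a \<in> carrier X \<Longrightarrow> nrm X \<rho> (alg_diff X a a) = 0"
    for X :: "'c seminormed_alg"
  proof -
    obtain \<rho> where \<rho>: "\<rho> \<in> idx X" using ne by auto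
    have "a \<in> {b \<in> carrier X. nrm X \<rho> (alg_diff X b a) < 1}" if "a \<in> carrier X" for a
      using that \<rho> reflX by auto
    then have "carrier X \<subseteq> topspace (alg_topology X)"
      unfolding alg_topology_def topology_generated_by_topspace using \<rho> zero_less_one[where 'a = real]
      by blast
    then show ?thesis by (auto simp: alg_topology_def topology_generated_by_topspace)
  qed
  have topA: "topspace (alg_topology A) = carrier A" and topB: "topspace (alg_topology B) = carrier B"
    by (auto intro!: top simp: ne reflA reflB)
  have "openin (alg_topology A) (f -` U \<inter> carrier A)"
    if U: "U = {b \<in> carrier B. nrm B \<rho> (alg_diff B b a) < \<epsilon>}" "a \<in> carrier B" "\<rho> \<in> idx B" for U a \<rho> \<epsilon>
  proof (subst openin_subopen, intro ballI)
    fix x assume x: "x \<in> f -` U \<inter> carrier A"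
    obtain \<sigma> C where \<sigma>: "\<sigma> \<in> idx A" "C > 0" and C: "\<And>a b. a\<in>carrier A \<Longrightarrow> b\<in>carrier A \<Longrightarrow>
      nrm B \<rho> (alg_diff B (f a) (f b)) \<le> C * nrm A \<sigma> (alg_diff A a b)"
      using bound[OF U(3)] by blast
    \<comment> \<open>The room left around f x inside the ball U, divided by the Lipschitz constant;
      the triangle inequality then keeps the image of the \<sigma>-ball of this radius inside
      U.\<close>
    define \<delta> where "\<delta> = (\<epsilon> - nrm B \<rho> (alg_diff B (f x) a)) / C"
    let ?V = "{y \<in> carrier A. nrm A \<sigma> (alg_diff A y x) < \<delta>}"
    have "\<delta> > 0" using x U \<sigma> by (auto simp: \<delta>_def)
    then have "openin (alg_topology A) ?V"
      unfolding alg_topology_def using x \<sigma> by (auto intro!: topology_generated_by_Basis)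
    moreover have "x \<in> ?V" using x \<open>\<delta> > 0\<close> reflA \<sigma> by auto
    moreover have "?V \<subseteq> f -` U \<inter> carrier A"
    proof
      fix y assume y: "y \<in> ?V"
      have "nrm B \<rho> (alg_diff B (f y) a) \<le> nrm B \<rho> (alg_diff B (f y) (f x)) + nrm B \<rho> (alg_diff B (f x) a)"
        using x y U f by (intro triangleB) auto
      also have "nrm B \<rho> (alg_diff B (f y) (f x)) \<le> C * nrm A \<sigma> (alg_diff A y x)"
        using x y by (intro C) auto
      also have "C * nrm A \<sigma> (alg_diff A y x) < C * \<delta>" using y \<sigma> by auto
      also have "C * \<delta> = \<epsilon> - nrm B \<rho> (alg_diff B (f x) a)" using \<sigma> by (simp add: \<delta>_def)
      finally show "y \<in> f -` U \<inter> carrier A" using y f U by auto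
    qed
    ultimately show "\<exists>T. openin (alg_topology A) T \<and> x \<in> T \<and> T \<subseteq> f -` U \<inter> carrier A" by blast
  qed
  then show ?thesis
    using topB f unfolding alg_topology_def[of B] continuous_on_generated_topo_iff topA
    by (auto simp: topA topology_generated_by_topspace)
qed

text \<open>The algebra is done in \<open>B\<close>, whose type supplies a genuine subtraction;
  \<open>A\<close> is only asked to be closed under its operations and to map into \<open>B\<close>.
  Subadditivity and the reverse triangle inequality are the properties of the seminorms on
  \<open>A\<close> that pass to limits along Cauchy filters. The product estimate carries a constant
  because the ball weights are multiplicative only up to one.\<close>

locale dense_embedding =
  fixes A :: "'a seminormed_alg" and B :: "'b::ab_group_add seminormed_alg" and \<iota> :: "'a \<Rightarrow> 'b"
  assumes idx_eq: "idx A = idx B" and idx_nonempty: "idx B \<noteq> {}"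
    and A_zero: "\<zero>\<^bsub>A\<^esub> \<in> carrier A" and A_one: "\<one>\<^bsub>A\<^esub> \<in> carrier A"
    and A_add: "\<And>a b. a \<in> carrier A \<Longrightarrow> b \<in> carrier A \<Longrightarrow> a \<oplus>\<^bsub>A\<^esub> b \<in> carrier A"
    and A_mult: "\<And>a b. a \<in> carrier A \<Longrightarrow> b \<in> carrier A \<Longrightarrow> a \<otimes>\<^bsub>A\<^esub> b \<in> carrier A"
    and A_smult: "\<And>c a. a \<in> carrier A \<Longrightarrow> c \<odot>\<^bsub>A\<^esub> a \<in> carrier A"
    and nrm_A_add: "\<And>\<rho> a b. \<rho> \<in> idx B \<Longrightarrow> a \<in> carrier A \<Longrightarrow> b \<in> carrier A \<Longrightarrow>
      nrm A \<rho> (a \<oplus>\<^bsub>A\<^esub> b) \<le> nrm A \<rho> a + nrm A \<rho> b"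
    and nrm_A_diff: "\<And>\<rho> a b. \<rho> \<in> idx B \<Longrightarrow> a \<in> carrier A \<Longrightarrow> b \<in> carrier A \<Longrightarrow>
      \<bar>nrm A \<rho> a - nrm A \<rho> b\<bar> \<le> nrm A \<rho> (alg_diff A a b)"
    and B_zero: "\<zero>\<^bsub>B\<^esub> = 0" "0 \<in> carrier B" and B_one: "\<one>\<^bsub>B\<^esub> \<in> carrier B"
    and B_add: "\<And>x y. x \<in> carrier B \<Longrightarrow> y \<in> carrier B \<Longrightarrow> x \<oplus>\<^bsub>B\<^esub> y = x + y"
      "\<And>x y. x \<in> carrier B \<Longrightarrow> y \<in> carrier B \<Longrightarrow> x + y \<in> carrier B"
    and B_mult: "\<And>x y. x \<in> carrier B \<Longrightarrow> y \<in> carrier B \<Longrightarrow> x \<otimes>\<^bsub>B\<^esub> y \<in> carrier B"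
    and B_smult: "\<And>c x. x \<in> carrier B \<Longrightarrow> c \<odot>\<^bsub>B\<^esub> x \<in> carrier B"
    and B_uminus: "\<And>x. x \<in> carrier B \<Longrightarrow> (-1) \<odot>\<^bsub>B\<^esub> x = - x"
    and B_smult_diff: "\<And>c x y. x \<in> carrier B \<Longrightarrow> y \<in> carrier B \<Longrightarrow>
      c \<odot>\<^bsub>B\<^esub> (x - y) = c \<odot>\<^bsub>B\<^esub> x - c \<odot>\<^bsub>B\<^esub> y"
    and B_mult_diff_left: "\<And>x y z. x \<in> carrier B \<Longrightarrow> y \<in> carrier B \<Longrightarrow> z \<in> carrier B \<Longrightarrow>
      (x - y) \<otimes>\<^bsub>B\<^esub> z = x \<otimes>\<^bsub>B\<^esub> z - y \<otimes>\<^bsub>B\<^esub> z"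
    and B_mult_diff_right: "\<And>x y z. x \<in> carrier B \<Longrightarrow> y \<in> carrier B \<Longrightarrow> z \<in> carrier B \<Longrightarrow>
      z \<otimes>\<^bsub>B\<^esub> (x - y) = z \<otimes>\<^bsub>B\<^esub> x - z \<otimes>\<^bsub>B\<^esub> y"
    and nrm_B_zero: "\<And>\<rho>. \<rho> \<in> idx B \<Longrightarrow> nrm B \<rho> 0 = 0"
    and nrm_B_add: "\<And>\<rho> x y. \<rho> \<in> idx B \<Longrightarrow> x \<in> carrier B \<Longrightarrow> y \<in> carrier B \<Longrightarrow>
      nrm B \<rho> (x + y) \<le> nrm B \<rho> x + nrm B \<rho> y"
    and nrm_B_smult: "\<And>\<rho> c x. \<rho> \<in> idx B \<Longrightarrow> x \<in> carrier B \<Longrightarrow>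
      nrm B \<rho> (c \<odot>\<^bsub>B\<^esub> x) = cmod c * nrm B \<rho> x"
    and nrm_B_mult: "\<And>\<rho>. \<rho> \<in> idx B \<Longrightarrow> \<exists>C. \<forall>x\<in>carrier B. \<forall>y\<in>carrier B.
      nrm B \<rho> (x \<otimes>\<^bsub>B\<^esub> y) \<le> C * nrm B \<rho> x * nrm B \<rho> y"
    and B_Hausdorff: "\<And>x. x \<in> carrier B \<Longrightarrow> (\<And>\<rho>. \<rho> \<in> idx B \<Longrightarrow> nrm B \<rho> x = 0) \<Longrightarrow> x = 0"
    and B_complete: "\<And>F. F \<in> Cauchy_filters B \<Longrightarrow>
      \<exists>x\<in>carrier B. \<forall>\<rho>\<in>idx B. ((\<lambda>y. nrm B \<rho> (y - x)) \<longlongrightarrow> 0) F"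
    and hom: "\<iota> \<in> alg_hom A B" and hom_zero: "\<iota> \<zero>\<^bsub>A\<^esub> = 0"
    and dense: "\<And>x. x \<in> carrier B \<Longrightarrow> \<exists>F. F \<noteq> bot \<and> F \<le> principal (carrier A) \<and>
      (\<forall>\<rho>\<in>idx B. ((\<lambda>a. nrm B \<rho> (\<iota> a - x)) \<longlongrightarrow> 0) F)"
    and nrm_le1: "\<And>\<rho>. \<rho> \<in> idx B \<Longrightarrow> \<exists>\<sigma>\<in>idx B. \<exists>C>0. \<forall>a\<in>carrier A. nrm A \<rho> a \<le> C * nrm B \<sigma> (\<iota> a)"
    and nrm_le2: "\<And>\<rho>. \<rho> \<in> idx B \<Longrightarrow> \<exists>\<sigma>\<in>idx B. \<exists>C>0. \<forall>a\<in>carrier A. nrm B \<rho> (\<iota> a) \<le> C * nrm A \<sigma> a"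
begin

lemma hom_simps:
  assumes "a \<in> carrier A" "b \<in> carrier A"
  shows "\<iota> a \<in> carrier B" "\<iota> (a \<oplus>\<^bsub>A\<^esub> b) = \<iota> a + \<iota> b" "\<iota> (a \<otimes>\<^bsub>A\<^esub> b) = \<iota> a \<otimes>\<^bsub>B\<^esub> \<iota> b"
    "\<iota> \<one>\<^bsub>A\<^esub> = \<one>\<^bsub>B\<^esub>" "\<iota> (c \<odot>\<^bsub>A\<^esub> a) = c \<odot>\<^bsub>B\<^esub> \<iota> a"
proof -
  have ab: "\<iota> a \<in> carrier B" "\<iota> b \<in> carrier B"
    using hom assms by (auto simp: alg_hom_def ring_hom_def)
  show "\<iota> a \<in> carrier B" "\<iota> (a \<oplus>\<^bsub>A\<^esub> b) = \<iota> a + \<iota> b" "\<iota> (a \<otimes>\<^bsub>A\<^esub> b) = \<iota> a \<otimes>\<^bsub>B\<^esub> \<iota> b"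
    "\<iota> \<one>\<^bsub>A\<^esub> = \<one>\<^bsub>B\<^esub>" "\<iota> (c \<odot>\<^bsub>A\<^esub> a) = c \<odot>\<^bsub>B\<^esub> \<iota> a"
    using hom assms B_add(1)[OF ab] ab by (auto simp: alg_hom_def ring_hom_def)
qed

lemma hom_closed: "a \<in> carrier A \<Longrightarrow> \<iota> a \<in> carrier B"
  by (rule hom_simps(1))

lemma B_uminus_closed: "x \<in> carrier B \<Longrightarrow> - x \<in> carrier B"
  using B_smult[of x "-1"] B_uminus by auto

lemma B_diff_closed: "x \<in> carrier B \<Longrightarrow> y \<in> carrier B \<Longrightarrow> x - y \<in> carrier B"
  using B_uminus_closed B_add(2)[of x "- y"] by auto

lemma alg_diff_B: "x \<in> carrier B \<Longrightarrow> y \<in> carrier B \<Longrightarrow> alg_diff B x y = x - y"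
  by (simp add: alg_diff_def B_uminus B_add B_uminus_closed)

lemma alg_diff_A_closed: "a \<in> carrier A \<Longrightarrow> b \<in> carrier A \<Longrightarrow> alg_diff A a b \<in> carrier A"
  by (simp add: alg_diff_def A_add A_smult)

lemma hom_alg_diff: "a \<in> carrier A \<Longrightarrow> b \<in> carrier A \<Longrightarrow> \<iota> (alg_diff A a b) = \<iota> a - \<iota> b"
  by (simp add: alg_diff_def hom_simps A_smult B_uminus)

lemma nrm_B_uminus: "\<rho> \<in> idx B \<Longrightarrow> x \<in> carrier B \<Longrightarrow> nrm B \<rho> (- x) = nrm B \<rho> x"
  using nrm_B_smult[of \<rho> x "-1"] B_uminus by simp

lemma nrm_B_commute:
  "\<rho> \<in> idx B \<Longrightarrow> x \<in> carrier B \<Longrightarrow> y \<in> carrier B \<Longrightarrow> nrm B \<rho> (x - y) = nrm B \<rho> (y - x)"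
  using nrm_B_uminus[of \<rho> "x - y"] by (simp add: B_diff_closed)

lemma nrm_B_nonneg: "\<rho> \<in> idx B \<Longrightarrow> x \<in> carrier B \<Longrightarrow> nrm B \<rho> x \<ge> 0"
  using nrm_B_add[of \<rho> x "- x"] by (simp add: B_uminus_closed nrm_B_uminus nrm_B_zero)

lemma nrm_B_triangle:
  "\<rho> \<in> idx B \<Longrightarrow> x \<in> carrier B \<Longrightarrow> y \<in> carrier B \<Longrightarrow> z \<in> carrier B \<Longrightarrow>
    nrm B \<rho> (x - z) \<le> nrm B \<rho> (x - y) + nrm B \<rho> (y - z)"
  using nrm_B_add[of \<rho> "x - y" "y - z"] by (simp add: B_diff_closed)

text \<open>
  Every Cauchy filter on \<open>A\<close> converges in \<open>B\<close>, and \<^const>\<open>Cauchy_rel\<close> relates exactly the filters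
  with the same limit. So \<open>limit_class\<close> is a bijection from \<open>B\<close> onto the completion of \<open>A\<close>, and its
  inverse is the required isomorphism.
\<close>

definition converges :: "'a filter \<Rightarrow> 'b \<Rightarrow> bool" where
  "converges F x \<longleftrightarrow> F \<noteq> bot \<and> F \<le> principal (carrier A) \<and>
    (\<forall>\<rho>\<in>idx B. ((\<lambda>a. nrm B \<rho> (\<iota> a - x)) \<longlongrightarrow> 0) F)"

definition limit_class :: "'b \<Rightarrow> 'a filter set" where
  "limit_class x = {F. converges F x}"

lemma convergesI:
  assumes "F \<noteq> bot" "\<forall>\<^sub>F a in F. a \<in> carrier A"
    and "\<And>\<rho>. \<rho> \<in> idx B \<Longrightarrow> ((\<lambda>a. nrm B \<rho> (\<iota> a - x)) \<longlongrightarrow> 0) F"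
  shows "converges F x"
  using assms by (auto simp: converges_def le_principal)

lemma convergesD:
  assumes "converges F x"
  shows "F \<noteq> bot" "F \<le> principal (carrier A)" "\<forall>\<^sub>F a in F. a \<in> carrier A"
    "\<rho> \<in> idx B \<Longrightarrow> ((\<lambda>a. nrm B \<rho> (\<iota> a - x)) \<longlongrightarrow> 0) F"
  using assms by (auto simp: converges_def le_principal)

section \<open>Limits in the larger algebra and equivalence of Cauchy filters\<close>

lemma prod_filter_limits:
  assumes "converges F x" "converges G y"
  shows "F \<times>\<^sub>F G \<noteq> bot"
    and "\<forall>\<^sub>F (a, b) in F \<times>\<^sub>F G. a \<in> carrier A \<and> b \<in> carrier A"
    and "\<rho> \<in> idx B \<Longrightarrow> ((\<lambda>(a, b). nrm B \<rho> (\<iota> a - x)) \<longlongrightarrow> 0) (F \<times>\<^sub>F G)"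
    and "\<rho> \<in> idx B \<Longrightarrow> ((\<lambda>(a, b). nrm B \<rho> (\<iota> b - y)) \<longlongrightarrow> 0) (F \<times>\<^sub>F G)"
proof -
  show "F \<times>\<^sub>F G \<noteq> bot" using assms by (simp add: convergesD prod_filter_eq_bot)
  show "\<forall>\<^sub>F (a, b) in F \<times>\<^sub>F G. a \<in> carrier A \<and> b \<in> carrier A"
    using eventually_prodI[OF convergesD(3)[OF assms(1)] convergesD(3)[OF assms(2)]]
    by (simp add: case_prod_unfold)
  show "((\<lambda>(a, b). nrm B \<rho> (\<iota> a - x)) \<longlongrightarrow> 0) (F \<times>\<^sub>F G)" if "\<rho> \<in> idx B"
    using filterlim_compose[OF convergesD(4)[OF assms(1) that] filterlim_fst]
    by (simp add: case_prod_unfold)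
  show "((\<lambda>(a, b). nrm B \<rho> (\<iota> b - y)) \<longlongrightarrow> 0) (F \<times>\<^sub>F G)" if "\<rho> \<in> idx B"
    using filterlim_compose[OF convergesD(4)[OF assms(2) that] filterlim_snd]
    by (simp add: case_prod_unfold)
qed

text \<open>Elements of both filters approach x in \<open>B\<close>, hence each other, and
  \<open>nrm_le1\<close> carries this back to \<open>A\<close>. For F = G this is the Cauchy
  property, for different filters it is their equivalence.\<close>

lemma converges_Cauchy_rel:
  assumes F: "converges F x" and G: "converges G x" and x: "x \<in> carrier B"
    and \<rho>: "\<rho> \<in> idx B"
  shows "((\<lambda>(a, b). nrm A \<rho> (alg_diff A a b)) \<longlongrightarrow> 0) (F \<times>\<^sub>F G)"
proof -
  obtain \<sigma> C where \<sigma>: "\<sigma> \<in> idx B" "C > 0" and C: "\<And>a. a \<in> carrier A \<Longrightarrow> nrm A \<rho> a \<le> C * nrm B \<sigma> (\<iota> a)"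
    using nrm_le1[OF \<rho>] by blast
  note lim = prod_filter_limits[OF F G]
  have L: "((\<lambda>p. C * ((\<lambda>(a, b). nrm B \<sigma> (\<iota> a - x)) p + (\<lambda>(a, b). nrm B \<sigma> (\<iota> b - x)) p)) \<longlongrightarrow> C * (0 + 0)) (F \<times>\<^sub>F G)"
    by (intro tendsto_intros lim \<sigma>)
  have ev: "\<forall>\<^sub>F p in F \<times>\<^sub>F G. 0 \<le> (\<lambda>(a, b). nrm A \<rho> (alg_diff A a b)) p \<and>
     (\<lambda>(a, b). nrm A \<rho> (alg_diff A a b)) p \<le> C * ((\<lambda>(a, b). nrm B \<sigma> (\<iota> a - x)) p + (\<lambda>(a, b). nrm B \<sigma> (\<iota> b - x)) p)"
    using lim(2)
  proof (rule eventually_mono, safe)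
    fix a b assume ab: "a \<in> carrier A" "b \<in> carrier A"
    show "0 \<le> nrm A \<rho> (alg_diff A a b)" using nrm_A_diff[OF \<rho> ab] by linarith
    have "nrm A \<rho> (alg_diff A a b) \<le> C * nrm B \<sigma> (\<iota> a - \<iota> b)"
      using C[OF alg_diff_A_closed[OF ab]] hom_alg_diff[OF ab] by simp
    also have "nrm B \<sigma> (\<iota> a - \<iota> b) \<le> nrm B \<sigma> (\<iota> a - x) + nrm B \<sigma> (x - \<iota> b)"
      using ab x hom_simps \<sigma> by (intro nrm_B_triangle) auto
    also have "nrm B \<sigma> (x - \<iota> b) = nrm B \<sigma> (\<iota> b - x)"
      using ab x hom_simps \<sigma> by (intro nrm_B_commute) auto
    finally show "nrm A \<rho> (alg_diff A a b) \<le> C * (nrm B \<sigma> (\<iota> a - x) + nrm B \<sigma> (\<iota> b - x))"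
      using \<sigma> by (simp add: mult_left_mono)
  qed
  show ?thesis
    by (rule tendsto_sandwich[OF _ _ tendsto_const, where h = "\<lambda>p. C * ((\<lambda>(a, b). nrm B \<sigma> (\<iota> a - x)) p + (\<lambda>(a, b). nrm B \<sigma> (\<iota> b - x)) p)"])
      (use ev L in \<open>auto elim: eventually_mono\<close>)
qed

lemma tendsto_zeroD: "((f :: 'c \<Rightarrow> real) \<longlongrightarrow> 0) F \<Longrightarrow> \<epsilon> > 0 \<Longrightarrow> \<forall>\<^sub>F p in F. f p < \<epsilon>"
  by (rule order_tendstoD(2))

lemma converges_Cauchy:
  assumes F: "converges F x" and x: "x \<in> carrier B"
  shows "F \<in> Cauchy_filters A"
  unfolding Cauchy_filters_def idx_eq
  using convergesD[OF F] tendsto_zeroD[OF converges_Cauchy_rel[OF F F x]]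
  by (auto simp: case_prod_unfold)

text \<open>By \<open>nrm_le2\<close> the image filter is Cauchy in \<open>B\<close>, where
  completeness supplies the limit.\<close>

lemma Cauchy_converges:
  assumes F: "F \<in> Cauchy_filters A"
  shows "\<exists>x\<in>carrier B. converges F x"
proof -
  have F': "F \<noteq> bot" "F \<le> principal (carrier A)" "\<forall>\<^sub>F a in F. a \<in> carrier A"
    using F by (auto simp: Cauchy_filters_def le_principal)
  have "filtermap \<iota> F \<in> Cauchy_filters B"
    unfolding Cauchy_filters_def
  proof (intro CollectI conjI ballI allI impI)
    show "filtermap \<iota> F \<noteq> bot" using F' by (simp add: filtermap_bot_iff)
    show "filtermap \<iota> F \<le> principal (carrier B)"
      using F'(3) hom_simps(1) by (auto simp: le_principal eventually_filtermap elim!: eventually_mono)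
    fix \<rho> and \<epsilon> :: real assume \<rho>: "\<rho> \<in> idx B" and \<epsilon>: "\<epsilon> > 0"
    obtain \<sigma> C where \<sigma>: "\<sigma> \<in> idx B" "C > 0" and C: "\<And>a. a \<in> carrier A \<Longrightarrow> nrm B \<rho> (\<iota> a) \<le> C * nrm A \<sigma> a"
      using nrm_le2[OF \<rho>] by blast
    have "\<forall>\<^sub>F p in F \<times>\<^sub>F F. nrm A \<sigma> (alg_diff A (fst p) (snd p)) < \<epsilon> / C"
      using F \<sigma> \<epsilon> by (auto simp: Cauchy_filters_def idx_eq case_prod_unfold)
    moreover have "\<forall>\<^sub>F p in F \<times>\<^sub>F F. fst p \<in> carrier A \<and> snd p \<in> carrier A"
      using eventually_prodI[OF F'(3) F'(3)] by simp
    ultimately have "\<forall>\<^sub>F p in F \<times>\<^sub>F F. nrm B \<rho> (alg_diff B (\<iota> (fst p)) (\<iota> (snd p))) < \<epsilon>"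
    proof eventually_elim
      case (elim p)
      have "nrm B \<rho> (\<iota> (alg_diff A (fst p) (snd p))) \<le> C * nrm A \<sigma> (alg_diff A (fst p) (snd p))"
        using elim by (intro C alg_diff_A_closed) auto
      also have "\<dots> < \<epsilon>" using elim \<sigma> by (simp add: field_simps)
      finally show ?case
        using elim alg_diff_B[of "\<iota> (fst p)" "\<iota> (snd p)"] by (simp add: hom_alg_diff hom_closed)
    qed
    then show "\<forall>\<^sub>F (a, b) in filtermap \<iota> F \<times>\<^sub>F filtermap \<iota> F. nrm B \<rho> (alg_diff B a b) < \<epsilon>"
      by (simp add: prod_filtermap1 prod_filtermap2 eventually_filtermap case_prod_unfold filtermap_filtermap)
  qed
  then obtain x where "x \<in> carrier B" "\<forall>\<rho>\<in>idx B. ((\<lambda>y. nrm B \<rho> (y - x)) \<longlongrightarrow> 0) (filtermap \<iota> F)"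
    using B_complete by blast
  then show ?thesis
    using F' by (auto simp: converges_def filterlim_filtermap)
qed

text \<open>An argument with \<epsilon>/3 along the path x, \<iota> a, \<iota> b, y: the outer steps
  are small by convergence, the middle one because equivalent filters are close in \<open>A\<close>.
  The Hausdorff property then turns vanishing seminorms into equality.\<close>

lemma converges_unique:
  assumes F: "converges F x" and G: "converges G y" and xy: "x \<in> carrier B" "y \<in> carrier B"
    and rel: "(F, G) \<in> Cauchy_rel A"
  shows "x = y"
proof -
  have "nrm B \<rho> (x - y) = 0" if \<rho>: "\<rho> \<in> idx B" for \<rho>
  proof -
    obtain \<sigma> C where \<sigma>: "\<sigma> \<in> idx B" "C > 0" and C: "\<And>a. a \<in> carrier A \<Longrightarrow> nrm B \<rho> (\<iota> a) \<le> C * nrm A \<sigma> a"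
      using nrm_le2[OF \<rho>] by blast
    note lim = prod_filter_limits[OF F G]
    have "nrm B \<rho> (x - y) \<le> 0 + \<epsilon>" if \<epsilon>: "\<epsilon> > 0" for \<epsilon>
    proof -
      have "\<forall>\<^sub>F p in F \<times>\<^sub>F G. nrm A \<sigma> (alg_diff A (fst p) (snd p)) < \<epsilon> / 3 / C"
        using rel \<sigma> \<epsilon> by (auto simp: Cauchy_rel_def idx_eq case_prod_unfold)
      moreover have "\<forall>\<^sub>F p in F \<times>\<^sub>F G. nrm B \<rho> (\<iota> (fst p) - x) < \<epsilon> / 3"
        using tendsto_zeroD[OF lim(3)[OF \<rho>], of "\<epsilon>/3"] \<epsilon> by (simp add: case_prod_unfold)
      moreover have "\<forall>\<^sub>F p in F \<times>\<^sub>F G. nrm B \<rho> (\<iota> (snd p) - y) < \<epsilon> / 3"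
        using tendsto_zeroD[OF lim(4)[OF \<rho>], of "\<epsilon>/3"] \<epsilon> by (simp add: case_prod_unfold)
      moreover note lim(2)
      ultimately have "\<forall>\<^sub>F p in F \<times>\<^sub>F G. nrm B \<rho> (x - y) \<le> \<epsilon>"
      proof eventually_elim
        case (elim p)
        obtain a b where p: "p = (a, b)" by (cases p)
        have ab: "a \<in> carrier A" "b \<in> carrier A" using elim p by auto
        note h = hom_simps(1)[OF ab(1) ab(1)] hom_simps(1)[OF ab(2) ab(2)]
        have "nrm B \<rho> (x - y) \<le> nrm B \<rho> (x - \<iota> a) + nrm B \<rho> (\<iota> a - y)"
          using h xy \<rho> by (intro nrm_B_triangle) auto
        also have "nrm B \<rho> (\<iota> a - y) \<le> nrm B \<rho> (\<iota> a - \<iota> b) + nrm B \<rho> (\<iota> b - y)"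
          using h xy \<rho> by (intro nrm_B_triangle) auto
        also have "nrm B \<rho> (\<iota> a - \<iota> b) \<le> C * nrm A \<sigma> (alg_diff A a b)"
          using C[OF alg_diff_A_closed[OF ab]] hom_alg_diff[OF ab] by simp
        also have "\<dots> \<le> \<epsilon> / 3" using elim p \<sigma> by (simp add: field_simps)
        finally show ?case using elim p \<epsilon> nrm_B_commute[OF \<rho> h(1) xy(1)] by simp
      qed
      then show ?thesis using eventually_const[OF lim(1)] by simp
    qed
    then have "nrm B \<rho> (x - y) \<le> 0" by (rule field_le_epsilon)
    then show ?thesis using nrm_B_nonneg[OF \<rho> B_diff_closed[OF xy]] by simp
  qed
  then have "x - y = 0" using B_Hausdorff B_diff_closed xy by blast
  then show ?thesis by simp
qed

lemma Cauchy_rel_iff: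
  assumes F: "converges F x" and x: "x \<in> carrier B"
  shows "(F, G) \<in> Cauchy_rel A \<longleftrightarrow> converges G x"
proof
  assume rel: "(F, G) \<in> Cauchy_rel A"
  then have "G \<in> Cauchy_filters A" by (auto simp: Cauchy_rel_def)
  then obtain y where y: "y \<in> carrier B" "converges G y" using Cauchy_converges by blast
  then show "converges G x" using converges_unique[OF F y(2) x y(1) rel] by simp
next
  assume G: "converges G x"
  show "(F, G) \<in> Cauchy_rel A"
    unfolding Cauchy_rel_def idx_eq
    using converges_Cauchy[OF F x] converges_Cauchy[OF G x] tendsto_zeroD[OF converges_Cauchy_rel[OF F G x]]
    by (auto simp: case_prod_unfold)
qed

lemma Cauchy_rel_class: "converges F x \<Longrightarrow> x \<in> carrier B \<Longrightarrow> Cauchy_rel A `` {F} = limit_class x"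
  by (auto simp: limit_class_def Cauchy_rel_iff)

lemma limit_class_nonempty: "x \<in> carrier B \<Longrightarrow> \<exists>F. converges F x"
  using dense by (auto simp: converges_def)

lemma carrier_completion: "carrier (alg_completion A) = limit_class ` carrier B"
proof
  show "carrier (alg_completion A) \<subseteq> limit_class ` carrier B"
    unfolding alg_completion_def
    by (auto simp: quotient_def Cauchy_rel_class dest!: Cauchy_converges)
  show "limit_class ` carrier B \<subseteq> carrier (alg_completion A)"
    unfolding alg_completion_def
  proof (clarsimp)
    fix x assume x: "x \<in> carrier B"
    obtain F where F: "converges F x" using limit_class_nonempty[OF x] by blast
    show "limit_class x \<in> Cauchy_filters A // Cauchy_rel A"
      using quotientI[OF converges_Cauchy[OF F x], of "Cauchy_rel A"] Cauchy_rel_class[OF F x] by simp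
  qed
qed

lemma inj_limit_class: "inj_on limit_class (carrier B)"
proof (rule inj_onI)
  fix x y assume xy: "x \<in> carrier B" "y \<in> carrier B" "limit_class x = limit_class y"
  obtain F where F: "converges F x" using limit_class_nonempty xy by blast
  then have F': "converges F y" using xy by (auto simp: limit_class_def)
  show "x = y" using converges_unique[OF F F' xy(1,2)] Cauchy_rel_iff[OF F xy(1)] F by blast
qed

section \<open>Continuity of the operations along filters\<close>

lemma converges_principal:
  assumes "a \<in> carrier A" shows "converges (principal {a}) (\<iota> a)"
proof (rule convergesI)
  show "((\<lambda>b. nrm B \<rho> (\<iota> b - \<iota> a)) \<longlongrightarrow> 0) (principal {a})" if "\<rho> \<in> idx B" for \<rho>
    by (rule tendsto_eventually) (use that in \<open>simp add: eventually_principal nrm_B_zero\<close>)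
qed (use assms in \<open>auto simp: eventually_principal principal_eq_bot_iff\<close>)

text \<open>Common frame for the three operations: P is a product filter for sums and products, and
  a single filter for scalar multiples.\<close>

lemma converges_filtermap:
  assumes P: "P \<noteq> bot" and x: "x \<in> carrier B" and f: "\<forall>\<^sub>F p in P. f p \<in> carrier A"
    and h: "\<And>\<rho>. \<rho> \<in> idx B \<Longrightarrow> (h \<rho> \<longlongrightarrow> 0) P"
    and le: "\<And>\<rho>. \<rho> \<in> idx B \<Longrightarrow> \<forall>\<^sub>F p in P. nrm B \<rho> (\<iota> (f p) - x) \<le> h \<rho> p"
  shows "converges (filtermap f P) x"
proof (rule convergesI)
  fix \<rho> assume \<rho>: "\<rho> \<in> idx B"
  have "\<forall>\<^sub>F p in P. norm (nrm B \<rho> (\<iota> (f p) - x)) \<le> h \<rho> p"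
    using f le[OF \<rho>] by eventually_elim (simp add: nrm_B_nonneg \<rho> B_diff_closed hom_closed x)
  from Lim_null_comparison[OF this h[OF \<rho>]]
  show "((\<lambda>a. nrm B \<rho> (\<iota> a - x)) \<longlongrightarrow> 0) (filtermap f P)" by (simp add: filterlim_filtermap)
qed (use P f in \<open>simp_all add: filtermap_bot_iff eventually_filtermap\<close>)

lemma converges_add:
  assumes F: "converges F x" and G: "converges G y" and xy: "x \<in> carrier B" "y \<in> carrier B"
  shows "converges (filtermap (\<lambda>(a, b). a \<oplus>\<^bsub>A\<^esub> b) (F \<times>\<^sub>F G)) (x + y)"
proof (rule converges_filtermap[OF _ B_add(2)[OF xy]])
  note lim = prod_filter_limits[OF F G]
  let ?h = "\<lambda>\<rho> p. (\<lambda>(a, b). nrm B \<rho> (\<iota> a - x)) p + (\<lambda>(a, b). nrm B \<rho> (\<iota> b - y)) p"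
  show "F \<times>\<^sub>F G \<noteq> bot" by (rule lim)
  show "\<forall>\<^sub>F p in F \<times>\<^sub>F G. (\<lambda>(a, b). a \<oplus>\<^bsub>A\<^esub> b) p \<in> carrier A"
    using lim(2) by (rule eventually_mono) (auto simp: A_add)
  fix \<rho> assume \<rho>: "\<rho> \<in> idx B"
  show "(?h \<rho> \<longlongrightarrow> 0) (F \<times>\<^sub>F G)"
    using tendsto_add[OF lim(3)[OF \<rho>] lim(4)[OF \<rho>]] by simp
  show "\<forall>\<^sub>F p in F \<times>\<^sub>F G. nrm B \<rho> (\<iota> ((\<lambda>(a, b). a \<oplus>\<^bsub>A\<^esub> b) p) - (x + y)) \<le> ?h \<rho> p"
    using lim(2)
  proof (rule eventually_mono, clarsimp)
    fix a b assume ab: "a \<in> carrier A" "b \<in> carrier A"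
    have "nrm B \<rho> ((\<iota> a - x) + (\<iota> b - y)) \<le> nrm B \<rho> (\<iota> a - x) + nrm B \<rho> (\<iota> b - y)"
      using ab xy by (intro nrm_B_add \<rho> B_diff_closed hom_closed)
    then show "nrm B \<rho> (\<iota> (a \<oplus>\<^bsub>A\<^esub> b) - (x + y)) \<le> nrm B \<rho> (\<iota> a - x) + nrm B \<rho> (\<iota> b - y)"
      using ab by (simp add: hom_simps algebra_simps)
  qed
qed

lemma converges_mult:
  assumes F: "converges F x" and G: "converges G y" and xy: "x \<in> carrier B" "y \<in> carrier B"
  shows "converges (filtermap (\<lambda>(a, b). a \<otimes>\<^bsub>A\<^esub> b) (F \<times>\<^sub>F G)) (x \<otimes>\<^bsub>B\<^esub> y)"
proof -
  note lim = prod_filter_limits[OF F G]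
  obtain C where C: "\<And>\<rho> u v. \<rho> \<in> idx B \<Longrightarrow> u \<in> carrier B \<Longrightarrow> v \<in> carrier B \<Longrightarrow>
      nrm B \<rho> (u \<otimes>\<^bsub>B\<^esub> v) \<le> C \<rho> * nrm B \<rho> u * nrm B \<rho> v"
    using nrm_B_mult by metis
  let ?f = "\<lambda>\<rho> (a, b). nrm B \<rho> (\<iota> a - x)" and ?g = "\<lambda>\<rho> (a, b). nrm B \<rho> (\<iota> b - y)"
  \<comment> \<open>The majorant comes from \<iota> a \<iota> b - x y = (\<iota> a - x) \<iota> b +
    x (\<iota> b - y), where \<iota> b is estimated by its distance to y plus y itself. The absolute
    value makes the constant nonnegative.\<close>
  let ?h = "\<lambda>\<rho> p. \<bar>C \<rho>\<bar> * ?f \<rho> p * (?g \<rho> p + nrm B \<rho> y) + \<bar>C \<rho>\<bar> * nrm B \<rho> x * ?g \<rho> p"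
  show ?thesis
  proof (rule converges_filtermap[OF _ B_mult[OF xy]])
    show "F \<times>\<^sub>F G \<noteq> bot" by (rule lim)
    show "\<forall>\<^sub>F p in F \<times>\<^sub>F G. (\<lambda>(a, b). a \<otimes>\<^bsub>A\<^esub> b) p \<in> carrier A"
      using lim(2) by (rule eventually_mono) (auto simp: A_mult)
    fix \<rho> assume \<rho>: "\<rho> \<in> idx B"
    have "(?h \<rho> \<longlongrightarrow> \<bar>C \<rho>\<bar> * 0 * (0 + nrm B \<rho> y) + \<bar>C \<rho>\<bar> * nrm B \<rho> x * 0) (F \<times>\<^sub>F G)"
      by (intro tendsto_add tendsto_mult tendsto_const lim \<rho>)
    then show "(?h \<rho> \<longlongrightarrow> 0) (F \<times>\<^sub>F G)" by simp
    show "\<forall>\<^sub>F p in F \<times>\<^sub>F G. nrm B \<rho> (\<iota> ((\<lambda>(a, b). a \<otimes>\<^bsub>A\<^esub> b) p) - x \<otimes>\<^bsub>B\<^esub> y) \<le> ?h \<rho> p"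
      using lim(2)
    proof (rule eventually_mono, clarsimp)
      fix a b assume ab: "a \<in> carrier A" "b \<in> carrier A"
      note h = ab[THEN hom_closed]
      note d = B_diff_closed[OF h(1) xy(1)] B_diff_closed[OF h(2) xy(2)]
      have C': "nrm B \<rho> (u \<otimes>\<^bsub>B\<^esub> v) \<le> \<bar>C \<rho>\<bar> * nrm B \<rho> u * nrm B \<rho> v"
        if "u \<in> carrier B" "v \<in> carrier B" for u v
        using C[OF \<rho> that] nrm_B_nonneg[OF \<rho> that(1)] nrm_B_nonneg[OF \<rho> that(2)]
        by (meson abs_ge_self mult_right_mono order_trans)
      have "\<iota> a \<otimes>\<^bsub>B\<^esub> \<iota> b - x \<otimes>\<^bsub>B\<^esub> y = (\<iota> a - x) \<otimes>\<^bsub>B\<^esub> \<iota> b + x \<otimes>\<^bsub>B\<^esub> (\<iota> b - y)"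
        using h xy by (simp add: B_mult_diff_left B_mult_diff_right)
      then have "nrm B \<rho> (\<iota> a \<otimes>\<^bsub>B\<^esub> \<iota> b - x \<otimes>\<^bsub>B\<^esub> y) \<le>
          nrm B \<rho> ((\<iota> a - x) \<otimes>\<^bsub>B\<^esub> \<iota> b) + nrm B \<rho> (x \<otimes>\<^bsub>B\<^esub> (\<iota> b - y))"
        using h xy d by (auto intro!: nrm_B_add \<rho> B_mult)
      also have "nrm B \<rho> ((\<iota> a - x) \<otimes>\<^bsub>B\<^esub> \<iota> b) \<le> \<bar>C \<rho>\<bar> * nrm B \<rho> (\<iota> a - x) * nrm B \<rho> (\<iota> b)"
        by (intro C' d h)
      also have "\<dots> \<le> \<bar>C \<rho>\<bar> * nrm B \<rho> (\<iota> a - x) * (nrm B \<rho> (\<iota> b - y) + nrm B \<rho> y)"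
        using nrm_B_add[OF \<rho> d(2) xy(2)] nrm_B_nonneg[OF \<rho> d(1)] by (intro mult_left_mono) auto
      also have "nrm B \<rho> (x \<otimes>\<^bsub>B\<^esub> (\<iota> b - y)) \<le> \<bar>C \<rho>\<bar> * nrm B \<rho> x * nrm B \<rho> (\<iota> b - y)"
        by (intro C' d xy)
      finally show "nrm B \<rho> (\<iota> (a \<otimes>\<^bsub>A\<^esub> b) - x \<otimes>\<^bsub>B\<^esub> y) \<le> \<bar>C \<rho>\<bar> * nrm B \<rho> (\<iota> a - x) *
          (nrm B \<rho> (\<iota> b - y) + nrm B \<rho> y) + \<bar>C \<rho>\<bar> * nrm B \<rho> x * nrm B \<rho> (\<iota> b - y)"
        using ab by (simp add: hom_simps)
    qed
  qed
qed

lemma converges_smult: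
  assumes F: "converges F x" and x: "x \<in> carrier B"
  shows "converges (filtermap (\<lambda>a. c \<odot>\<^bsub>A\<^esub> a) F) (c \<odot>\<^bsub>B\<^esub> x)"
proof (rule converges_filtermap[OF convergesD(1)[OF F] B_smult[OF x]])
  show "\<forall>\<^sub>F a in F. c \<odot>\<^bsub>A\<^esub> a \<in> carrier A"
    using convergesD(3)[OF F] by (rule eventually_mono) (rule A_smult)
  fix \<rho> assume \<rho>: "\<rho> \<in> idx B"
  show "((\<lambda>a. cmod c * nrm B \<rho> (\<iota> a - x)) \<longlongrightarrow> 0) F"
    using tendsto_mult_right_zero[OF convergesD(4)[OF F \<rho>]] .
  show "\<forall>\<^sub>F a in F. nrm B \<rho> (\<iota> (c \<odot>\<^bsub>A\<^esub> a) - c \<odot>\<^bsub>B\<^esub> x) \<le> cmod c * nrm B \<rho> (\<iota> a - x)"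
    using convergesD(3)[OF F]
    by (rule eventually_mono)
      (simp add: hom_simps hom_closed x \<rho> B_diff_closed flip: B_smult_diff nrm_B_smult)
qed

text \<open>Operations of the completion are unions over all representatives; they collapse because
  every representative yields the same class.\<close>

lemma UNION_const_class:
  assumes "x \<in> carrier B" "\<And>F. converges F x \<Longrightarrow> f F = Z"
  shows "(\<Union>F\<in>limit_class x. f F) = Z"
  using limit_class_nonempty[OF assms(1)] assms(2) by (auto simp: limit_class_def)

lemma completion_ops:
  assumes xy: "x \<in> carrier B" "y \<in> carrier B"
  shows "limit_class x \<oplus>\<^bsub>alg_completion A\<^esub> limit_class y = limit_class (x + y)"
    and "limit_class x \<otimes>\<^bsub>alg_completion A\<^esub> limit_class y = limit_class (x \<otimes>\<^bsub>B\<^esub> y)"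
    and "c \<odot>\<^bsub>alg_completion A\<^esub> limit_class x = limit_class (c \<odot>\<^bsub>B\<^esub> x)"
    and "\<one>\<^bsub>alg_completion A\<^esub> = limit_class \<one>\<^bsub>B\<^esub>"
  unfolding alg_completion_def
  using xy converges_principal[OF A_one] hom_simps(4)[OF A_one A_one]
  by (auto intro!: UNION_const_class Cauchy_rel_class converges_add converges_mult converges_smult
      B_add B_mult B_smult B_one simp del: UN_simps)

lemma alg_diff_completion:
  assumes xy: "x \<in> carrier B" "y \<in> carrier B"
  shows "alg_diff (alg_completion A) (limit_class x) (limit_class y) = limit_class (x - y)"
  using xy by (simp add: alg_diff_def completion_ops B_smult B_uminus B_uminus_closed)

section \<open>Seminorms of the completion\<close>

abbreviation completed_nrm :: "real \<Rightarrow> 'b \<Rightarrow> real" where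
  "completed_nrm \<rho> x \<equiv> nrm (alg_completion A) \<rho> (limit_class x)"

text \<open>By the reverse triangle inequality the seminorm is a Cauchy family of reals along the
  chosen representative, so its limit exists; equivalence of filters makes the limit independent of
  the representative.\<close>

lemma nrm_completion:
  assumes x: "x \<in> carrier B" and \<rho>: "\<rho> \<in> idx B" and G: "converges G x"
  shows "(nrm A \<rho> \<longlongrightarrow> completed_nrm \<rho> x) G"
proof -
  define F where "F = (SOME F. F \<in> limit_class x)"
  have F: "converges F x"
    unfolding F_def using limit_class_nonempty[OF x] someI[of "\<lambda>F. F \<in> limit_class x"]
    by (auto simp: limit_class_def)
  have "cauchy_filter (filtermap (nrm A \<rho>) F)"
    unfolding cauchy_filter_metric_filtermap
  proof (intro allI impI)
    fix e :: real assume e: "e > 0"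
    have "\<forall>\<^sub>F p in F \<times>\<^sub>F F. nrm A \<rho> (alg_diff A (fst p) (snd p)) < e"
      using tendsto_zeroD[OF converges_Cauchy_rel[OF F F x \<rho>] e] by (simp add: case_prod_unfold)
    then obtain P where P: "eventually P F" "\<And>a b. P a \<Longrightarrow> P b \<Longrightarrow> nrm A \<rho> (alg_diff A a b) < e"
      unfolding eventually_prod_same by (auto simp: split_beta)
    have "dist (nrm A \<rho> a) (nrm A \<rho> b) < e"
      if "P a \<and> a \<in> carrier A" "P b \<and> b \<in> carrier A" for a b
      using nrm_A_diff[OF \<rho>, of a b] P(2)[of a b] that by (auto simp: dist_real_def)
    moreover have "\<forall>\<^sub>F a in F. P a \<and> a \<in> carrier A" using P(1) convergesD(3)[OF F] by (rule eventually_conj)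
    ultimately show "\<exists>P. eventually P F \<and> (\<forall>x y. P x \<and> P y \<longrightarrow> dist (nrm A \<rho> x) (nrm A \<rho> y) < e)"
      by blast
  qed
  moreover have "filtermap (nrm A \<rho>) F \<noteq> bot" using convergesD(1)[OF F] by (simp add: filtermap_bot_iff)
  ultimately obtain l where "filtermap (nrm A \<rho>) F \<le> nhds l"
    using complete_uniform[of "UNIV::real set"] complete_UNIV by (auto)
  then have l: "(nrm A \<rho> \<longlongrightarrow> l) F" by (simp add: filterlim_def)
  then have "completed_nrm \<rho> x = l"
    using tendsto_Lim[OF convergesD(1)[OF F] l] by (simp add: alg_completion_def F_def)
  \<comment> \<open>On the product of F and G the seminorm of the first entry tends to l and the
    difference of the two seminorms tends to 0. Projecting to the second entry gives back G, since F
    is nontrivial.\<close>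
  moreover have "(nrm A \<rho> \<longlongrightarrow> l) G"
  proof -
    note lim = prod_filter_limits[OF F G]
    have "((\<lambda>p. nrm A \<rho> (fst p)) \<longlongrightarrow> l) (F \<times>\<^sub>F G)"
      by (rule filterlim_compose[OF l filterlim_fst])
    moreover have "((\<lambda>p. nrm A \<rho> (snd p) - nrm A \<rho> (fst p)) \<longlongrightarrow> 0) (F \<times>\<^sub>F G)"
    proof (rule Lim_null_comparison)
      show "((\<lambda>(a, b). nrm A \<rho> (alg_diff A a b)) \<longlongrightarrow> 0) (F \<times>\<^sub>F G)"
        by (rule converges_Cauchy_rel[OF F G x \<rho>])
      show "\<forall>\<^sub>F p in F \<times>\<^sub>F G. norm (nrm A \<rho> (snd p) - nrm A \<rho> (fst p)) \<le> (\<lambda>(a, b). nrm A \<rho> (alg_diff A a b)) p"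
        using lim(2) by (rule eventually_mono) (auto simp: abs_minus_commute intro!: nrm_A_diff \<rho>)
    qed
    ultimately have "((\<lambda>p. nrm A \<rho> (fst p) + (nrm A \<rho> (snd p) - nrm A \<rho> (fst p))) \<longlongrightarrow> l + 0) (F \<times>\<^sub>F G)"
      by (rule tendsto_add)
    then have "(nrm A \<rho> \<longlongrightarrow> l) (filtermap snd (F \<times>\<^sub>F G))" by (simp add: filterlim_filtermap)
    moreover have "filtermap snd (F \<times>\<^sub>F G) = G"
      using eventually_prod2[OF convergesD(1)[OF F], of _ G]
      by (simp add: filter_eq_iff eventually_filtermap case_prod_unfold)
    ultimately show ?thesis by simp
  qed
  ultimately show ?thesis by simp
qed

lemma nrm_completion_add:
  assumes xy: "x \<in> carrier B" "y \<in> carrier B" and \<rho>: "\<rho> \<in> idx B"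
  shows "completed_nrm \<rho> (x + y) \<le>
    completed_nrm \<rho> x + completed_nrm \<rho> y"
proof -
  obtain F G where F: "converges F x" and G: "converges G y" using limit_class_nonempty xy by blast
  note lim = prod_filter_limits[OF F G]
  show ?thesis
  proof (rule tendsto_le[OF lim(1)])
    show "((\<lambda>p. nrm A \<rho> ((\<lambda>(a, b). a \<oplus>\<^bsub>A\<^esub> b) p)) \<longlongrightarrow> completed_nrm \<rho> (x + y)) (F \<times>\<^sub>F G)"
      using nrm_completion[OF B_add(2)[OF xy] \<rho> converges_add[OF F G xy]] by (simp add: filterlim_filtermap)
    show "((\<lambda>p. nrm A \<rho> (fst p) + nrm A \<rho> (snd p)) \<longlongrightarrow>
        completed_nrm \<rho> x + completed_nrm \<rho> y) (F \<times>\<^sub>F G)"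
      using nrm_completion xy \<rho> F G
      by (intro tendsto_add filterlim_compose[OF _ filterlim_fst] filterlim_compose[OF _ filterlim_snd]) auto
    show "\<forall>\<^sub>F p in F \<times>\<^sub>F G. nrm A \<rho> ((\<lambda>(a, b). a \<oplus>\<^bsub>A\<^esub> b) p) \<le> nrm A \<rho> (fst p) + nrm A \<rho> (snd p)"
      using lim(2) by (rule eventually_mono) (auto intro!: nrm_A_add \<rho>)
  qed
qed

lemma nrm_B_tendsto:
  assumes F: "converges F x" and x: "x \<in> carrier B" and \<rho>: "\<rho> \<in> idx B"
  shows "((\<lambda>a. nrm B \<rho> (\<iota> a)) \<longlongrightarrow> nrm B \<rho> x) F"
proof -
  have "((\<lambda>a. nrm B \<rho> (\<iota> a) - nrm B \<rho> x) \<longlongrightarrow> 0) F"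
  proof (rule Lim_null_comparison)
    show "((\<lambda>a. nrm B \<rho> (\<iota> a - x)) \<longlongrightarrow> 0) F" by (rule convergesD(4)[OF F \<rho>])
    show "\<forall>\<^sub>F a in F. norm (nrm B \<rho> (\<iota> a) - nrm B \<rho> x) \<le> nrm B \<rho> (\<iota> a - x)"
      using convergesD(3)[OF F]
    proof (rule eventually_mono)
      fix a assume a: "a \<in> carrier A"
      note h = hom_simps(1)[OF a a]
      have "nrm B \<rho> (\<iota> a) \<le> nrm B \<rho> (\<iota> a - x) + nrm B \<rho> x"
        using nrm_B_add[OF \<rho> B_diff_closed[OF h x] x] by simp
      moreover have "nrm B \<rho> x \<le> nrm B \<rho> (x - \<iota> a) + nrm B \<rho> (\<iota> a)"
        using nrm_B_add[OF \<rho> B_diff_closed[OF x h] h] by simp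
      ultimately show "norm (nrm B \<rho> (\<iota> a) - nrm B \<rho> x) \<le> nrm B \<rho> (\<iota> a - x)"
        using nrm_B_commute[OF \<rho> h x] by simp
    qed
  qed
  then show ?thesis by (simp add: LIM_zero_iff)
qed

text \<open>The inequalities between the seminorms on \<open>A\<close> are preserved by limits, so
  they extend to \<open>B\<close> with the same radii and constants.\<close>

lemma nrm_completion_le:
  assumes \<rho>: "\<rho> \<in> idx B"
  shows "\<exists>\<sigma>\<in>idx B. \<exists>C>0. \<forall>x\<in>carrier B. completed_nrm \<rho> x \<le> C * nrm B \<sigma> x"
    and "\<exists>\<sigma>\<in>idx B. \<exists>C>0. \<forall>x\<in>carrier B. nrm B \<rho> x \<le> C * completed_nrm \<sigma> x"
proof -
  obtain \<sigma> C where \<sigma>: "\<sigma> \<in> idx B" "C > 0" and C: "\<And>a. a \<in> carrier A \<Longrightarrow> nrm A \<rho> a \<le> C * nrm B \<sigma> (\<iota> a)"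
    using nrm_le1[OF \<rho>] by blast
  have "completed_nrm \<rho> x \<le> C * nrm B \<sigma> x" if x: "x \<in> carrier B" for x
  proof -
    obtain F where F: "converges F x" using limit_class_nonempty x by blast
    show ?thesis
      using convergesD(3)[OF F] C
      by (intro tendsto_le[OF convergesD(1)[OF F] tendsto_mult[OF tendsto_const nrm_B_tendsto[OF F x \<sigma>(1)]]
            nrm_completion[OF x \<rho> F]]) (auto elim: eventually_mono)
  qed
  then show "\<exists>\<sigma>\<in>idx B. \<exists>C>0. \<forall>x\<in>carrier B. completed_nrm \<rho> x \<le> C * nrm B \<sigma> x"
    using \<sigma> by blast
  obtain \<sigma> C where \<sigma>: "\<sigma> \<in> idx B" "C > 0" and C: "\<And>a. a \<in> carrier A \<Longrightarrow> nrm B \<rho> (\<iota> a) \<le> C * nrm A \<sigma> a"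
    using nrm_le2[OF \<rho>] by blast
  have "nrm B \<rho> x \<le> C * completed_nrm \<sigma> x" if x: "x \<in> carrier B" for x
  proof -
    obtain F where F: "converges F x" using limit_class_nonempty x by blast
    show ?thesis
      using convergesD(3)[OF F] C
      by (intro tendsto_le[OF convergesD(1)[OF F] tendsto_mult[OF tendsto_const nrm_completion[OF x \<sigma>(1) F]]
            nrm_B_tendsto[OF F x \<rho>]]) (auto elim: eventually_mono)
  qed
  then show "\<exists>\<sigma>\<in>idx B. \<exists>C>0. \<forall>x\<in>carrier B. nrm B \<rho> x \<le> C * completed_nrm \<sigma> x"
    using \<sigma> by blast
qed

theorem completion_isomorphic: "topologically_isomorphic (alg_completion A) B"
proof -
  let ?C = "alg_completion A"
  define h where "h = the_inv_into (carrier B) limit_class"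
  have h [simp]: "h (limit_class x) = x" if "x \<in> carrier B" for x
    unfolding h_def by (rule the_inv_into_f_f[OF inj_limit_class that])
  have idx [simp]: "idx ?C = idx B" by (simp add: alg_completion_def idx_eq)
  \<comment> \<open>Bounded above by a multiple of the seminorm of 0 in \<open>B\<close>, and below
    by subadditivity applied to 0 + 0.\<close>
  have zero: "nrm ?C \<rho> (limit_class 0) = 0" if \<rho>: "\<rho> \<in> idx B" for \<rho>
  proof -
    obtain \<sigma> C where "\<sigma> \<in> idx B" "nrm ?C \<rho> (limit_class 0) \<le> C * nrm B \<sigma> 0"
      using nrm_completion_le(1)[OF \<rho>] B_zero(2) by blast
    then show ?thesis using nrm_completion_add[OF B_zero(2) B_zero(2) \<rho>] by (simp add: nrm_B_zero)
  qed
  have "h \<in> alg_hom ?C B"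
    unfolding alg_hom_def ring_hom_def carrier_completion
    by (auto simp: completion_ops completion_ops(4)[OF B_zero(2) B_zero(2)] B_add B_mult B_smult B_one)
  moreover have "homeomorphic_maps (alg_topology ?C) (alg_topology B) h limit_class"
    unfolding homeomorphic_maps_def
  proof (intro conjI ballI)
    show "continuous_map (alg_topology ?C) (alg_topology B) h"
    proof (rule continuous_map_alg_topology)
      show "\<exists>\<sigma>\<in>idx ?C. \<exists>C>0. \<forall>a\<in>carrier ?C. \<forall>b\<in>carrier ?C.
        nrm B \<rho> (alg_diff B (h a) (h b)) \<le> C * nrm ?C \<sigma> (alg_diff ?C a b)" if \<rho>: "\<rho> \<in> idx B" for \<rho>
      proof -
        obtain \<sigma> C where "\<sigma> \<in> idx B" "C > 0"
          "\<And>x. x \<in> carrier B \<Longrightarrow> nrm B \<rho> x \<le> C * nrm ?C \<sigma> (limit_class x)"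
          using nrm_completion_le(2)[OF \<rho>] by blast
        then show ?thesis
          by (auto simp: carrier_completion alg_diff_completion alg_diff_B B_diff_closed
              intro!: bexI[of _ \<sigma>] exI[of _ C])
      qed
    qed (auto simp: carrier_completion idx_nonempty alg_diff_completion alg_diff_B zero nrm_B_zero
        intro: nrm_B_triangle)
    show "continuous_map (alg_topology B) (alg_topology ?C) limit_class"
    proof (rule continuous_map_alg_topology)
      show "\<exists>\<sigma>\<in>idx B. \<exists>C>0. \<forall>a\<in>carrier B. \<forall>b\<in>carrier B.
        nrm ?C \<rho> (alg_diff ?C (limit_class a) (limit_class b)) \<le> C * nrm B \<sigma> (alg_diff B a b)"
        if \<rho>: "\<rho> \<in> idx ?C" for \<rho>
      proof -
        obtain \<sigma> C where "\<sigma> \<in> idx B" "C > 0"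
          "\<And>x. x \<in> carrier B \<Longrightarrow> nrm ?C \<rho> (limit_class x) \<le> C * nrm B \<sigma> x"
          using nrm_completion_le(1)[of \<rho>] \<rho> by auto
        then show ?thesis
          by (auto simp: alg_diff_completion alg_diff_B B_diff_closed intro!: bexI[of _ \<sigma>] exI[of _ C])
      qed
      show "nrm ?C \<rho> (alg_diff ?C a c) \<le> nrm ?C \<rho> (alg_diff ?C a b) + nrm ?C \<rho> (alg_diff ?C b c)"
        if \<rho>: "\<rho> \<in> idx ?C" and abc: "a \<in> carrier ?C" "b \<in> carrier ?C" "c \<in> carrier ?C" for \<rho> a b c
      proof -
        obtain x y z where "x \<in> carrier B" "y \<in> carrier B" "z \<in> carrier B"
          "a = limit_class x" "b = limit_class y" "c = limit_class z"
          using abc by (auto simp: carrier_completion)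
        then show ?thesis
          using nrm_completion_add[of "x - y" "y - z" \<rho>] \<rho> by (simp add: B_diff_closed alg_diff_completion)
      qed
    qed (auto simp: carrier_completion idx_nonempty alg_diff_completion alg_diff_B zero nrm_B_zero)
    have sub: "topspace (alg_topology X) \<subseteq> carrier X" for X :: "'c seminormed_alg"
      by (auto simp: alg_topology_def topology_generated_by_topspace)
    show "limit_class (h u) = u" if "u \<in> topspace (alg_topology ?C)" for u
      using that sub[of ?C] by (auto simp: carrier_completion)
    show "h (limit_class x) = x" if "x \<in> topspace (alg_topology B)" for x
      using that sub[of B] by auto
  qed
  ultimately show ?thesis
    unfolding topologically_isomorphic_def homeomorphic_map_maps by blast
qed

end

section \<open>Weighted summable families and the norms of the quantum ball\<close>

definition weighted_summable :: "('k \<Rightarrow> real) \<Rightarrow> ('k \<Rightarrow> complex) \<Rightarrow> bool" where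
  "weighted_summable W c \<longleftrightarrow> (\<lambda>k. cmod (c k) * W k) summable_on UNIV"

definition weighted_norm :: "('k \<Rightarrow> real) \<Rightarrow> ('k \<Rightarrow> complex) \<Rightarrow> real" where
  "weighted_norm W c = (\<Sum>\<^sub>\<infinity>k. cmod (c k) * W k)"

text \<open>Estimates are proved on finite sets of indices and transferred here, which yields
  summability and the bound on the norm at once.\<close>

lemma weighted_boundI:
  assumes "\<And>k. W k \<ge> 0" and "\<And>F. finite F \<Longrightarrow> (\<Sum>k\<in>F. cmod (c k) * W k) \<le> B"
  shows "weighted_summable W c" "weighted_norm W c \<le> B"
proof -
  show "weighted_summable W c"
    unfolding weighted_summable_def using assms
    by (intro nonneg_bdd_above_summable_on bdd_aboveI[of _ B]) auto
  then show "weighted_norm W c \<le> B"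
    unfolding weighted_norm_def weighted_summable_def using assms(2) by (intro infsum_le_finite_sums) auto
qed

lemma weighted_sum_le:
  assumes "\<And>k. W k \<ge> 0" and "weighted_summable W c" "finite F"
  shows "(\<Sum>k\<in>F. cmod (c k) * W k) \<le> weighted_norm W c"
  using assms unfolding weighted_norm_def weighted_summable_def by (intro finite_sum_le_infsum) auto

lemma weighted_term_le:
  assumes "\<And>k. W k \<ge> 0" and "weighted_summable W c"
  shows "cmod (c k) * W k \<le> weighted_norm W c"
  using weighted_sum_le[OF assms, of "{k}"] by simp

lemma weighted_norm_nonneg: "(\<And>k. W k \<ge> 0) \<Longrightarrow> weighted_norm W c \<ge> 0"
  unfolding weighted_norm_def by (intro infsum_nonneg) auto

lemma weighted_add:
  assumes W: "\<And>k. W k \<ge> 0" and c: "weighted_summable W c" and d: "weighted_summable W d"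
  shows "weighted_summable W (c + d)" "weighted_norm W (c + d) \<le> weighted_norm W c + weighted_norm W d"
proof -
  have "(\<Sum>k\<in>F. cmod ((c + d) k) * W k) \<le> weighted_norm W c + weighted_norm W d" if "finite F" for F
  proof -
    have "(\<Sum>k\<in>F. cmod ((c + d) k) * W k) \<le> (\<Sum>k\<in>F. cmod (c k) * W k + cmod (d k) * W k)"
      unfolding distrib_right[symmetric] by (intro sum_mono mult_right_mono W) (auto simp: norm_triangle_ineq)
    also have "\<dots> \<le> weighted_norm W c + weighted_norm W d"
      unfolding sum.distrib using that c d W by (intro add_mono weighted_sum_le)
    finally show ?thesis .
  qed
  from weighted_boundI[OF W this]
  show "weighted_summable W (c + d)" "weighted_norm W (c + d) \<le> weighted_norm W c + weighted_norm W d"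
    by (auto simp: plus_fun_def)
qed

lemma weighted_smult:
  shows "weighted_summable W c \<Longrightarrow> weighted_summable W (\<lambda>k. a * c k)"
    and "weighted_norm W (\<lambda>k. a * c k) = cmod a * weighted_norm W c"
  unfolding weighted_norm_def weighted_summable_def
  by (auto simp: norm_mult mult.assoc infsum_cmult_right' intro: summable_on_cmult_right)

lemma weighted_uminus:
  "weighted_summable W c \<Longrightarrow> weighted_summable W (- c)" "weighted_norm W (- c) = weighted_norm W c"
  by (simp_all add: weighted_norm_def weighted_summable_def)

lemma weighted_diff:
  assumes W: "\<And>k. W k \<ge> 0" and c: "weighted_summable W c" and d: "weighted_summable W d"
  shows "weighted_summable W (c - d)"
  using weighted_add(1)[OF W c weighted_uminus(1)[OF d]] by simp

lemma weighted_finite_support: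
  assumes "finite {k. c k \<noteq> 0}"
  shows "weighted_summable W c"
  unfolding weighted_summable_def
proof (rule summable_on_cong_neutral[THEN iffD1])
  show "(\<lambda>k. cmod (c k) * W k) summable_on {k. c k \<noteq> 0}" using assms by (rule summable_on_finite)
qed auto

text \<open>A Fatou argument: on a finite set K the Cauchy estimate for c - d survives the
  coordinatewise limit in d, with the same \<epsilon> for every K. Summability of x follows by
  writing it as c - (c - x).\<close>

lemma weighted_complete:
  assumes W: "\<And>k. W k \<ge> 0" and ev: "\<forall>\<^sub>F d in F. weighted_summable W d"
    and bot: "F \<noteq> bot" and lim: "\<And>k. ((\<lambda>d. d k) \<longlongrightarrow> x k) F"
    and Cauchy: "\<And>\<epsilon>. \<epsilon> > 0 \<Longrightarrow> \<forall>\<^sub>F (c, d) in F \<times>\<^sub>F F. weighted_norm W (c - d) < \<epsilon>"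
  shows "weighted_summable W x" "((\<lambda>d. weighted_norm W (d - x)) \<longlongrightarrow> 0) F"
proof -
  have *: "\<forall>\<^sub>F c in F. weighted_summable W c \<and> weighted_summable W (c - x) \<and> weighted_norm W (c - x) \<le> \<epsilon>"
    if \<epsilon>: "\<epsilon> > 0" for \<epsilon>
  proof -
    obtain P where P: "eventually P F" "\<And>c d. P c \<Longrightarrow> P d \<Longrightarrow> weighted_norm W (c - d) < \<epsilon>"
      using Cauchy[OF \<epsilon>] unfolding eventually_prod_same by auto
    show ?thesis
      using P(1) ev
    proof eventually_elim
      case (elim c)
      have "(\<Sum>k\<in>K. cmod ((c - x) k) * W k) \<le> \<epsilon>" if K: "finite K" for K
      proof (rule tendsto_upperbound[OF _ _ bot])
        show "((\<lambda>d. \<Sum>k\<in>K. cmod (c k - d k) * W k) \<longlongrightarrow> (\<Sum>k\<in>K. cmod ((c - x) k) * W k)) F"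
          by (simp add: minus_apply) (intro tendsto_intros lim)
        show "\<forall>\<^sub>F d in F. (\<Sum>k\<in>K. cmod (c k - d k) * W k) \<le> \<epsilon>"
          using P(1) ev
        proof eventually_elim
          case (elim d)
          have "(\<Sum>k\<in>K. cmod ((c - d) k) * W k) \<le> weighted_norm W (c - d)"
            using elim \<open>weighted_summable W c\<close> by (intro weighted_sum_le W weighted_diff K)
          also have "\<dots> \<le> \<epsilon>" using P(2)[OF \<open>P c\<close> \<open>P d\<close>] by simp
          finally show ?case by simp
        qed
      qed
      from weighted_boundI[OF W this] show ?case using elim by (auto simp: fun_diff_def)
    qed
  qed
  obtain c where "weighted_summable W c" "weighted_summable W (c - x)"
    using eventually_happens'[OF bot *[OF zero_less_one]] by auto
  from weighted_diff[OF W this] show "weighted_summable W x" by simp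
  show "((\<lambda>d. weighted_norm W (d - x)) \<longlongrightarrow> 0) F"
  proof (rule tendstoI)
    fix e :: real assume "e > 0"
    then have "\<forall>\<^sub>F c in F. weighted_norm W (c - x) \<le> e / 2" using *[of "e/2"] by (auto elim: eventually_mono)
    then show "\<forall>\<^sub>F c in F. dist (weighted_norm W (c - x)) 0 < e"
    proof (rule eventually_mono)
      fix c assume "weighted_norm W (c - x) \<le> e / 2"
      then show "dist (weighted_norm W (c - x)) 0 < e"
        using \<open>e > 0\<close> weighted_norm_nonneg[of W "c - x", OF W] by simp
    qed
  qed
qed

definition truncate :: "('k \<Rightarrow> complex) \<Rightarrow> 'k set \<Rightarrow> 'k \<Rightarrow> complex" where
  "truncate c K = (\<lambda>k. if k \<in> K then c k else 0)"

text \<open>The error is the tail of a convergent sum; this is the density of finitely supported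
  families.\<close>

lemma weighted_truncate:
  assumes c: "weighted_summable W c"
  shows "((\<lambda>K. weighted_norm W (truncate c K - c)) \<longlongrightarrow> 0) (finite_subsets_at_top UNIV)"
proof -
  let ?f = "\<lambda>k. cmod (c k) * W k"
  have f: "?f summable_on UNIV" using c by (simp add: weighted_summable_def)
  have "weighted_norm W (truncate c K - c) = infsum ?f UNIV - sum ?f K" if "finite K" for K
  proof -
    have "weighted_norm W (truncate c K - c) = infsum ?f (UNIV - K)"
      unfolding weighted_norm_def by (rule infsum_cong_neutral) (auto simp: truncate_def)
    also have "\<dots> = infsum ?f UNIV - infsum ?f K"
      by (rule infsum_Diff) (use f that in auto)
    finally show ?thesis using that by simp
  qed
  then have "\<forall>\<^sub>F K in finite_subsets_at_top UNIV. infsum ?f UNIV - sum ?f K = weighted_norm W (truncate c K - c)"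
    by (auto simp: eventually_finite_subsets_at_top intro: exI[of _ "{}"])
  moreover have "((\<lambda>K. infsum ?f UNIV - sum ?f K) \<longlongrightarrow> infsum ?f UNIV - infsum ?f UNIV) (finite_subsets_at_top UNIV)"
    using f by (intro tendsto_diff tendsto_const) (auto simp: has_sum_def[symmetric] has_sum_infsum)
  ultimately show ?thesis by (auto intro: Lim_transform_eventually)
qed

section \<open>Norm estimate for the twisted convolution\<close>

lemma ball_mult_alt:
  "ball_mult q c d m = (\<Sum>p | (\<lambda>i. fst p i + snd p i) = m.
    c (fst p) * d (snd p) * of_real (q powi (- int (reorder_exp (fst p) (snd p)))))"
  by (simp add: ball_mult_def case_prod_unfold)

lemma finite_splitting_pairs:
  "finite {p. (\<lambda>i::'n::finite. fst p i + snd p i) = (m :: 'n \<Rightarrow> nat)}"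
  using finite_index_splittings[of m] by (simp add: case_prod_unfold)

text \<open>The inequality \<open>W_mult\<close> absorbs the reordering factor, so that the twisted
  product is dominated termwise by an ordinary product of two sums.\<close>

lemma weighted_ball_mult:
  fixes c d :: "('n::{finite,linorder} \<Rightarrow> nat) \<Rightarrow> complex"
  assumes W: "\<And>k. W k \<ge> 0" and q: "q > 0"
    and W_mult: "\<And>k l. q powi (- int (reorder_exp k l)) * W (\<lambda>i. k i + l i) \<le> C * (W k * W l)"
    and c: "weighted_summable W c" and d: "weighted_summable W d" and C: "C \<ge> 0"
  shows "weighted_summable W (ball_mult q c d)"
    "weighted_norm W (ball_mult q c d) \<le> C * weighted_norm W c * weighted_norm W d"
proof -
  have "(\<Sum>m\<in>F. cmod (ball_mult q c d m) * W m) \<le> C * weighted_norm W c * weighted_norm W d"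
    if F: "finite F" for F
  proof -
    let ?g = "\<lambda>p i. fst p i + snd p i :: nat"
    let ?P = "\<lambda>m. {p. ?g p = m}"
    \<comment> \<open>All pairs of multi-indices whose sum lies in F; finite because each
      multi-index has finitely many splittings.\<close>
    define P where "P = (\<Union>m\<in>F. ?P m)"
    let ?f = "\<lambda>p. C * (cmod (c (fst p)) * W (fst p) * (cmod (d (snd p)) * W (snd p)))"
    have P: "finite P" unfolding P_def using F finite_splitting_pairs by (intro finite_UN_I) auto
    have "(\<Sum>m\<in>F. cmod (ball_mult q c d m) * W m) \<le> (\<Sum>m\<in>F. \<Sum>p\<in>{p \<in> P. ?g p = m}. ?f p)"
    proof (rule sum_mono)
      fix m assume m: "m \<in> F"
      have Pm: "{p \<in> P. ?g p = m} = ?P m" using m by (auto simp: P_def)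
      have "cmod (ball_mult q c d m) * W m \<le> (\<Sum>p\<in>?P m. cmod (c (fst p) * d (snd p) *
          of_real (q powi (- int (reorder_exp (fst p) (snd p)))))) * W m"
        unfolding ball_mult_alt by (intro mult_right_mono norm_sum W)
      also have "\<dots> \<le> (\<Sum>p\<in>?P m. ?f p)"
        unfolding sum_distrib_right
      proof (rule sum_mono)
        fix p assume p: "p \<in> ?P m"
        have "cmod (c (fst p)) * cmod (d (snd p)) *
            (q powi (- int (reorder_exp (fst p) (snd p))) * W m) \<le>
          cmod (c (fst p)) * cmod (d (snd p)) * (C * (W (fst p) * W (snd p)))"
          using W_mult[of "fst p" "snd p"] p by (intro mult_left_mono) auto
        then show "cmod (c (fst p) * d (snd p) * of_real (q powi (- int (reorder_exp (fst p) (snd p))))) * W m \<le> ?f p"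
          using q by (simp add: norm_mult norm_power_int mult_ac power_int_minus norm_inverse norm_power)
      qed
      finally show "cmod (ball_mult q c d m) * W m \<le> (\<Sum>p\<in>{p \<in> P. ?g p = m}. ?f p)" unfolding Pm .
    qed
    also have "\<dots> = sum ?f P" by (rule sum.group) (use F P in \<open>auto simp: P_def\<close>)
    \<comment> \<open>Enlarging P to the product of its projections adds only nonnegative terms and
      makes the double sum factor.\<close>
    also have "\<dots> \<le> sum ?f (fst ` P \<times> snd ` P)"
      using P W C by (intro sum_mono2) (auto simp: rev_image_eqI)
    also have "\<dots> = C * ((\<Sum>k\<in>fst ` P. cmod (c k) * W k) * (\<Sum>l\<in>snd ` P. cmod (d l) * W l))"
      by (subst sum_product, subst sum.cartesian_product) (simp add: sum_distrib_left case_prod_unfold)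
    also have "\<dots> \<le> C * (weighted_norm W c * weighted_norm W d)"
      using P W c d C weighted_norm_nonneg[OF W]
      by (intro mult_left_mono mult_mono weighted_sum_le sum_nonneg) auto
    finally show ?thesis by (simp add: mult.assoc)
  qed
  from weighted_boundI[OF W this] show "weighted_summable W (ball_mult q c d)"
    "weighted_norm W (ball_mult q c d) \<le> C * weighted_norm W c * weighted_norm W d" by auto
qed

lemma ball_mult_diff:
  "ball_mult q (c - d) e = ball_mult q c e - ball_mult q d e"
  "ball_mult q e (c - d) = ball_mult q e c - ball_mult q e d"
  by (simp_all add: fun_eq_iff ball_mult_alt sum_subtractf[symmetric] algebra_simps)

section \<open>The Pochhammer symbols (t;t)_m and the weights of the ball\<close>

definition qpoch :: "real \<Rightarrow> nat \<Rightarrow> real" where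
  "qpoch t m = (\<Prod>i=1..m. 1 - t ^ i)"

lemma qpoch_Suc: "qpoch t (Suc m) = qpoch t m * (1 - t ^ Suc m)"
  by (simp add: qpoch_def)

lemma qpoch_0 [simp]: "qpoch t 0 = 1"
  by (simp add: qpoch_def)

lemma qpoch_pos: "0 < t \<Longrightarrow> t < 1 \<Longrightarrow> qpoch t m > 0"
  by (auto simp: qpoch_def power_less_one_iff intro!: prod_pos)

lemma qpoch_mono: assumes "0 < t" "t < 1" shows "qpoch t (m + j) \<le> qpoch t m"
proof (induction j)
  case (Suc j)
  have "qpoch t (Suc (m + j)) \<le> qpoch t (m + j) * 1"
    unfolding qpoch_Suc using qpoch_pos[OF assms, of "m + j"] assms by (intro mult_left_mono) auto
  then show ?case using Suc by simp
qed auto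

lemma qpoch_le_1: "0 < t \<Longrightarrow> t < 1 \<Longrightarrow> qpoch t m \<le> 1"
  using qpoch_mono[of t 0 m] by simp

text \<open>For s = t^i \<le> t one has 1/(1-s) = 1 + s/(1-s) \<le> exp(s/(1-t)). Multiplying these
  bounds leaves the geometric sum of the t^i, at most 1/(1-t), divided by 1-t; this is the exponent
  of the constant.\<close>

lemma qpoch_bounded_below:
  assumes t: "0 < t" "t < 1"
  shows "\<exists>P>0. \<forall>m. P \<le> qpoch t m"
proof (intro exI conjI allI)
  show "exp (- (1 / (1 - t)^2)) > (0::real)" by simp
  fix m
  have "exp (- (\<Sum>i=1..m. t ^ i / (1 - t))) \<le> qpoch t m"
    unfolding sum_negf[symmetric] exp_sum[OF finite_atLeastAtMost] qpoch_def
  proof (rule prod_mono, safe)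
    fix i assume i: "i \<in> {1..m}"
    have ti: "0 < t ^ i" "t ^ i \<le> t" using t i power_decreasing[of 1 i t] by auto
    have "1 / (1 - t ^ i) = 1 + t ^ i / (1 - t ^ i)" using t ti by (simp add: field_simps)
    also have "\<dots> \<le> 1 + t ^ i / (1 - t)" using t ti by (intro add_left_mono divide_left_mono) auto
    also have "\<dots> \<le> exp (t ^ i / (1 - t))" by (rule exp_ge_add_one_self)
    finally show "exp (- (t ^ i / (1 - t))) \<le> 1 - t ^ i"
      using t ti by (simp add: exp_minus field_simps)
  qed auto
  moreover have "(\<Sum>i=1..m. t ^ i / (1 - t)) \<le> 1 / (1 - t)^2"
  proof -
    have "(\<Sum>i=1..m. t ^ i) \<le> (\<Sum>i<Suc m. t ^ i)" using t by (intro sum_mono2) auto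
    also have "\<dots> \<le> 1 / (1 - t)" using t by (subst sum_gp_strict) (auto simp: divide_right_mono)
    finally have "(\<Sum>i=1..m. t ^ i) / (1 - t) \<le> 1 / (1 - t) / (1 - t)"
      by (rule divide_right_mono) (use t in simp)
    then show ?thesis by (simp add: sum_divide_distrib power2_eq_square)
  qed
  ultimately show "exp (- (1 / (1 - t)^2)) \<le> qpoch t m"
    by (meson exp_le_cancel_iff neg_le_iff_le order_trans)
qed

lemma qfact_Suc: "qfact t (Suc m) = qfact t m * qint t (Suc m)"
  by (simp add: qfact_def)

lemma qfact_qpoch: "t \<noteq> 1 \<Longrightarrow> qfact t m * (1 - t) ^ m = qpoch t m"
proof (induction m)
  case (Suc m)
  have "qint t (Suc m) * (1 - t) = 1 - t ^ Suc m"
    unfolding qint_def using Suc.prems by (subst sum_gp_strict) auto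
  moreover have "qfact t (Suc m) * (1 - t) ^ Suc m = qfact t m * (1 - t) ^ m * (qint t (Suc m) * (1 - t))"
    by (simp add: qfact_Suc)
  ultimately show ?case unfolding qpoch_Suc using Suc.IH[OF Suc.prems] by simp
qed (simp add: qfact_def)

text \<open>Reversing the geometric sum gives [m] at 1/t times t^(m-1) equal to [m] at t. The
  conversion is needed because the ball is defined with parameter q^(-2) and the representation with
  q^2.\<close>

lemma qfact_inverse: "t \<noteq> 0 \<Longrightarrow> qfact (inverse t) m * t ^ (\<Sum>i<m. i) = qfact t m"
proof (induction m)
  case (Suc m)
  have "qint (inverse t) (Suc m) * t ^ m = (\<Sum>j<Suc m. t ^ (Suc m - Suc j))"
    unfolding qint_def sum_distrib_right using Suc.prems
    by (intro sum.cong) (auto simp: power_diff power_inverse field_simps)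
  also have "\<dots> = qint t (Suc m)" unfolding qint_def by (rule sum.nat_diff_reindex)
  finally have "qint (inverse t) (Suc m) * t ^ m = qint t (Suc m)" .
  moreover have "qfact (inverse t) (Suc m) * t ^ (\<Sum>i<Suc m. i) =
      qfact (inverse t) m * t ^ (\<Sum>i<m. i) * (qint (inverse t) (Suc m) * t ^ m)"
    by (simp add: qfact_Suc power_add)
  ultimately show ?case using Suc.IH[OF Suc.prems] by (simp only: qfact_Suc)
qed (simp add: qfact_def)

text \<open>
  Replacing \<open>1/t\<close> by \<open>t\<close> in a factorial costs a triangular power of \<open>t\<close>; in the quotient defining
  \<^const>\<open>ball_weight\<close> the triangular numbers combine to \<open>\<Sum>\<^sub>i\<^sub><\<^sub>j k\<^sub>i k\<^sub>j\<close>, which is \<open>reorder_exp k k\<close>.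
\<close>

lemma triangular_add: "(\<Sum>i<m + n. i) = (\<Sum>i<m. i) + (\<Sum>i<n. i) + m * (n::nat)"
  by (induction n) (auto simp: algebra_simps)

text \<open>Inserting the greatest index b adds, besides its own triangular number, the products of
  k b with all earlier entries: exactly the new pairs below b.\<close>

lemma triangular_sum:
  fixes k :: "'n::linorder \<Rightarrow> nat"
  assumes "finite S"
  shows "(\<Sum>i<\<Sum>j\<in>S. k j. i) = (\<Sum>j\<in>S. \<Sum>i<k j. i) + (\<Sum>j\<in>S. \<Sum>i\<in>{i \<in> S. i < j}. k i * k j)"
  using assms
proof (induction rule: finite_linorder_max_induct)
  case (insert b A)
  have "b \<notin> A" using insert by auto
  have "{i \<in> insert b A. i < b} = A" using insert by auto
  moreover have "{i \<in> insert b A. i < j} = {i \<in> A. i < j}" if "j \<in> A" for j using insert that by auto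
  ultimately have "(\<Sum>j\<in>insert b A. \<Sum>i\<in>{i \<in> insert b A. i < j}. k i * k j) =
      (\<Sum>i\<in>A. k i * k b) + (\<Sum>j\<in>A. \<Sum>i\<in>{i \<in> A. i < j}. k i * k j)"
    using \<open>b \<notin> A\<close> insert(1) by simp
  then show ?case
    using \<open>b \<notin> A\<close> insert by (simp add: triangular_add sum_distrib_right[symmetric] mult_ac)
qed simp

lemma reorder_exp_alt: "reorder_exp k l = (\<Sum>j\<in>UNIV. \<Sum>i | i < j. l i * k j)"
proof -
  have "reorder_exp k l = (\<Sum>(j, i)\<in>(SIGMA j:UNIV. {i. i < j}). l i * k j)"
    unfolding reorder_exp_def by (rule sum.reindex_bij_witness[of _ prod.swap prod.swap]) auto
  then show ?thesis by (simp add: sum.Sigma)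
qed

lemma reorder_exp_add:
  "reorder_exp (\<lambda>i. k i + k' i) l = reorder_exp k l + reorder_exp k' l"
  "reorder_exp l (\<lambda>i. k i + k' i) = reorder_exp l k + reorder_exp l k'"
  by (simp_all add: reorder_exp_def case_prod_unfold sum.distrib algebra_simps)

abbreviation total :: "('n::finite \<Rightarrow> nat) \<Rightarrow> nat" where
  "total k \<equiv> \<Sum>i\<in>UNIV. k i"

text \<open>The powers of 1 - q^2 cancel because numerator and denominator both have degree |k|, and
  the square root turns the remaining power of q^2 into one of q.\<close>

lemma ball_weight_eq:
  fixes k :: "'n::{finite,linorder} \<Rightarrow> nat"
  assumes q: "0 < q" "q < 1"
  shows "ball_weight q k = sqrt ((\<Prod>i\<in>UNIV. qpoch (q^2) (k i)) / qpoch (q^2) (total k)) * q ^ reorder_exp k k"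
proof -
  define t where "t = q^2"
  have t: "0 < t" "t < 1" using q by (auto simp: t_def power_less_one_iff)
  let ?T = "\<lambda>m::nat. \<Sum>i<m. i"
  have qi: "\<bar>q\<bar> powi (-2) = inverse t" using q by (simp add: t_def power_int_minus)
  have f: "qfact (inverse t) m = qpoch t m / ((1 - t) ^ m * t ^ ?T m)" for m
  proof -
    have "qfact (inverse t) m * (t ^ ?T m * (1 - t) ^ m) = qpoch t m"
      using qfact_inverse[of t m] qfact_qpoch[of t m] t by (simp only: mult.assoc[symmetric])
    then show ?thesis using t by (simp add: eq_divide_eq mult.commute)
  qed
  have T: "?T (total k) = (\<Sum>i\<in>UNIV. ?T (k i)) + reorder_exp k k"
    using triangular_sum[of UNIV k] by (simp add: reorder_exp_alt)
  have "qfact_multi (inverse t) k / qfact (inverse t) (total k) =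
     (\<Prod>i\<in>UNIV. qpoch t (k i)) / qpoch t (total k) * t ^ reorder_exp k k"
    unfolding qfact_multi_def f prod_dividef prod.distrib power_sum[symmetric] T power_add
    using t qpoch_pos[OF t, of "total k"] by (simp add: field_simps)
  moreover have "sqrt (t ^ reorder_exp k k) = q ^ reorder_exp k k"
    using q by (simp add: t_def real_sqrt_power)
  ultimately show ?thesis unfolding ball_weight_def qi t_def[symmetric] by (simp only: real_sqrt_mult)
qed

lemma ball_weight_bounds:
  assumes q: "0 < q" "q < 1"
  obtains c C where "c > 0" "C > 0"
    "\<And>k::'n::{finite,linorder} \<Rightarrow> nat. c * q ^ reorder_exp k k \<le> ball_weight q k"
    "\<And>k::'n \<Rightarrow> nat. ball_weight q k \<le> C * q ^ reorder_exp k k"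
proof -
  define t where "t = q^2"
  have t: "0 < t" "t < 1" using q by (auto simp: t_def power_less_one_iff)
  obtain P where P: "P > 0" "\<And>m. P \<le> qpoch t m" using qpoch_bounded_below[OF t] by auto
  show ?thesis
  proof
    fix k :: "'n \<Rightarrow> nat"
    \<comment> \<open>Each of the n factors of the numerator is at least P and the denominator at
      most 1; for the upper bound the numerator is at most 1 and the denominator at least P.\<close>
    have "P ^ CARD('n) / 1 \<le> (\<Prod>i\<in>UNIV. qpoch t (k i)) / qpoch t (total k)"
      using P prod_mono[of UNIV "\<lambda>_. P" "\<lambda>i. qpoch t (k i)"] qpoch_pos[OF t] qpoch_le_1[OF t]
      by (intro frac_le) (auto intro!: prod_nonneg less_imp_le[OF qpoch_pos[OF t]])
    then show "sqrt (P ^ CARD('n)) * q ^ reorder_exp k k \<le> ball_weight q k"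
      unfolding ball_weight_eq[OF q] t_def using q by (intro mult_right_mono) auto
    have "(\<Prod>i\<in>UNIV. qpoch t (k i)) / qpoch t (total k) \<le> 1 / P"
      using P qpoch_pos[OF t] qpoch_le_1[OF t] by (intro frac_le prod_le_1) (auto intro: less_imp_le)
    then show "ball_weight q k \<le> sqrt (1 / P) * q ^ reorder_exp k k"
      unfolding ball_weight_eq[OF q] t_def using q by (intro mult_right_mono) auto
  qed (use P in auto)
qed

lemma ball_weight_pos: "0 < q \<Longrightarrow> q < 1 \<Longrightarrow> ball_weight q (k::'n::{finite,linorder} \<Rightarrow> nat) > 0"
  using ball_weight_bounds[of q, where 'n = 'n]
  by (metis mult_pos_pos order_less_le_trans zero_less_power)

text \<open>Since \<open>reorder_exp\<close> is biadditive, the exponent belonging to k + l contains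
  both mixed terms. The reordering factor cancels one of them, and the power of q given by the other
  is at most 1.\<close>

lemma ball_weight_mult:
  assumes q: "0 < q" "q < 1"
  obtains C where "C > 0" "\<And>k l :: 'n::{finite,linorder} \<Rightarrow> nat.
    q powi (- int (reorder_exp k l)) * ball_weight q (\<lambda>i. k i + l i) \<le> C * (ball_weight q k * ball_weight q l)"
proof -
  obtain c C where cC: "c > 0" "C > 0"
    "\<And>k::'n \<Rightarrow> nat. c * q ^ reorder_exp k k \<le> ball_weight q k"
    "\<And>k::'n \<Rightarrow> nat. ball_weight q k \<le> C * q ^ reorder_exp k k"
    using ball_weight_bounds[OF q, where 'n = 'n] by metis
  show ?thesis
  proof
    show "C / c^2 > 0" using cC by simp
    fix k l :: "'n \<Rightarrow> nat"
    have "q powi (- int (reorder_exp k l)) * ball_weight q (\<lambda>i. k i + l i) \<le>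
       q powi (- int (reorder_exp k l)) * (C * q ^ reorder_exp (\<lambda>i. k i + l i) (\<lambda>i. k i + l i))"
      using cC(4)[of "\<lambda>i. k i + l i"] q by (intro mult_left_mono) auto
    also have "\<dots> = C * (q ^ reorder_exp k k * q ^ reorder_exp l l * q ^ reorder_exp l k)"
      using q by (simp add: reorder_exp_add power_add power_int_minus field_simps)
    also have "\<dots> \<le> C * (q ^ reorder_exp k k * q ^ reorder_exp l l * 1)"
      using q cC by (intro mult_left_mono) (auto simp: power_le_one)
    also have "\<dots> = C / c^2 * ((c * q ^ reorder_exp k k) * (c * q ^ reorder_exp l l))"
      using cC by (simp add: power2_eq_square)
    also have "\<dots> \<le> C / c^2 * (ball_weight q k * ball_weight q l)"
      using cC q ball_weight_pos[OF q] by (intro mult_left_mono mult_mono) (auto intro: less_imp_le)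
    finally show "q powi (- int (reorder_exp k l)) * ball_weight q (\<lambda>i. k i + l i) \<le>
      C / c^2 * (ball_weight q k * ball_weight q l)" .
  qed
qed

section \<open>Bounded operators on square-summable families\<close>

lemma l2I:
  assumes "\<And>F. finite F \<Longrightarrow> L2_set (\<lambda>k. cmod (f k)) F \<le> B"
  shows "f \<in> l2" "l2_norm f \<le> B"
proof -
  have B: "B \<ge> 0" using assms[of "{}"] by simp
  have *: "(\<Sum>k\<in>F. (cmod (f k))\<^sup>2) \<le> B\<^sup>2" if "finite F" for F
    using assms[OF that] B real_sqrt_le_iff[of _ "B^2"] by (simp add: L2_set_def)
  then have "(\<lambda>k. (cmod (f k))\<^sup>2) summable_on UNIV"
    by (intro nonneg_bdd_above_summable_on bdd_aboveI[of _ "B\<^sup>2"]) auto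
  then show "f \<in> l2" by (simp add: l2_def)
  have "(\<Sum>\<^sub>\<infinity>k. (cmod (f k))\<^sup>2) \<le> B\<^sup>2"
    by (intro infsum_le_finite_sums *) fact+
  then show "l2_norm f \<le> B" using B by (simp add: l2_norm_def real_le_lsqrt infsum_nonneg)
qed

lemma L2_set_le_l2_norm: "f \<in> l2 \<Longrightarrow> finite F \<Longrightarrow> L2_set (\<lambda>k. cmod (f k)) F \<le> l2_norm f"
  unfolding L2_set_def l2_norm_def l2_def by (intro real_sqrt_le_mono finite_sum_le_infsum) auto

lemma cmod_le_l2_norm: "f \<in> l2 \<Longrightarrow> cmod (f k) \<le> l2_norm f"
  using L2_set_le_l2_norm[of f "{k}"] by simp

lemma l2_norm_nonneg: "l2_norm f \<ge> 0"
  by (simp add: l2_norm_def infsum_nonneg)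

lemma l2_norm_zero: "l2_norm (\<lambda>k. 0) = 0" and l2_zero: "(\<lambda>k. 0) \<in> l2"
  by (simp_all add: l2_norm_def l2_def)

lemma l2_add:
  assumes "f \<in> l2" "g \<in> l2"
  shows "(\<lambda>k. f k + g k) \<in> l2" "l2_norm (\<lambda>k. f k + g k) \<le> l2_norm f + l2_norm g"
proof -
  have "L2_set (\<lambda>k. cmod (f k + g k)) F \<le> l2_norm f + l2_norm g" if "finite F" for F
  proof -
    have "L2_set (\<lambda>k. cmod (f k + g k)) F \<le> L2_set (\<lambda>k. cmod (f k) + cmod (g k)) F"
      by (intro L2_set_mono norm_triangle_ineq) auto
    also have "\<dots> \<le> L2_set (\<lambda>k. cmod (f k)) F + L2_set (\<lambda>k. cmod (g k)) F"
      by (rule L2_set_triangle_ineq)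
    also have "\<dots> \<le> l2_norm f + l2_norm g" using assms that by (intro add_mono L2_set_le_l2_norm)
    finally show ?thesis .
  qed
  from l2I[OF this] show "(\<lambda>k. f k + g k) \<in> l2" "l2_norm (\<lambda>k. f k + g k) \<le> l2_norm f + l2_norm g"
    by auto
qed

lemma l2_smult:
  shows "f \<in> l2 \<Longrightarrow> (\<lambda>k. c * f k) \<in> l2" and "l2_norm (\<lambda>k. c * f k) = cmod c * l2_norm f"
  unfolding l2_def l2_norm_def
  by (auto simp: norm_mult power_mult_distrib infsum_cmult_right' real_sqrt_mult
      intro: summable_on_cmult_right)

lemma l2_basis: "l2_basis k \<in> l2" "l2_norm (l2_basis k) = 1"
proof -
  have "(\<lambda>m. (cmod (l2_basis k m))\<^sup>2) summable_on {k}" by simp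
  then show "l2_basis k \<in> l2"
    unfolding l2_def by (subst (asm) summable_on_cong_neutral[where T = UNIV]) (auto simp: l2_basis_def)
  have "(\<Sum>\<^sub>\<infinity>m. (cmod (l2_basis k m))\<^sup>2) = (\<Sum>\<^sub>\<infinity>m\<in>{k}. (cmod (l2_basis k m))\<^sup>2)"
    by (rule infsum_cong_neutral) (auto simp: l2_basis_def)
  then show "l2_norm (l2_basis k) = 1" by (simp add: l2_norm_def l2_basis_def)
qed

lemma l2_inner_basis: "l2_inner (l2_basis k) g = cnj (g k)"
proof -
  have "l2_inner (l2_basis k) g = (\<Sum>\<^sub>\<infinity>m\<in>{k}. l2_basis k m * cnj (g m))"
    unfolding l2_inner_def by (rule infsum_cong_neutral) (auto simp: l2_basis_def)
  then show ?thesis by (simp add: l2_basis_def)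
qed

lemma l2_inner_summable:
  assumes "f \<in> l2" "g \<in> l2" shows "(\<lambda>k. f k * cnj (g k)) summable_on UNIV"
proof (rule abs_summable_summable)
  have "(\<Sum>k\<in>F. norm (f k * cnj (g k))) \<le> l2_norm f * l2_norm g" if "finite F" for F
  proof -
    have "(\<Sum>k\<in>F. norm (f k * cnj (g k))) = (\<Sum>k\<in>F. \<bar>cmod (f k)\<bar> * \<bar>cmod (g k)\<bar>)"
      by (simp add: norm_mult)
    also have "\<dots> \<le> L2_set (\<lambda>k. cmod (f k)) F * L2_set (\<lambda>k. cmod (g k)) F" by (rule L2_set_mult_ineq)
    also have "\<dots> \<le> l2_norm f * l2_norm g"
      using assms that by (intro mult_mono L2_set_le_l2_norm l2_norm_nonneg L2_set_nonneg)
    finally show ?thesis .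
  qed
  then show "(\<lambda>k. norm (f k * cnj (g k))) summable_on UNIV"
    by (intro nonneg_bdd_above_summable_on bdd_aboveI[of _ "l2_norm f * l2_norm g"]) auto
qed

lemma l2_truncate:
  assumes f: "f \<in> l2"
  shows "((\<lambda>K. l2_norm (\<lambda>k. f k - truncate f K k)) \<longlongrightarrow> 0) (finite_subsets_at_top UNIV)"
proof -
  let ?f = "\<lambda>k. (cmod (f k))\<^sup>2"
  have s: "?f summable_on UNIV" using f by (simp add: l2_def)
  have "l2_norm (\<lambda>k. f k - truncate f K k) = sqrt (infsum ?f UNIV - sum ?f K)" if "finite K" for K
  proof -
    have "(\<Sum>\<^sub>\<infinity>k. (cmod (f k - truncate f K k))\<^sup>2) = infsum ?f (UNIV - K)"
      by (rule infsum_cong_neutral) (auto simp: truncate_def)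
    also have "\<dots> = infsum ?f UNIV - infsum ?f K"
      by (rule infsum_Diff) (use s that in auto)
    finally show ?thesis using that by (simp add: l2_norm_def)
  qed
  then have "\<forall>\<^sub>F K in finite_subsets_at_top UNIV.
      sqrt (infsum ?f UNIV - sum ?f K) = l2_norm (\<lambda>k. f k - truncate f K k)"
    by (auto simp: eventually_finite_subsets_at_top intro: exI[of _ "{}"])
  moreover have "((\<lambda>K. sqrt (infsum ?f UNIV - sum ?f K)) \<longlongrightarrow> sqrt (infsum ?f UNIV - infsum ?f UNIV))
      (finite_subsets_at_top UNIV)"
    using s by (intro tendsto_real_sqrt tendsto_diff tendsto_const) (auto simp: has_sum_def[symmetric] has_sum_infsum)
  ultimately show ?thesis by (auto intro: Lim_transform_eventually)
qed

text \<open>An explicit bound propagates through sums and compositions, and its existence ensures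
  that the supremum in \<open>l2_opnorm\<close> is taken over a bounded set.\<close>

definition op_bounded_by :: "'k l2_op \<Rightarrow> real \<Rightarrow> bool" where
  "op_bounded_by T B \<longleftrightarrow> B \<ge> 0 \<and>
    (\<forall>f\<in>l2. T f \<in> l2 \<and> l2_norm (T f) \<le> B * l2_norm f) \<and>
    (\<forall>f\<in>l2. \<forall>g\<in>l2. T (\<lambda>k. f k + g k) = (\<lambda>k. T f k + T g k)) \<and>
    (\<forall>f\<in>l2. \<forall>c. T (\<lambda>k. c * f k) = (\<lambda>k. c * T f k))"

lemma op_bounded_byD:
  assumes "op_bounded_by T B"
  shows "B \<ge> 0" "f \<in> l2 \<Longrightarrow> T f \<in> l2" "f \<in> l2 \<Longrightarrow> l2_norm (T f) \<le> B * l2_norm f"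
    "f \<in> l2 \<Longrightarrow> g \<in> l2 \<Longrightarrow> T (\<lambda>k. f k + g k) = (\<lambda>k. T f k + T g k)"
    "f \<in> l2 \<Longrightarrow> T (\<lambda>k. c * f k) = (\<lambda>k. c * T f k)"
  using assms by (simp_all add: op_bounded_by_def)

lemma l2_bounded_op_iff: "l2_bounded_op T \<longleftrightarrow> (\<exists>B. op_bounded_by T B)"
proof
  assume T: "l2_bounded_op T"
  then obtain B where B: "\<forall>f\<in>l2. l2_norm (T f) \<le> B * l2_norm f" by (auto simp: l2_bounded_op_def)
  have "l2_norm (T f) \<le> \<bar>B\<bar> * l2_norm f" if "f \<in> l2" for f
    using B[rule_format, OF that] mult_right_mono[OF abs_ge_self[of B] l2_norm_nonneg[of f]] by linarith
  then have "op_bounded_by T \<bar>B\<bar>" using T by (simp add: op_bounded_by_def l2_bounded_op_def)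
  then show "\<exists>B. op_bounded_by T B" ..
qed (auto simp: op_bounded_by_def l2_bounded_op_def)

lemma op_bounded_by_id: "op_bounded_by (\<lambda>f. f) 1"
  by (simp add: op_bounded_by_def)

lemma op_bounded_by_comp:
  assumes T: "op_bounded_by T B" and S: "op_bounded_by S C"
  shows "op_bounded_by (\<lambda>f. T (S f)) (B * C)"
  unfolding op_bounded_by_def
proof (intro conjI ballI allI)
  fix f assume f: "f \<in> (l2 :: ('a \<Rightarrow> complex) set)"
  have "l2_norm (T (S f)) \<le> B * l2_norm (S f)" by (intro op_bounded_byD[OF T] op_bounded_byD[OF S] f)
  also have "\<dots> \<le> B * (C * l2_norm f)" by (intro mult_left_mono op_bounded_byD[OF T] op_bounded_byD[OF S] f)
  finally show "l2_norm (T (S f)) \<le> B * C * l2_norm f" by simp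
qed (use op_bounded_byD[OF T] op_bounded_byD[OF S] in simp_all)

lemma op_bounded_by_add:
  assumes T: "op_bounded_by T B" and S: "op_bounded_by S C"
  shows "op_bounded_by (\<lambda>f k. T f k + S f k) (B + C)"
  unfolding op_bounded_by_def
proof (intro conjI ballI allI)
  fix f assume f: "f \<in> (l2 :: ('a \<Rightarrow> complex) set)"
  show "(\<lambda>k. T f k + S f k) \<in> l2" by (intro l2_add op_bounded_byD[OF T] op_bounded_byD[OF S] f)
  have "l2_norm (\<lambda>k. T f k + S f k) \<le> l2_norm (T f) + l2_norm (S f)"
    by (intro l2_add op_bounded_byD[OF T] op_bounded_byD[OF S] f)
  also have "\<dots> \<le> B * l2_norm f + C * l2_norm f"
    by (intro add_mono op_bounded_byD[OF T] op_bounded_byD[OF S] f)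
  finally show "l2_norm (\<lambda>k. T f k + S f k) \<le> (B + C) * l2_norm f" by (simp add: distrib_right)
qed (use op_bounded_byD[OF T] op_bounded_byD[OF S] in \<open>simp_all add: fun_eq_iff algebra_simps\<close>)

lemma op_bounded_by_smult:
  assumes T: "op_bounded_by T B"
  shows "op_bounded_by (\<lambda>f k. c * T f k) (cmod c * B)"
  unfolding op_bounded_by_def
proof (intro conjI ballI allI)
  fix f assume f: "f \<in> (l2 :: ('a \<Rightarrow> complex) set)"
  show "(\<lambda>k. c * T f k) \<in> l2" by (intro l2_smult op_bounded_byD[OF T] f)
  show "l2_norm (\<lambda>k. c * T f k) \<le> cmod c * B * l2_norm f"
    using op_bounded_byD(3)[OF T f] by (simp add: l2_smult mult.assoc mult_left_mono)
qed (use op_bounded_byD[OF T] in \<open>simp_all add: fun_eq_iff algebra_simps\<close>)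

lemma op_bounded_by_sum:
  assumes "finite I" "\<And>i. i \<in> I \<Longrightarrow> op_bounded_by (T i) (B i)"
  shows "op_bounded_by (\<lambda>f k. \<Sum>i\<in>I. T i f k) (\<Sum>i\<in>I. B i)"
  using assms
proof (induction I rule: finite_induct)
  case empty
  show ?case by (simp add: op_bounded_by_def l2_zero l2_norm_zero)
next
  case (insert i I)
  then show ?case using op_bounded_by_add[of "T i" "B i" "\<lambda>f k. \<Sum>i\<in>I. T i f k" "\<Sum>i\<in>I. B i"] by simp
qed

text \<open>Linearity gives agreement on finite truncations of f; on the remaining tail both
  operators are small by their bounds. The comparison is made in each coordinate, which the norm
  dominates.\<close>

lemma op_eq_on_basis:
  assumes T: "op_bounded_by T B" and S: "op_bounded_by S C"
    and eq: "\<And>k. T (l2_basis k) = S (l2_basis k)" and f: "f \<in> l2"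
  shows "T f = S f"
proof -
  have trunc: "truncate f K \<in> l2 \<and> T (truncate f K) = S (truncate f K)" if "finite K" for K
    using that
  proof (induction K)
    case empty
    have "truncate f {} = (\<lambda>k. 0 * f k)" by (simp add: truncate_def)
    then show ?case
      using op_bounded_byD(5)[OF T f, of 0] op_bounded_byD(5)[OF S f, of 0] by (simp add: l2_zero)
  next
    case (insert i K)
    have *: "truncate f (insert i K) = (\<lambda>k. truncate f K k + f i * l2_basis i k)"
      using insert by (auto simp: truncate_def l2_basis_def fun_eq_iff)
    show ?case
      unfolding * using insert l2_smult(1)[OF l2_basis(1), of "f i" i]
      by (simp add: l2_add(1) op_bounded_byD(4,5)[OF T] op_bounded_byD(4,5)[OF S] l2_basis(1) eq)
  qed
  have "cmod (T f m - S f m) \<le> (B + C) * l2_norm (\<lambda>k. f k - truncate f K k)" if K: "finite K" for K m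
  proof -
    let ?g = "\<lambda>k. f k - truncate f K k"
    have g: "?g \<in> l2" using l2_add(1)[OF f l2_smult(1)[of "truncate f K" "-1"]] trunc[OF K] by simp
    have "T (\<lambda>k. truncate f K k + ?g k) = (\<lambda>k. T (truncate f K) k + T ?g k)"
      "S (\<lambda>k. truncate f K k + ?g k) = (\<lambda>k. S (truncate f K) k + S ?g k)"
      using op_bounded_byD(4)[OF T _ g] op_bounded_byD(4)[OF S _ g] trunc[OF K] by blast+
    then have "T f = (\<lambda>k. T (truncate f K) k + T ?g k)" "S f = (\<lambda>k. S (truncate f K) k + S ?g k)"
      by simp_all
    then have "cmod (T f m - S f m) = cmod (T ?g m - S ?g m)" using trunc[OF K] by simp
    also have "\<dots> \<le> cmod (T ?g m) + cmod (S ?g m)" by (rule norm_triangle_ineq4)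
    also have "\<dots> \<le> l2_norm (T ?g) + l2_norm (S ?g)"
      by (intro add_mono cmod_le_l2_norm op_bounded_byD(2)[OF T g] op_bounded_byD(2)[OF S g])
    also have "\<dots> \<le> B * l2_norm ?g + C * l2_norm ?g"
      by (intro add_mono op_bounded_byD(3)[OF T g] op_bounded_byD(3)[OF S g])
    finally show ?thesis by (simp add: distrib_right)
  qed
  then have ev: "\<forall>\<^sub>F K in finite_subsets_at_top UNIV.
      cmod (T f m - S f m) \<le> (B + C) * l2_norm (\<lambda>k. f k - truncate f K k)" for m
    by (auto simp: eventually_finite_subsets_at_top intro: exI[of _ "{}"])
  have "cmod (T f m - S f m) \<le> (B + C) * 0" for m
    by (rule tendsto_lowerbound[OF tendsto_mult[OF tendsto_const l2_truncate[OF f]] ev]) simp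
  then show ?thesis by (simp add: fun_eq_iff)
qed

lemma l2_unit_ball_nonempty: "{f \<in> l2. l2_norm f \<le> 1} \<noteq> {}"
proof -
  have "(\<lambda>k. 0) \<in> {f \<in> l2. l2_norm f \<le> 1}" by (simp add: l2_zero l2_norm_zero)
  then show ?thesis by blast
qed

lemma l2_opnorm_le:
  fixes T :: "'k l2_op"
  assumes T: "op_bounded_by T B"
  shows "l2_opnorm T \<le> B"
  unfolding l2_opnorm_def
proof (rule cSUP_least)
  show "{f \<in> l2. l2_norm f \<le> 1} \<noteq> ({} :: ('k \<Rightarrow> complex) set)" by (rule l2_unit_ball_nonempty)
  show "l2_norm (T f) \<le> B" if "f \<in> {f \<in> l2. l2_norm f \<le> 1}" for f
    using that op_bounded_byD(3)[OF T, of f] mult_left_mono[of "l2_norm f" 1 B] op_bounded_byD(1)[OF T] by auto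
qed

lemma l2_norm_le_opnorm:
  assumes T: "l2_bounded_op T" and f: "f \<in> l2" "l2_norm f \<le> 1"
  shows "l2_norm (T f) \<le> l2_opnorm T"
proof -
  obtain B where B: "op_bounded_by T B" using T by (auto simp: l2_bounded_op_iff)
  have "l2_norm (T g) \<le> B" if "g \<in> l2" "l2_norm g \<le> 1" for g
    using that op_bounded_byD(3)[OF B, of g] mult_left_mono[of "l2_norm g" 1 B] op_bounded_byD(1)[OF B] by auto
  then show ?thesis
    unfolding l2_opnorm_def using f by (intro cSUP_upper) (auto intro!: bdd_aboveI[of _ B])
qed

lemma l2_opnorm_cong: "(\<And>f. f \<in> l2 \<Longrightarrow> T f = S f) \<Longrightarrow> l2_opnorm T = l2_opnorm S"
  unfolding l2_opnorm_def by (rule SUP_cong) auto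

lemma l2_opnorm_add:
  fixes T S :: "'k l2_op"
  assumes T: "l2_bounded_op T" and S: "l2_bounded_op S"
  shows "l2_opnorm (\<lambda>f k. T f k + S f k) \<le> l2_opnorm T + l2_opnorm S"
  unfolding l2_opnorm_def[of "\<lambda>f k. T f k + S f k"]
proof (rule cSUP_least)
  show "{f \<in> l2. l2_norm f \<le> 1} \<noteq> ({} :: ('k \<Rightarrow> complex) set)" by (rule l2_unit_ball_nonempty)
  fix f assume f: "f \<in> {f \<in> l2 :: ('k \<Rightarrow> complex) set. l2_norm f \<le> 1}"
  have "l2_norm (\<lambda>k. T f k + S f k) \<le> l2_norm (T f) + l2_norm (S f)"
    using T S f by (intro l2_add) (auto simp: l2_bounded_op_def)
  also have "\<dots> \<le> l2_opnorm T + l2_opnorm S"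
    using f by (intro add_mono l2_norm_le_opnorm T S) auto
  finally show "l2_norm (\<lambda>k. T f k + S f k) \<le> l2_opnorm T + l2_opnorm S" .
qed

lemma l2_opnorm_uminus: "l2_opnorm (\<lambda>f k. - T f k) = l2_opnorm T"
  using l2_smult(2)[of "-1" "T _"] by (simp add: l2_opnorm_def)

section \<open>Adjoint pairs of operators\<close>

definition op_adjoint :: "'k l2_op \<Rightarrow> 'k l2_op \<Rightarrow> bool" where
  "op_adjoint T S \<longleftrightarrow> (\<forall>f\<in>l2. \<forall>g\<in>l2. l2_inner (T f) g = l2_inner f (S g))"

lemma op_adjoint_id: "op_adjoint (\<lambda>f. f) (\<lambda>f. f)"
  by (simp add: op_adjoint_def)

lemma op_adjoint_comp:
  assumes "op_adjoint T T'" "op_adjoint S S'" "op_bounded_by S B" "op_bounded_by T' C"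
  shows "op_adjoint (\<lambda>f. T (S f)) (\<lambda>f. S' (T' f))"
  using assms by (simp add: op_adjoint_def op_bounded_by_def)

lemma infsum_of_sum:
  fixes f :: "'i \<Rightarrow> 'k \<Rightarrow> complex"
  assumes "finite I" "\<And>i. i \<in> I \<Longrightarrow> f i summable_on A"
  shows "(\<lambda>k. \<Sum>i\<in>I. f i k) summable_on A \<and> (\<Sum>\<^sub>\<infinity>k\<in>A. \<Sum>i\<in>I. f i k) = (\<Sum>i\<in>I. infsum (f i) A)"
  using assms by (induction rule: finite_induct) (auto simp: infsum_add intro: summable_on_add)

text \<open>Boundedness makes every inner product summable, so the finite and the infinite sum may
  be exchanged; the coefficients are conjugated because the inner product is antilinear in its
  second argument.\<close>

lemma op_adjoint_lincomb:
  fixes T S :: "'i \<Rightarrow> 'k l2_op"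
  assumes I: "finite I" and adj: "\<And>i. i \<in> I \<Longrightarrow> op_adjoint (T i) (S i)"
    and bd: "\<And>i. i \<in> I \<Longrightarrow> op_bounded_by (T i) (B i)" "\<And>i. i \<in> I \<Longrightarrow> op_bounded_by (S i) (C i)"
  shows "op_adjoint (\<lambda>f k. \<Sum>i\<in>I. c i * T i f k) (\<lambda>f k. \<Sum>i\<in>I. cnj (c i) * S i f k)"
  unfolding op_adjoint_def
proof (intro ballI)
  fix f g :: "'k \<Rightarrow> complex" assume fg: "f \<in> l2" "g \<in> l2"
  have sT: "(\<lambda>k. T i f k * cnj (g k)) summable_on UNIV" if "i \<in> I" for i
    using fg op_bounded_byD(2)[OF bd(1)[OF that]] by (intro l2_inner_summable) auto
  have sS: "(\<lambda>k. f k * cnj (S i g k)) summable_on UNIV" if "i \<in> I" for i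
    using fg op_bounded_byD(2)[OF bd(2)[OF that]] by (intro l2_inner_summable) auto
  have "l2_inner (\<lambda>k. \<Sum>i\<in>I. c i * T i f k) g = (\<Sum>\<^sub>\<infinity>k. \<Sum>i\<in>I. c i * (T i f k * cnj (g k)))"
    by (simp add: l2_inner_def sum_distrib_right mult.assoc)
  also have "\<dots> = (\<Sum>i\<in>I. \<Sum>\<^sub>\<infinity>k. c i * (T i f k * cnj (g k)))"
    by (intro infsum_of_sum[THEN conjunct2] I summable_on_cmult_right sT)
  also have "\<dots> = (\<Sum>i\<in>I. c i * l2_inner (T i f) g)"
    by (simp add: l2_inner_def infsum_cmult_right')
  also have "\<dots> = (\<Sum>i\<in>I. c i * l2_inner f (S i g))"
    using adj fg by (intro sum.cong) (auto simp: op_adjoint_def)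
  also have "\<dots> = (\<Sum>i\<in>I. \<Sum>\<^sub>\<infinity>k. c i * (f k * cnj (S i g k)))"
    by (simp add: l2_inner_def infsum_cmult_right')
  also have "\<dots> = (\<Sum>\<^sub>\<infinity>k. \<Sum>i\<in>I. c i * (f k * cnj (S i g k)))"
    by (intro infsum_of_sum[THEN conjunct2, symmetric] I summable_on_cmult_right sS)
  also have "\<dots> = l2_inner f (\<lambda>k. \<Sum>i\<in>I. cnj (c i) * S i g k)"
    by (simp add: l2_inner_def sum_distrib_left mult.left_commute)
  finally show "l2_inner (\<lambda>k. \<Sum>i\<in>I. c i * T i f k) g = l2_inner f (\<lambda>k. \<Sum>i\<in>I. cnj (c i) * S i g k)" .
qed

section \<open>Weighted shifts along an injection of the index set\<close>

definition wshift :: "('k \<Rightarrow> 'k) \<Rightarrow> ('k \<Rightarrow> real) \<Rightarrow> 'k l2_op" where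
  "wshift \<sigma> \<alpha> f = (\<lambda>m. if m \<in> range \<sigma> then of_real (\<alpha> (inv_into UNIV \<sigma> m)) * f (inv_into UNIV \<sigma> m) else 0)"

definition wshift_adj :: "('k \<Rightarrow> 'k) \<Rightarrow> ('k \<Rightarrow> real) \<Rightarrow> 'k l2_op" where
  "wshift_adj \<sigma> \<alpha> f = (\<lambda>m. of_real (\<alpha> m) * f (\<sigma> m))"

lemma wshift_image [simp]: "inj \<sigma> \<Longrightarrow> wshift \<sigma> \<alpha> f (\<sigma> m) = of_real (\<alpha> m) * f m"
  by (simp add: wshift_def)

lemma wshift_basis: "inj \<sigma> \<Longrightarrow> wshift \<sigma> \<alpha> (l2_basis k) = (\<lambda>m. of_real (\<alpha> k) * l2_basis (\<sigma> k) m)"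
  by (auto simp: wshift_def l2_basis_def fun_eq_iff inj_def)

lemma op_bounded_by_wshift:
  assumes \<sigma>: "inj \<sigma>" and \<alpha>: "\<And>k. \<bar>\<alpha> k\<bar> \<le> u"
  shows "op_bounded_by (wshift \<sigma> \<alpha>) u"
proof -
  have u: "u \<ge> 0" using \<alpha>[of undefined] by linarith
  have "wshift \<sigma> \<alpha> f \<in> l2 \<and> l2_norm (wshift \<sigma> \<alpha> f) \<le> u * l2_norm f" if f: "f \<in> l2" for f
  proof -
    have "L2_set (\<lambda>m. cmod (wshift \<sigma> \<alpha> f m)) F \<le> u * l2_norm f" if F: "finite F" for F
    proof -
      \<comment> \<open>Coordinates off the range of \<sigma> vanish, so the sum over F is a sum
        over its preimage, on which the coordinates of f are merely scaled.\<close>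
      define G where "G = \<sigma> -` F"
      have G: "finite G" unfolding G_def using F \<sigma> by (rule finite_vimageI)
      have "L2_set (\<lambda>m. cmod (wshift \<sigma> \<alpha> f m)) F = L2_set (\<lambda>m. cmod (wshift \<sigma> \<alpha> f m)) (\<sigma> ` G)"
        unfolding L2_set_def using F by (intro arg_cong[of _ _ sqrt] sum.mono_neutral_right)
          (auto simp: G_def wshift_def)
      also have "\<dots> = L2_set (\<lambda>k. cmod (wshift \<sigma> \<alpha> f (\<sigma> k))) G"
        unfolding L2_set_def using \<sigma> by (subst sum.reindex) (auto intro: inj_on_subset)
      also have "\<dots> \<le> L2_set (\<lambda>k. u * cmod (f k)) G"
        using \<sigma> \<alpha> by (intro L2_set_mono) (auto simp: norm_mult intro: mult_right_mono)
      also have "\<dots> = u * L2_set (\<lambda>k. cmod (f k)) G" using u by (simp add: L2_set_right_distrib)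
      also have "\<dots> \<le> u * l2_norm f" using u f G by (intro mult_left_mono L2_set_le_l2_norm)
      finally show ?thesis .
    qed
    from l2I[OF this] show ?thesis by auto
  qed
  then show ?thesis using u by (auto simp: op_bounded_by_def wshift_def fun_eq_iff algebra_simps)
qed

lemma op_bounded_by_wshift_adj:
  assumes \<sigma>: "inj \<sigma>" and \<alpha>: "\<And>k. \<bar>\<alpha> k\<bar> \<le> u"
  shows "op_bounded_by (wshift_adj \<sigma> \<alpha>) u"
proof -
  have u: "u \<ge> 0" using \<alpha>[of undefined] by linarith
  have "wshift_adj \<sigma> \<alpha> f \<in> l2 \<and> l2_norm (wshift_adj \<sigma> \<alpha> f) \<le> u * l2_norm f" if f: "f \<in> l2" for f
  proof -
    have "L2_set (\<lambda>m. cmod (wshift_adj \<sigma> \<alpha> f m)) F \<le> u * l2_norm f" if F: "finite F" for F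
    proof -
      have "L2_set (\<lambda>m. cmod (wshift_adj \<sigma> \<alpha> f m)) F \<le> L2_set (\<lambda>k. u * cmod (f (\<sigma> k))) F"
        using \<alpha> by (intro L2_set_mono) (auto simp: wshift_adj_def norm_mult intro: mult_right_mono)
      also have "\<dots> = u * L2_set (\<lambda>k. cmod (f k)) (\<sigma> ` F)"
        unfolding L2_set_right_distrib[OF u, symmetric] unfolding L2_set_def using \<sigma>
        by (subst sum.reindex) (auto intro: inj_on_subset)
      also have "\<dots> \<le> u * l2_norm f" using u f F by (intro mult_left_mono L2_set_le_l2_norm) auto
      finally show ?thesis .
    qed
    from l2I[OF this] show ?thesis by auto
  qed
  then show ?thesis using u by (auto simp: op_bounded_by_def wshift_adj_def fun_eq_iff algebra_simps)
qed

lemma l2_inner_wshift: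
  assumes "inj \<sigma>"
  shows "l2_inner (wshift \<sigma> \<alpha> f) g = l2_inner f (wshift_adj \<sigma> \<alpha> g)"
proof -
  have "l2_inner (wshift \<sigma> \<alpha> f) g = (\<Sum>\<^sub>\<infinity>m\<in>range \<sigma>. wshift \<sigma> \<alpha> f m * cnj (g m))"
    unfolding l2_inner_def by (rule infsum_cong_neutral) (auto simp: wshift_def)
  also have "\<dots> = (\<Sum>\<^sub>\<infinity>k. wshift \<sigma> \<alpha> f (\<sigma> k) * cnj (g (\<sigma> k)))"
    using infsum_reindex[OF assms] by (simp add: o_def)
  also have "\<dots> = l2_inner f (wshift_adj \<sigma> \<alpha> g)"
    using assms by (simp add: l2_inner_def wshift_adj_def mult_ac)
  finally show ?thesis .
qed

lemma l2_inner_commute: "l2_inner f g = cnj (l2_inner g f)"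
  by (simp add: l2_inner_def infsum_cnj[symmetric] mult.commute)

lemma op_adjoint_sym: "op_adjoint T S \<Longrightarrow> op_adjoint S T"
  unfolding op_adjoint_def by (metis l2_inner_commute)

lemma op_adjoint_wshift:
  assumes "inj \<sigma>"
  shows "op_adjoint (wshift \<sigma> \<alpha>) (wshift_adj \<sigma> \<alpha>)" "op_adjoint (wshift_adj \<sigma> \<alpha>) (wshift \<sigma> \<alpha>)"
proof -
  show *: "op_adjoint (wshift \<sigma> \<alpha>) (wshift_adj \<sigma> \<alpha>)"
    using l2_inner_wshift[OF assms] by (auto simp: op_adjoint_def)
  show "op_adjoint (wshift_adj \<sigma> \<alpha>) (wshift \<sigma> \<alpha>)" by (rule op_adjoint_sym[OF *])
qed

section \<open>The Pusz--Woronowicz representation\<close>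

definition tail_sum :: "'n::{finite,linorder} \<Rightarrow> ('n \<Rightarrow> nat) \<Rightarrow> nat" where
  "tail_sum j m = (\<Sum>i | j < i. m i)"

text \<open>The weight of \<pi>(x_j) at e_m, with the factor sqrt(1 - q^2) absorbed through (1 -
  q^2) [m_j + 1] = 1 - q^(2 (m_j + 1)).\<close>

definition pw_coeff :: "real \<Rightarrow> 'n::{finite,linorder} \<Rightarrow> ('n \<Rightarrow> nat) \<Rightarrow> real" where
  "pw_coeff q j m = sqrt (1 - (q^2) ^ (m j + 1)) * q ^ tail_sum j m"

definition incr :: "'n \<Rightarrow> ('n \<Rightarrow> nat) \<Rightarrow> 'n \<Rightarrow> nat" where
  "incr j m = m(j := m j + 1)"

lemma inj_incr: "inj (incr j)"
proof (rule injI)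
  fix m m' assume eq: "incr j m = incr j m'"
  show "m = m'"
  proof
    fix i show "m i = m' i" using fun_cong[OF eq, of i] by (cases "i = j") (auto simp: incr_def)
  qed
qed

lemma incr_commute: "incr i (incr j m) = incr j (incr i m)"
  by (auto simp: incr_def fun_eq_iff)

lemma incr_same [simp]: "incr j m j = Suc (m j)" and incr_other: "i \<noteq> j \<Longrightarrow> incr j m i = m i"
  by (auto simp: incr_def)

text \<open>The two branches of a creation operator: at an index that cannot be lowered in direction
  j it gives 0, at any other index it is a multiple of the value one step below.\<close>

lemma incr_cases:
  obtains "m j = 0" | \<nu> where "m = incr j \<nu>"
proof (cases "m j = 0")
  case False
  then have "m = incr j (m(j := m j - 1))" by (auto simp: incr_def)
  with that show ?thesis by blast
qed (use that in blast)

lemma tail_sum_incr: "tail_sum j (incr i m) = tail_sum j m + (if j < i then 1 else 0)"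
proof -
  have "tail_sum j (incr i m) = (\<Sum>l | j < l. m l + (if l = i then 1 else 0))"
    unfolding tail_sum_def incr_def by (rule sum.cong) auto
  then show ?thesis by (simp add: sum.distrib tail_sum_def)
qed

lemma pw_coeff_incr:
  "i \<noteq> j \<Longrightarrow> pw_coeff q j (incr i m) = (if j < i then q else 1) * pw_coeff q j m"
  by (simp add: pw_coeff_def tail_sum_incr incr_other)

lemma pw_coeff_bound:
  assumes q: "0 < q" "q < 1"
  shows "\<bar>pw_coeff q j m\<bar> \<le> 1"
proof -
  have "(q^2) ^ (m j + 1) \<le> 1" using q by (intro power_le_one) (auto simp: power_le_one)
  then have "0 \<le> sqrt (1 - (q^2) ^ (m j + 1))" "sqrt (1 - (q^2) ^ (m j + 1)) \<le> 1" using q by auto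
  moreover have "0 \<le> q ^ tail_sum j m" "q ^ tail_sum j m \<le> 1" using q by (auto simp: power_le_one)
  ultimately show ?thesis unfolding pw_coeff_def by (simp add: mult_le_one)
qed

lemma pw_coeff_square:
  assumes q: "0 < q" "q < 1"
  shows "(pw_coeff q j m)\<^sup>2 = (1 - (q^2) ^ (m j + 1)) * (q^2) ^ tail_sum j m"
proof -
  have "(q^2) ^ (m j + 1) \<le> 1" using q by (intro power_le_one) (auto simp: power_le_one)
  then show ?thesis
    unfolding pw_coeff_def power_mult_distrib by (simp add: power_mult[symmetric] mult.commute)
qed

text \<open>The term at k is t to the sum of the entries after k, minus t to the sum from k on, so
  consecutive terms cancel.\<close>

lemma telescope_tail:
  fixes m :: "'n::linorder \<Rightarrow> nat" and t :: real
  assumes "finite S"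
  shows "(\<Sum>k\<in>S. (1 - t ^ m k) * t ^ (\<Sum>i\<in>{i \<in> S. k < i}. m i)) = 1 - t ^ (\<Sum>i\<in>S. m i)"
  using assms
proof (induction rule: finite_linorder_min_induct)
  case (insert b A)
  have b: "b \<notin> A" using insert by auto
  have "{i \<in> insert b A. b < i} = A" using insert by auto
  moreover have "{i \<in> insert b A. k < i} = {i \<in> A. k < i}" if "k \<in> A" for k using insert that by auto
  ultimately show ?case using b insert by (simp add: algebra_simps power_add)
qed simp

text \<open>The third defining relation evaluated at e_m. Telescoping leaves the common factor q^(2
  tail), and the rest is the identity 1 - t^(m+1) = t (1 - t^m) + (1 - t) with t = q^2.\<close>

lemma pw_coeff_relation:
  fixes m :: "'n::{finite,linorder} \<Rightarrow> nat"
  assumes q: "0 < q" "q < 1"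
  shows "(pw_coeff q i m)\<^sup>2 = q^2 * ((1 - (q^2) ^ m i) * (q^2) ^ tail_sum i m)
    + (1 - q^2) * (1 - (\<Sum>k | k > i. (1 - (q^2) ^ m k) * (q^2) ^ tail_sum k m))"
proof -
  have "{l \<in> {k. i < k}. k < l} = {l. k < l}" if "i < k" for k using that by auto
  then have sum: "(\<Sum>k | k > i. (1 - (q^2) ^ m k) * (q^2) ^ tail_sum k m) = 1 - (q^2) ^ tail_sum i m"
    using telescope_tail[of "{k. i < k}" "q^2" m] by (simp add: tail_sum_def cong: conj_cong)
  show ?thesis unfolding pw_coeff_square[OF q] sum by (simp add: algebra_simps)
qed

text \<open>
  The operators below act on all functions, not only on \<^const>\<open>l2\<close>, so that the defining relations are
  pointwise identities.
\<close>

definition creation :: "real \<Rightarrow> 'n::{finite,linorder} \<Rightarrow> ('n \<Rightarrow> nat) l2_op" where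
  "creation q j = wshift (incr j) (pw_coeff q j)"

definition annihilation :: "real \<Rightarrow> 'n::{finite,linorder} \<Rightarrow> ('n \<Rightarrow> nat) l2_op" where
  "annihilation q j = wshift_adj (incr j) (pw_coeff q j)"

lemma creation_0: "m j = 0 \<Longrightarrow> creation q j f m = 0"
  by (auto simp: creation_def wshift_def)

lemma creation_incr: "creation q j f (incr j m) = of_real (pw_coeff q j m) * f m"
  by (simp add: creation_def inj_incr)

lemma annihilation_eq: "annihilation q j f m = of_real (pw_coeff q j m) * f (incr j m)"
  by (simp add: annihilation_def wshift_adj_def)

text \<open>Both orders raise the same two entries. Only the weight of the smaller index i notices
  the other one, and having raised j before multiplies it by q.\<close>

lemma creation_creation:
  fixes i j :: "'n::{finite,linorder}"
  assumes "i < j"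
  shows "creation q i (creation q j f) = (\<lambda>m. of_real q * creation q j (creation q i f) m)"
proof
  fix m
  show "creation q i (creation q j f) m = of_real q * creation q j (creation q i f) m"
  proof (cases m i rule: incr_cases)
    case 1
    then have *: "creation q i (creation q j f) m = 0" by (rule creation_0)
    show ?thesis
    proof (cases m j rule: incr_cases)
      case (2 \<nu>)
      then have "\<nu> i = 0" using 1 assms by (simp add: incr_other)
      then show ?thesis using * 2 by (simp add: creation_incr creation_0)
    qed (simp add: * creation_0)
  next
    case (2 \<mu>)
    show ?thesis
    proof (cases \<mu> j rule: incr_cases)
      case 1
      then have "m j = 0" using 2 assms by (simp add: incr_other)
      then show ?thesis using 1 2 by (simp add: creation_incr creation_0)
    next
      case (2 \<nu>)
      have "creation q i (creation q j f) m = of_real (pw_coeff q i (incr j \<nu>) * pw_coeff q j \<nu>) * f \<nu>"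
        using \<open>m = incr i \<mu>\<close> 2 by (simp add: creation_incr)
      moreover have "creation q j (creation q i f) m = of_real (pw_coeff q j (incr i \<nu>) * pw_coeff q i \<nu>) * f \<nu>"
        using \<open>m = incr i \<mu>\<close> 2 by (simp add: incr_commute[of i j] creation_incr)
      ultimately show ?thesis using assms by (simp add: pw_coeff_incr)
    qed
  qed
qed

text \<open>Exactly one of the two weights belongs to the smaller index and notices that the other
  entry is one higher, so a single factor q appears whichever index is smaller.\<close>

lemma annihilation_creation:
  fixes i j :: "'n::{finite,linorder}"
  assumes "i \<noteq> j"
  shows "annihilation q i (creation q j f) = (\<lambda>m. of_real q * creation q j (annihilation q i f) m)"
proof
  fix m
  show "annihilation q i (creation q j f) m = of_real q * creation q j (annihilation q i f) m"
  proof (cases m j rule: incr_cases)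
    case 1
    then have "incr i m j = 0" using assms by (simp add: incr_other)
    then show ?thesis using 1 by (simp add: annihilation_eq creation_0)
  next
    case (2 \<nu>)
    have "annihilation q i (creation q j f) m = of_real (pw_coeff q i (incr j \<nu>) * pw_coeff q j (incr i \<nu>)) * f (incr i \<nu>)"
      using 2 by (simp add: annihilation_eq incr_commute[of i j] creation_incr)
    moreover have "creation q j (annihilation q i f) m = of_real (pw_coeff q j \<nu> * pw_coeff q i \<nu>) * f (incr i \<nu>)"
      using 2 by (simp add: annihilation_eq creation_incr)
    ultimately show ?thesis using assms by (auto simp: pw_coeff_incr)
  qed
qed

lemma annihilation_creation_same:
  "annihilation q i (creation q i f) m = of_real ((pw_coeff q i m)\<^sup>2) * f m"
  by (simp add: annihilation_eq creation_incr power2_eq_square)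

lemma creation_annihilation:
  assumes q: "0 < q" "q < 1"
  shows "creation q k (annihilation q k f) m = of_real ((1 - (q^2) ^ m k) * (q^2) ^ tail_sum k m) * f m"
proof (cases m k rule: incr_cases)
  case (2 \<nu>)
  then have "creation q k (annihilation q k f) m = of_real ((pw_coeff q k \<nu>)\<^sup>2) * f m"
    by (simp add: annihilation_eq creation_incr power2_eq_square)
  then show ?thesis unfolding pw_coeff_square[OF q] using 2 by (simp add: tail_sum_incr)
qed (simp add: creation_0)

lemma annihilation_creation_relation:
  assumes q: "0 < q" "q < 1"
  shows "annihilation q i (creation q i f) m = of_real (q^2) * creation q i (annihilation q i f) m
    + of_real (1 - q^2) * (f m - (\<Sum>k | k > i. creation q k (annihilation q k f) m))"
proof -
  have "(\<Sum>k | k > i. creation q k (annihilation q k f) m) =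
      of_real (\<Sum>k | k > i. (1 - (q^2) ^ m k) * (q^2) ^ tail_sum k m) * f m"
    unfolding creation_annihilation[OF q] of_real_sum sum_distrib_right ..
  moreover have "of_real ((pw_coeff q i m)\<^sup>2) * f m = of_real (q^2) * (of_real ((1 - (q^2) ^ m i) * (q^2) ^ tail_sum i m) * f m)
    + of_real (1 - q^2) * (f m - of_real (\<Sum>k | k > i. (1 - (q^2) ^ m k) * (q^2) ^ tail_sum k m) * f m)"
    unfolding pw_coeff_relation[OF q] by (simp add: algebra_simps)
  ultimately show ?thesis
    by (simp only: annihilation_creation_same creation_annihilation[OF q])
qed

section \<open>The action of words and of the free algebra\<close>

fun letter_op :: "real \<Rightarrow> 'n::{finite,linorder} gen \<Rightarrow> ('n \<Rightarrow> nat) l2_op" where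
  "letter_op q (Gen j) = creation q j"
| "letter_op q (Gen_star j) = annihilation q j"

definition word_op :: "real \<Rightarrow> 'n::{finite,linorder} gen list \<Rightarrow> ('n \<Rightarrow> nat) l2_op" where
  "word_op q gs = foldr (letter_op q) gs"

lemma word_op_simps [simp]:
  "word_op q [] f = f" "word_op q (g # gs) f = letter_op q g (word_op q gs f)"
  "word_op q (gs @ hs) f = word_op q gs (word_op q hs f)"
  by (simp_all add: word_op_def)

lemma word_op_linear:
  "word_op q gs (\<lambda>m. f m + g m) = (\<lambda>m. word_op q gs f m + word_op q gs g m)"
  "word_op q gs (\<lambda>m. c * f m) = (\<lambda>m. c * word_op q gs f m)"
proof -
  have *: "letter_op q g (\<lambda>m. f m + h m) = (\<lambda>m. letter_op q g f m + letter_op q g h m)"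
    "letter_op q g (\<lambda>m. c * f m) = (\<lambda>m. c * letter_op q g f m)" for g f h
    by (cases g; auto simp: creation_def annihilation_def wshift_def wshift_adj_def fun_eq_iff algebra_simps)+
  show "word_op q gs (\<lambda>m. f m + g m) = (\<lambda>m. word_op q gs f m + word_op q gs g m)"
    "word_op q gs (\<lambda>m. c * f m) = (\<lambda>m. c * word_op q gs f m)"
    by (induction gs) (simp_all add: *)
qed

lemma word_op_sum: "finite I \<Longrightarrow> word_op q gs (\<lambda>m. \<Sum>i\<in>I. f i m) = (\<lambda>m. \<Sum>i\<in>I. word_op q gs (f i) m)"
proof (induction I rule: finite_induct)
  case empty
  then show ?case using word_op_linear(2)[of q gs 0] by simp
qed (simp add: word_op_linear)

definition free_op :: "real \<Rightarrow> 'n::{finite,linorder} free \<Rightarrow> ('n \<Rightarrow> nat) l2_op" where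
  "free_op q a f = (\<lambda>m. \<Sum>w\<in>Poly_Mapping.keys a. Poly_Mapping.lookup a w * word_op q (letters w) f m)"

lemma free_op_superset:
  assumes "finite K" "Poly_Mapping.keys a \<subseteq> K"
  shows "free_op q a f m = (\<Sum>w\<in>K. Poly_Mapping.lookup a w * word_op q (letters w) f m)"
  unfolding free_op_def using assms by (intro sum.mono_neutral_left) (auto simp: in_keys_iff)

lemma free_op_add: "free_op q (a + b) f = (\<lambda>m. free_op q a f m + free_op q b f m)"
proof
  fix m
  let ?K = "Poly_Mapping.keys a \<union> Poly_Mapping.keys b"
  show "free_op q (a + b) f m = free_op q a f m + free_op q b f m"
    using Poly_Mapping.keys_add[of a b]
    by (simp add: free_op_superset[of ?K] lookup_add distrib_right sum.distrib)
qed

lemma free_op_zero: "free_op q 0 f = (\<lambda>m. 0)"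
  by (simp add: free_op_def)

lemma free_op_uminus: "free_op q (- a) f = (\<lambda>m. - free_op q a f m)"
  using free_op_add[of q a "- a" f] by (simp add: free_op_zero fun_eq_iff add_eq_0_iff)

lemma free_op_diff: "free_op q (a - b) f = (\<lambda>m. free_op q a f m - free_op q b f m)"
  using free_op_add[of q a "- b" f] by (simp add: free_op_uminus)

lemma free_op_sum: "finite I \<Longrightarrow> free_op q (\<Sum>i\<in>I. a i) f = (\<lambda>m. \<Sum>i\<in>I. free_op q (a i) f m)"
  by (induction I rule: finite_induct) (simp_all add: free_op_zero free_op_add)

lemma free_op_single: "free_op q (Poly_Mapping.single w c) f = (\<lambda>m. c * word_op q (letters w) f m)"
  by (simp add: free_op_def keys_single fun_eq_iff)

lemma free_expand: "a = (\<Sum>w\<in>Poly_Mapping.keys a. Poly_Mapping.single w (Poly_Mapping.lookup a w))"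
  by (rule poly_mapping_eqI)
    (simp add: lookup_sum lookup_single when_def in_keys_iff)

lemma free_op_single_mult:
  "free_op q (Poly_Mapping.single w c * b) f = (\<lambda>m. c * word_op q (letters w) (free_op q b f) m)"
proof -
  let ?b = "\<lambda>v. Poly_Mapping.single v (Poly_Mapping.lookup b v)"
  have "free_op q (Poly_Mapping.single w c * b) f =
      free_op q (\<Sum>v\<in>Poly_Mapping.keys b. Poly_Mapping.single (w + v) (c * Poly_Mapping.lookup b v)) f"
    by (subst free_expand[of b]) (simp add: sum_distrib_left mult_single)
  also have "\<dots> = (\<lambda>m. c * word_op q (letters w) (free_op q b f) m)"
    by (simp add: free_op_sum free_op_single plus_word_def free_op_def[of q b] word_op_sum word_op_linear
        sum_distrib_left mult.assoc)
  finally show ?thesis .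
qed

lemma free_op_mult: "free_op q (a * b) f = free_op q a (free_op q b f)"
proof -
  have "free_op q (a * b) f = free_op q (\<Sum>w\<in>Poly_Mapping.keys a. Poly_Mapping.single w (Poly_Mapping.lookup a w) * b) f"
    by (subst free_expand[of a]) (simp add: sum_distrib_right)
  then show ?thesis by (simp add: free_op_sum free_op_single_mult free_op_def[of q a])
qed

lemma free_op_scal: "free_op q (scal c a) f = (\<lambda>m. c * free_op q a f m)"
  by (simp add: scal_def free_op_single_mult zero_word_def)

lemma free_op_one: "free_op q 1 f = f"
proof -
  have "free_op q (Poly_Mapping.single 0 1) f = f"
    unfolding free_op_single by (simp add: zero_word_def)
  then show ?thesis by simp
qed

lemma free_op_fX: "free_op q (fX j) f = creation q j f" "free_op q (fXs j) f = annihilation q j f"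
  by (simp_all add: fX_def fXs_def free_op_single)

lemma free_op_relations:
  assumes q: "0 < q" "q < 1" and a: "a \<in> pol_relations q"
  shows "free_op q a f = (\<lambda>m. 0)"
  using a unfolding pol_relations_def
proof (elim UnE CollectE exE conjE)
  fix i j assume "a = fX i * fX j - scal (of_real q) (fX j * fX i)" "i < j"
  then show ?thesis by (simp add: free_op_diff free_op_mult free_op_scal free_op_fX creation_creation)
next
  fix i j assume "a = fXs i * fX j - scal (of_real q) (fX j * fXs i)" "i \<noteq> j"
  then show ?thesis by (simp add: free_op_diff free_op_mult free_op_scal free_op_fX annihilation_creation)
next
  fix i assume "a = fXs i * fX i - (scal (of_real (q^2)) (fX i * fXs i)
        + scal (of_real (1 - q^2)) (1 - (\<Sum>k | k > i. fX k * fXs k)))"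
  then show ?thesis
    by (simp only: free_op_diff free_op_mult free_op_scal free_op_fX free_op_add free_op_one
        free_op_sum[OF finite] annihilation_creation_relation[OF q] diff_self)
qed

lemma op_bounded_by_letter:
  assumes q: "0 < q" "q < 1" shows "op_bounded_by (letter_op q g) 1"
  using q by (cases g) (auto simp: creation_def annihilation_def
      intro!: op_bounded_by_wshift op_bounded_by_wshift_adj inj_incr pw_coeff_bound)

lemma op_bounded_by_word:
  assumes q: "0 < q" "q < 1" shows "op_bounded_by (word_op q gs) 1"
proof (induction gs)
  case Nil
  show ?case using op_bounded_by_id by (simp add: word_op_def id_def)
next
  case (Cons g gs)
  then show ?case using op_bounded_by_comp[OF op_bounded_by_letter[OF q] Cons] by (simp add: word_op_def o_def)
qed

lemma op_bounded_by_free: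
  assumes q: "0 < q" "q < 1"
  shows "\<exists>B. op_bounded_by (free_op q a) B"
  using op_bounded_by_sum[of "Poly_Mapping.keys a" "\<lambda>w f k. Poly_Mapping.lookup a w * word_op q (letters w) f k",
      OF finite_keys op_bounded_by_smult[OF op_bounded_by_word[OF q]]]
  unfolding free_op_def by blast

lemma op_adjoint_letter: "op_adjoint (letter_op q g) (letter_op q (gen_star g))"
  by (cases g) (simp_all add: creation_def annihilation_def op_adjoint_wshift inj_incr)

lemma op_adjoint_word:
  assumes q: "0 < q" "q < 1"
  shows "op_adjoint (word_op q gs) (word_op q (rev (map gen_star gs)))"
proof (induction gs)
  case Nil
  show ?case using op_adjoint_id by (simp add: word_op_def id_def)
next
  case (Cons g gs)
  show ?case
    using op_adjoint_comp[OF op_adjoint_letter Cons op_bounded_by_word[OF q] op_bounded_by_letter[OF q]]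
    by (simp add: word_op_def o_def)
qed

text \<open>Lets the adjoints of the defining relations be dealt with as adjoint operators, without
  writing those relations out.\<close>

lemma op_adjoint_free:
  assumes q: "0 < q" "q < 1"
  shows "op_adjoint (free_op q a) (free_op q (free_star a))"
proof -
  have "free_op q (free_star a) = (\<lambda>f k. \<Sum>w\<in>Poly_Mapping.keys a.
      cnj (Poly_Mapping.lookup a w) * word_op q (rev (map gen_star (letters w))) f k)"
    by (simp add: fun_eq_iff free_star_def free_op_sum free_op_single)
  moreover have "free_op q a = (\<lambda>f k. \<Sum>w\<in>Poly_Mapping.keys a.
      Poly_Mapping.lookup a w * word_op q (letters w) f k)"
    by (simp add: fun_eq_iff free_op_def)
  ultimately show ?thesis
    using op_adjoint_lincomb[OF finite_keys op_adjoint_word[OF q] op_bounded_by_word[OF q] op_bounded_by_word[OF q]]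
    by simp
qed

text \<open>Pairing with the basis vectors recovers the coordinates of S g.\<close>

lemma op_adjoint_zero:
  assumes adj: "op_adjoint T S" and T: "\<And>f. f \<in> l2 \<Longrightarrow> T f = (\<lambda>m. 0)" and g: "g \<in> l2"
  shows "S g = (\<lambda>m. 0)"
proof
  fix k
  have "l2_inner (T (l2_basis k)) g = l2_inner (l2_basis k) (S g)"
    using adj g by (simp add: op_adjoint_def l2_basis(1))
  then show "S g k = 0" using T[OF l2_basis(1)] by (simp add: l2_inner_basis) (simp add: l2_inner_def)
qed

section \<open>The ideal of relations and its quotient\<close>

lemma ring_free_alg: "ring free_alg"
proof (rule ringI)
  show "abelian_group free_alg"
    by (rule abelian_groupI) (auto simp: free_alg_def add_ac intro: exI[of _ "- _"])
  show "Group.monoid free_alg"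
    by (rule monoidI) (auto simp: free_alg_def mult.assoc)
qed (auto simp: free_alg_def algebra_simps)

lemma ideal_free_algI:
  assumes "0 \<in> I" "\<And>a b. a \<in> I \<Longrightarrow> b \<in> I \<Longrightarrow> a + b \<in> I"
    and "\<And>a b. b \<in> I \<Longrightarrow> a * b \<in> I" "\<And>a b. b \<in> I \<Longrightarrow> b * a \<in> I"
  shows "ideal I free_alg"
proof (rule idealI[OF ring_free_alg])
  interpret ring free_alg by (rule ring_free_alg)
  have neg: "\<ominus>\<^bsub>free_alg\<^esub> a = - a" for a :: "'a free"
    by (rule minus_equality) (auto simp: free_alg_def)
  show "subgroup I (add_monoid free_alg)"
  proof (rule subgroup.intro)
    show "inv\<^bsub>add_monoid free_alg\<^esub> a \<in> I" if "a \<in> I" for a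
      using assms(3)[of a "- 1"] that neg[of a] by (simp add: a_inv_def)
  qed (use assms in \<open>auto simp: free_alg_def\<close>)
qed (use assms in \<open>auto simp: free_alg_def\<close>)

lemma ideal_pol_ideal: "ideal (pol_ideal q) free_alg"
  unfolding pol_ideal_def by (rule ring.genideal_ideal[OF ring_free_alg]) (simp add: free_alg_def)

lemma pol_ideal_closed:
  fixes a b :: "'n::{finite,linorder} free"
  shows "(0 :: 'n free) \<in> pol_ideal q"
  "a \<in> pol_ideal q \<Longrightarrow> b \<in> pol_ideal q \<Longrightarrow> a + b \<in> pol_ideal q"
  "b \<in> pol_ideal q \<Longrightarrow> a * b \<in> pol_ideal q"
  "b \<in> pol_ideal q \<Longrightarrow> b * a \<in> pol_ideal q"
proof -
  interpret ideal "pol_ideal q :: 'n free set" free_alg by (rule ideal_pol_ideal)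
  show "(0 :: 'n free) \<in> pol_ideal q" using additive_subgroup.zero_closed[OF is_additive_subgroup] by (simp add: free_alg_def)
  show "a \<in> pol_ideal q \<Longrightarrow> b \<in> pol_ideal q \<Longrightarrow> a + b \<in> pol_ideal q"
    using additive_subgroup.a_closed[OF is_additive_subgroup, of a b] by (simp add: free_alg_def)
  show "b \<in> pol_ideal q \<Longrightarrow> a * b \<in> pol_ideal q" "b \<in> pol_ideal q \<Longrightarrow> b * a \<in> pol_ideal q"
    using I_l_closed[of b a] I_r_closed[of b a] by (simp_all add: free_alg_def)
qed

lemma pol_ideal_uminus: "a \<in> pol_ideal q \<Longrightarrow> - a \<in> pol_ideal q"
  using pol_ideal_closed(3)[of a q "- 1"] by simp

lemma pol_ideal_diff: "a \<in> pol_ideal q \<Longrightarrow> b \<in> pol_ideal q \<Longrightarrow> a - b \<in> pol_ideal q"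
  using pol_ideal_closed(2)[of a q "- b"] pol_ideal_uminus by auto

lemma pol_ideal_scal: "a \<in> pol_ideal q \<Longrightarrow> scal c a \<in> pol_ideal q"
  unfolding scal_def by (rule pol_ideal_closed)

lemma pol_ideal_relation: "a \<in> pol_relations q \<Longrightarrow> a \<in> pol_ideal q"
  unfolding pol_ideal_def
  using ring.genideal_self[OF ring_free_alg, of "pol_relations q \<union> free_star ` pol_relations q"]
  by (auto simp: free_alg_def)

lemma in_pol_class: "b \<in> pol_class q a \<longleftrightarrow> b - a \<in> pol_ideal q"
proof
  show "b - a \<in> pol_ideal q \<Longrightarrow> b \<in> pol_class q a"
    unfolding pol_class_def a_r_coset_def' by (auto simp: free_alg_def intro!: bexI[of _ "b - a"])
qed (auto simp: pol_class_def a_r_coset_def' free_alg_def)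

lemma pol_class_self: "a \<in> pol_class q a"
  by (simp add: in_pol_class pol_ideal_closed)

lemma pol_class_eq_iff: "pol_class q a = pol_class q b \<longleftrightarrow> a - b \<in> pol_ideal q"
proof
  assume "pol_class q a = pol_class q b"
  then show "a - b \<in> pol_ideal q" using pol_class_self[of a q] by (simp add: in_pol_class)
next
  assume ab: "a - b \<in> pol_ideal q"
  have "c - a \<in> pol_ideal q \<longleftrightarrow> c - b \<in> pol_ideal q" for c
    using pol_ideal_closed(2)[of "c - a" q "a - b"] pol_ideal_diff[of "c - b" q "a - b"] ab by auto
  then show "pol_class q a = pol_class q b" by (auto simp: in_pol_class)
qed

lemma scal_diff: "scal c (a - b) = scal c a - scal c b"
  by (simp add: scal_def algebra_simps)

lemma pol_simps:
  fixes a b :: "'n::{finite,linorder} free"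
  shows "carrier (pol q) = range (pol_class q :: 'n free \<Rightarrow> _)"
  "\<one>\<^bsub>pol q\<^esub> = pol_class q (1 :: 'n free)"
  "\<zero>\<^bsub>pol q\<^esub> = pol_class q (0 :: 'n free)"
  "pol_class q a \<oplus>\<^bsub>pol q\<^esub> pol_class q b = pol_class q (a + b)"
  "pol_class q a \<otimes>\<^bsub>pol q\<^esub> pol_class q b = pol_class q (a * b)"
  "c \<odot>\<^bsub>pol q\<^esub> pol_class q a = pol_class q (scal c a)"
proof -
  interpret ideal "pol_ideal q :: 'n free set" free_alg by (rule ideal_pol_ideal)
  have hom: "(pol_class q :: 'n free \<Rightarrow> _) \<in> ring_hom free_alg (free_alg Quot pol_ideal q)"
    using rcos_ring_hom unfolding pol_class_def[abs_def] .
  show "carrier (pol q) = range (pol_class q :: 'n free \<Rightarrow> _)"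
    by (auto simp: pol_def Let_def FactRing_def A_RCOSETS_def' pol_class_def free_alg_def)
  show "\<one>\<^bsub>pol q\<^esub> = pol_class q (1 :: 'n free)" using ring_hom_one[OF hom] by (simp add: pol_def Let_def free_alg_def)
  show "\<zero>\<^bsub>pol q\<^esub> = pol_class q (0 :: 'n free)"
    by (auto simp: pol_def Let_def FactRing_def in_pol_class)
  show "pol_class q a \<oplus>\<^bsub>pol q\<^esub> pol_class q b = pol_class q (a + b)"
    using ring_hom_add[OF hom, of a b] by (simp add: pol_def Let_def free_alg_def)
  show "pol_class q a \<otimes>\<^bsub>pol q\<^esub> pol_class q b = pol_class q (a * b)"
    using ring_hom_mult[OF hom, of a b] by (simp add: pol_def Let_def free_alg_def)
  \<comment> \<open>Scalar multiplication in the quotient is a union over representatives; all of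
    them give the same class, so the union is that class.\<close>
  have "pol_class q (scal c b) = pol_class q (scal c a)" if "b \<in> pol_class q a" for b :: "'n free"
    using that pol_ideal_scal[of "b - a" q c] by (simp add: in_pol_class pol_class_eq_iff scal_diff)
  then have "(\<Union>b\<in>pol_class q a. pol_class q (scal c b)) = pol_class q (scal c a)"
    using pol_class_self[of a q] by blast
  then show "c \<odot>\<^bsub>pol q\<^esub> pol_class q a = pol_class q (scal c a)" by (simp add: pol_def Let_def)
qed

lemma free_op_pol_ideal:
  assumes q: "0 < q" "q < 1" and a: "a \<in> pol_ideal q" and f: "f \<in> l2"
  shows "free_op q a f = (\<lambda>m. 0)"
proof -
  let ?K = "{a. \<forall>f\<in>l2. free_op q a f = (\<lambda>m. 0)}"
  have l2: "free_op q a f \<in> l2" if "f \<in> l2" for a f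
    using op_bounded_by_free[OF q, of a] that by (auto dest: op_bounded_byD)
  have zero: "free_op q a (\<lambda>m. 0) = (\<lambda>m. 0)" for a
    using op_bounded_by_free[OF q, of a] op_bounded_byD(5)[of "free_op q a" _ "\<lambda>m. 0" 0] by (auto simp: l2_zero)
  \<comment> \<open>On \<^const>\<open>l2\<close> the adjoint relations act as adjoints of zero operators.\<close>
  have "ideal ?K free_alg"
    by (rule ideal_free_algI) (auto simp: free_op_zero free_op_add free_op_mult zero l2)
  moreover have "free_star a \<in> ?K" if "a \<in> pol_relations q" for a
    using op_adjoint_zero[OF op_adjoint_free[OF q] free_op_relations[OF q that]] by simp
  then have "pol_relations q \<union> free_star ` pol_relations q \<subseteq> ?K"
    using free_op_relations[OF q] by auto
  ultimately have "pol_ideal q \<subseteq> ?K"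
    unfolding pol_ideal_def by (rule ring.genideal_minimal[OF ring_free_alg])
  then show ?thesis using a f by auto
qed

text \<open>An arbitrary representative is chosen; on \<open>l2\<close> all representatives act
  alike, because their differences lie in the ideal of relations.\<close>

definition explicit_rep :: "real \<Rightarrow> 'n::{finite,linorder} free set \<Rightarrow> ('n \<Rightarrow> nat) l2_op" where
  "explicit_rep q A = free_op q (SOME a. a \<in> A)"

lemma free_op_pol_class:
  assumes q: "0 < q" "q < 1" and f: "f \<in> l2" and b: "b \<in> pol_class q a"
  shows "free_op q b f = free_op q a f"
  using free_op_pol_ideal[OF q _ f, of "b - a"] b by (simp add: in_pol_class free_op_diff fun_eq_iff)

lemma explicit_rep_class:
  assumes q: "0 < q" "q < 1" and f: "f \<in> l2"
  shows "explicit_rep q (pol_class q a) f = free_op q a f"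
  unfolding explicit_rep_def using someI[of "\<lambda>b. b \<in> pol_class q a", OF pol_class_self]
  by (rule free_op_pol_class[OF q f])

lemma creation_coefficient:
  assumes q: "0 < q" "q < 1"
  shows "sqrt (1 - q^2) * sqrt (qint (q^2) (k j + 1)) * q ^ (\<Sum>i | i > j. k i) = pw_coeff q j k"
proof -
  have "(1 - q^2) * qint (q^2) (k j + 1) = 1 - (q^2) ^ (k j + 1)"
    unfolding qint_def using q by (subst sum_gp_strict) (auto simp: power2_eq_1_iff)
  then show ?thesis by (simp add: pw_coeff_def tail_sum_def real_sqrt_mult[symmetric])
qed

lemma is_pw_rep_explicit:
  assumes q: "0 < q" "q < 1"
  shows "is_pw_rep q (explicit_rep q :: 'n::{finite,linorder} free set \<Rightarrow> _)"
  unfolding is_pw_rep_def l2_star_rep_def pol_simps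
proof (intro conjI ballI allI; (elim rangeE)?)
  fix A and a :: "'n free" assume A: "A = pol_class q a"
  show "l2_bounded_op (explicit_rep q A)"
    using op_bounded_by_free[OF q] by (simp add: l2_bounded_op_iff explicit_rep_def)
next
  fix f :: "('n \<Rightarrow> nat) \<Rightarrow> complex" assume f: "f \<in> l2"
  show "explicit_rep q (pol_class q 1) f = f" using q f by (simp add: explicit_rep_class free_op_one)
  fix A B and a b :: "'n free" assume A: "A = pol_class q a" "B = pol_class q b"
  show "explicit_rep q (A \<oplus>\<^bsub>pol q\<^esub> B) f = (\<lambda>k. explicit_rep q A f k + explicit_rep q B f k)"
    using q f by (simp add: A pol_simps explicit_rep_class free_op_add)
  have "free_op q b f \<in> l2" using op_bounded_by_free[OF q, of b] f by (auto dest: op_bounded_byD)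
  then show "explicit_rep q (A \<otimes>\<^bsub>pol q\<^esub> B) f = explicit_rep q A (explicit_rep q B f)"
    using q f by (simp add: A pol_simps explicit_rep_class free_op_mult)
next
  fix f :: "('n \<Rightarrow> nat) \<Rightarrow> complex" and c A and a :: "'n free" assume f: "f \<in> l2" and A: "A = pol_class q a"
  show "explicit_rep q (c \<odot>\<^bsub>pol q\<^esub> A) f = (\<lambda>k. c * explicit_rep q A f k)"
    using q f by (simp add: A pol_simps explicit_rep_class free_op_scal)
next
  fix f g :: "('n \<Rightarrow> nat) \<Rightarrow> complex" and A and a :: "'n free" assume fg: "f \<in> l2" "g \<in> l2" and A: "A = pol_class q a"
  \<comment> \<open>Whether \<^const>\<open>pol_star\<close> respects classes does not matter: any choice from it is \<open>free_star b\<close> with \<open>b \<in> A\<close>.\<close>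
  obtain b where b: "b \<in> A" "(SOME c. c \<in> pol_star A) = free_star b"
    using someI[of "\<lambda>c. c \<in> pol_star A" "free_star a"] pol_class_self[of a q] A
    by (auto simp: pol_star_def)
  have "l2_inner (free_op q b f) g = l2_inner f (free_op q (free_star b) g)"
    using op_adjoint_free[OF q, of b] fg by (simp add: op_adjoint_def)
  then show "l2_inner (explicit_rep q A f) g = l2_inner f (explicit_rep q (pol_star A) g)"
    using b free_op_pol_class[OF q fg(1)] A explicit_rep_class[OF q fg(1)]
    by (simp add: explicit_rep_def)
next
  fix j :: 'n and k
  show "explicit_rep q (px q j) (l2_basis k) =
    (\<lambda>m. of_real (sqrt (1 - q^2) * sqrt (qint (q^2) (k j + 1)) * q ^ (\<Sum>i | i > j. k i))
            * l2_basis (k(j := k j + 1)) m)"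
    unfolding creation_coefficient[OF q] px_def explicit_rep_class[OF q l2_basis(1)] free_op_fX
    by (simp add: creation_def wshift_basis inj_incr incr_def)
qed

text \<open>From here on the chosen representation is known through its specification; the explicit
  operators have served as the witness for the choice.\<close>

lemma is_pw_rep_pw_rep: "0 < q \<Longrightarrow> q < 1 \<Longrightarrow> is_pw_rep q (pw_rep q)"
  unfolding pw_rep_def by (rule someI[of "is_pw_rep q", OF is_pw_rep_explicit])

section \<open>Ordered monomials\<close>

definition gen_word :: "'n list \<Rightarrow> 'n free" where
  "gen_word js = Poly_Mapping.single (Word (map Gen js)) 1"

lemma gen_word_simps:
  "gen_word [] = 1" "gen_word (j # js) = fX j * gen_word js" "gen_word (js @ ls) = gen_word js * gen_word ls"
  by (simp_all add: gen_word_def fX_def mult_single plus_word_def) (simp flip: zero_word_def)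

lemma scal_simps:
  "scal a (scal b x) = scal (a * b) x" "scal 1 x = x" "scal a x * y = scal a (x * y)" "scal 0 x = 0"
  "scal (a + b) x = scal a x + scal b x" "scal a 0 = 0"
  by (simp_all add: scal_def mult.assoc[symmetric] mult_single single_add distrib_right)

lemma scal_central: "x * scal a y = scal a (x * y)"
proof -
  have *: "Poly_Mapping.single w c * Poly_Mapping.single 0 a = Poly_Mapping.single 0 a * Poly_Mapping.single w c"
    for w :: "'a gen word" and c :: complex by (simp add: mult_single mult.commute)
  have "x * Poly_Mapping.single 0 a = Poly_Mapping.single 0 a * x"
    by (subst (1 2) free_expand[of x]) (simp add: sum_distrib_left sum_distrib_right *)
  then show ?thesis by (simp add: scal_def mult.assoc[symmetric])
qed

lemma scal_sum_left: "scal (\<Sum>i\<in>I. a i) x = (\<Sum>i\<in>I. scal (a i) x)"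
  by (induction I rule: infinite_finite_induct) (simp_all add: scal_simps)

lemma scal_sum: "scal a (\<Sum>i\<in>I. f i) = (\<Sum>i\<in>I. scal a (f i))"
  by (simp add: scal_def sum_distrib_left)

lemma pol_class_mult_cong:
  assumes "pol_class q a = pol_class q a'" "pol_class q b = pol_class q b'"
  shows "pol_class q (a * b) = pol_class q (a' * b')"
proof -
  have "a * b - a' * b' = (a - a') * b + a' * (b - b')" by (simp add: algebra_simps)
  then show ?thesis
    using assms unfolding pol_class_eq_iff by (auto intro: pol_ideal_closed)
qed

lemma pol_class_scal_cong: "pol_class q a = pol_class q b \<Longrightarrow> pol_class q (scal c a) = pol_class q (scal c b)"
  unfolding pol_class_eq_iff scal_diff[symmetric] by (rule pol_ideal_scal)

lemma pol_class_add_cong: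
  "pol_class q a = pol_class q a' \<Longrightarrow> pol_class q b = pol_class q b' \<Longrightarrow> pol_class q (a + b) = pol_class q (a' + b')"
  unfolding pol_class_eq_iff using pol_ideal_closed(2)[of "a - a'" q "b - b'"] by (simp add: algebra_simps)

lemma pol_class_sum_cong:
  "(\<And>i. i \<in> I \<Longrightarrow> pol_class q (f i) = pol_class q (g i)) \<Longrightarrow> pol_class q (\<Sum>i\<in>I. f i) = pol_class q (\<Sum>i\<in>I. g i)"
proof (induction I rule: infinite_finite_induct)
  case (insert i I)
  have "pol_class q (f i + sum f I) = pol_class q (g i + sum g I)"
    by (rule pol_class_add_cong) (use insert in simp_all)
  then show ?case using insert by simp
qed simp_all

text \<open>The defining relation rewrites increasing pairs; sorting has to rewrite decreasing ones,
  hence the inverse of q.\<close>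

lemma pol_class_swap:
  assumes q: "q \<noteq> 0" and "i < j"
  shows "pol_class q (fX j * fX i) = pol_class q (scal (of_real (inverse q)) (fX i * fX j))"
proof -
  have "fX i * fX j - scal (of_real q) (fX j * fX i) \<in> pol_ideal q"
    using assms by (intro pol_ideal_relation) (auto simp: pol_relations_def)
  then have "pol_class q (fX i * fX j) = pol_class q (scal (of_real q) (fX j * fX i))"
    by (simp add: pol_class_eq_iff)
  from pol_class_scal_cong[OF this, of "of_real (inverse q)"] show ?thesis
    using q by (simp add: scal_simps)
qed

text \<open>Insertion sort moves the letter j past smaller letters, each time by one commutation;
  the accumulated power of q is not tracked.\<close>

lemma gen_word_insort:
  assumes q: "q \<noteq> 0"
  shows "\<exists>c. pol_class q (gen_word (j # js)) = pol_class q (scal c (gen_word (insort j js)))"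
proof (induction js)
  case Nil
  show ?case by (auto simp: scal_simps intro: exI[of _ 1])
next
  case (Cons y ys)
  show ?case
  proof (cases "j \<le> y")
    case True
    then show ?thesis by (auto simp: scal_simps intro: exI[of _ 1])
  next
    case False
    obtain c where c: "pol_class q (gen_word (j # ys)) = pol_class q (scal c (gen_word (insort j ys)))"
      using Cons by blast
    have "pol_class q (gen_word (j # y # ys)) = pol_class q (fX j * fX y * gen_word ys)"
      by (simp add: gen_word_simps mult.assoc)
    also have "\<dots> = pol_class q (scal (of_real (inverse q)) (fX y * fX j) * gen_word ys)"
      by (intro pol_class_mult_cong pol_class_swap q refl) (use False in simp)
    also have "\<dots> = pol_class q (scal (of_real (inverse q)) (fX y * gen_word (j # ys)))"
      by (simp add: gen_word_simps scal_simps mult.assoc)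
    also have "\<dots> = pol_class q (scal (of_real (inverse q)) (fX y * scal c (gen_word (insort j ys))))"
      by (intro pol_class_scal_cong pol_class_mult_cong c refl)
    finally show ?thesis using False by (auto simp: scal_central scal_simps gen_word_simps)
  qed
qed

lemma gen_word_sort:
  assumes q: "q \<noteq> 0"
  shows "\<exists>c. pol_class q (gen_word js) = pol_class q (scal c (gen_word (sort js)))"
proof (induction js)
  case Nil
  show ?case by (auto simp: scal_simps intro: exI[of _ 1])
next
  case (Cons j js)
  then obtain c where c: "pol_class q (gen_word js) = pol_class q (scal c (gen_word (sort js)))" by blast
  obtain d where d: "pol_class q (gen_word (j # sort js)) = pol_class q (scal d (gen_word (insort j (sort js))))"
    using gen_word_insort[OF q] by blast
  have "pol_class q (gen_word (j # js)) = pol_class q (fX j * scal c (gen_word (sort js)))"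
    unfolding gen_word_simps by (intro pol_class_mult_cong c refl)
  also have "\<dots> = pol_class q (scal c (gen_word (j # sort js)))" by (simp add: gen_word_simps scal_central)
  also have "\<dots> = pol_class q (scal c (scal d (gen_word (insort j (sort js)))))"
    by (intro pol_class_scal_cong d)
  finally show ?case by (auto simp: scal_simps)
qed

section \<open>Multi-indices as sorted words and their action on basis vectors\<close>

definition multi_list :: "('n::{finite,linorder} \<Rightarrow> nat) \<Rightarrow> 'n list" where
  "multi_list k = sorted_list_of_multiset (Abs_multiset k)"

definition letter_count :: "'n list \<Rightarrow> 'n \<Rightarrow> nat" where
  "letter_count js = count (mset js)"

lemma letter_count_simps:
  "letter_count [] = (\<lambda>i. 0)" "letter_count (j # js) = incr j (letter_count js)"
  "letter_count (js @ ls) = (\<lambda>i. letter_count js i + letter_count ls i)"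
  by (auto simp: letter_count_def incr_def fun_eq_iff)

lemma letter_count_multi_list [simp]: "letter_count (multi_list k) = k"
  by (simp add: letter_count_def multi_list_def count_Abs_multiset)

lemma sorted_multi_list [simp]: "sorted (multi_list k)"
  by (simp add: multi_list_def)

lemma sort_eq_multi_list: "sort js = multi_list (letter_count js)"
  by (simp add: multi_list_def letter_count_def count_inverse)

lemma length_multi_list: "length (multi_list k) = total k"
proof -
  have "length (multi_list k) = size (Abs_multiset k)"
    unfolding multi_list_def by (metis size_mset mset_sorted_list_of_multiset)
  also have "\<dots> = (\<Sum>i\<in>set_mset (Abs_multiset k). k i)"
    by (simp add: size_multiset_overloaded_eq count_Abs_multiset)
  also have "\<dots> = total k"
    by (rule sum.mono_neutral_left) (auto simp: count_Abs_multiset simp flip: count_greater_zero_iff)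
  finally show ?thesis .
qed

text \<open>The letters of a word act from the right, so the weight of j is taken at an index
  already raised by all letters behind it.\<close>

primrec word_coeff :: "real \<Rightarrow> 'n::{finite,linorder} list \<Rightarrow> ('n \<Rightarrow> nat) \<Rightarrow> real" where
  "word_coeff q [] m = 1"
| "word_coeff q (j # js) m = pw_coeff q j (\<lambda>i. m i + letter_count js i) * word_coeff q js m"

lemma word_op_basis:
  "word_op q (map Gen js) (l2_basis m) =
    (\<lambda>l. of_real (word_coeff q js m) * l2_basis (\<lambda>i. m i + letter_count js i) l)"
proof (induction js)
  case (Cons j js)
  have "incr j (\<lambda>i. m i + letter_count js i) = (\<lambda>i. m i + letter_count (j # js) i)"
    by (auto simp: letter_count_simps incr_def)
  then show ?case
    using word_op_linear(2)[of q "[Gen j]"] Cons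
    by (simp add: creation_def wshift_basis inj_incr mult_ac)
qed (simp add: letter_count_simps)

text \<open>The product of the square roots occurring in the weights along any path of increments
  from 0 to m; quotients of its values therefore replace products of weights.\<close>

definition qpoch_norm :: "real \<Rightarrow> ('n::finite \<Rightarrow> nat) \<Rightarrow> real" where
  "qpoch_norm q m = sqrt (\<Prod>i\<in>UNIV. qpoch (q^2) (m i))"

lemma qpoch_norm_incr:
  "qpoch_norm q (incr j m) = qpoch_norm q m * sqrt (1 - (q^2) ^ (m j + 1))"
proof -
  have "(\<Prod>i\<in>UNIV. qpoch (q^2) (incr j m i)) =
      (\<Prod>i\<in>UNIV. qpoch (q^2) (m i) * (if i = j then 1 - (q^2) ^ (m j + 1) else 1))"
    by (rule prod.cong) (auto simp: incr_other qpoch_Suc)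
  then show ?thesis by (simp add: qpoch_norm_def prod.distrib real_sqrt_mult)
qed

lemma reorder_exp_zero [simp]: "reorder_exp (\<lambda>i. 0) l = 0" "reorder_exp l (\<lambda>i. 0) = 0"
  by (simp_all add: reorder_exp_def)

lemma reorder_exp_incr_right: "reorder_exp m (incr j k) = reorder_exp m k + tail_sum j m"
proof -
  have "reorder_exp m (incr j k) = (\<Sum>l\<in>UNIV. \<Sum>i | i < l. k i * m l + (if i = j then m l else 0))"
    unfolding reorder_exp_alt by (intro sum.cong) (auto simp: incr_def algebra_simps)
  also have "\<dots> = reorder_exp m k + (\<Sum>l\<in>UNIV. if j < l then m l else 0)"
    by (simp add: sum.distrib reorder_exp_alt)
  also have "(\<Sum>l\<in>UNIV. if j < l then m l else 0) = tail_sum j m"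
    by (simp add: tail_sum_def sum.If_cases Collect_conj_eq[symmetric])
  finally show ?thesis .
qed

lemma reorder_exp_incr_left: "reorder_exp (incr j k) l = reorder_exp k l + (\<Sum>i | i < j. l i)"
proof -
  have "reorder_exp (incr j k) l = (\<Sum>m\<in>UNIV. (\<Sum>i | i < m. l i * k m) + (if m = j then \<Sum>i | i < j. l i else 0))"
    unfolding reorder_exp_alt by (intro sum.cong) (auto simp: incr_def sum.distrib[symmetric] algebra_simps)
  then show ?thesis by (simp add: sum.distrib reorder_exp_alt)
qed

text \<open>In a sorted word no letter smaller than j stands behind j. Hence raising entry j
  increases \<open>reorder_exp k k\<close> by the tail sum at j only, which is exactly the power of
  q in the weight of the new letter.\<close>

lemma word_coeff_sorted:
  assumes "sorted js"
  shows "word_coeff q js m * qpoch_norm q m = qpoch_norm q (\<lambda>i. m i + letter_count js i)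
    * q ^ (reorder_exp m (letter_count js) + reorder_exp (letter_count js) (letter_count js))"
  using assms
proof (induction js)
  case Nil
  show ?case by (simp add: letter_count_simps)
next
  case (Cons j js)
  let ?k = "letter_count js"
  have zero: "?k i = 0" if "i < j" for i
    using Cons.prems that by (auto simp: letter_count_def count_eq_zero_iff not_in_iff[symmetric])
  have e: "(\<lambda>i. m i + incr j ?k i) = incr j (\<lambda>i. m i + ?k i)" by (auto simp: incr_def)
  have t: "tail_sum j (\<lambda>i. m i + ?k i) = tail_sum j m + tail_sum j ?k"
    by (simp add: tail_sum_def sum.distrib)
  have "tail_sum j (incr j ?k) = tail_sum j ?k" by (simp add: tail_sum_incr)
  then have r: "reorder_exp (incr j ?k) (incr j ?k) = reorder_exp ?k ?k + tail_sum j ?k"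
    using zero by (simp add: reorder_exp_incr_right reorder_exp_incr_left)
  have "word_coeff q (j # js) m * qpoch_norm q m = pw_coeff q j (\<lambda>i. m i + ?k i) * (word_coeff q js m * qpoch_norm q m)"
    by simp
  also have "\<dots> = pw_coeff q j (\<lambda>i. m i + ?k i) * (qpoch_norm q (\<lambda>i. m i + ?k i) * q ^ (reorder_exp m ?k + reorder_exp ?k ?k))"
    using Cons by simp
  also have "\<dots> = qpoch_norm q (incr j (\<lambda>i. m i + ?k i)) *
      q ^ (tail_sum j (\<lambda>i. m i + ?k i) + reorder_exp m ?k + reorder_exp ?k ?k)"
    by (simp add: qpoch_norm_incr pw_coeff_def power_add)
  finally show ?case
    unfolding letter_count_simps e t r reorder_exp_incr_right[of m] by (simp add: add_ac)
qed

lemma qpoch_norm_pos: "0 < q \<Longrightarrow> q < 1 \<Longrightarrow> qpoch_norm q m > 0"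
  unfolding qpoch_norm_def by (auto intro!: prod_pos qpoch_pos simp: power_less_one_iff)

lemma qpoch_norm_zero [simp]: "qpoch_norm q (\<lambda>i. 0) = 1"
  by (simp add: qpoch_norm_def)

lemma word_coeff_multi_list:
  assumes q: "0 < q" "q < 1"
  shows "word_coeff q (multi_list k) m =
    qpoch_norm q (\<lambda>i. m i + k i) / qpoch_norm q m * q ^ (reorder_exp m k + reorder_exp k k)"
  using word_coeff_sorted[of "multi_list k" q m] qpoch_norm_pos[OF q, of m] by (simp add: field_simps)

definition ordered_monomial :: "('n::{finite,linorder} \<Rightarrow> nat) \<Rightarrow> 'n free" where
  "ordered_monomial k = gen_word (multi_list k)"

lemma free_op_monomial_basis:
  "free_op q (ordered_monomial k) (l2_basis m) =
    (\<lambda>l. of_real (word_coeff q (multi_list k) m) * l2_basis (\<lambda>i. m i + k i) l)"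
  by (simp add: ordered_monomial_def gen_word_def free_op_single word_op_basis)

lemma free_op_class_cong:
  assumes q: "0 < q" "q < 1" and f: "f \<in> l2" and "pol_class q a = pol_class q b"
  shows "free_op q a f = free_op q b f"
  using free_op_pol_class[OF q f, of a b] pol_class_self[of a q] assms(4) by simp

text \<open>
  Sorting produces some scalar; its value is read off from the action on the vacuum vector \<open>e\<^sub>0\<close>.
\<close>

lemma ordered_monomial_mult:
  assumes q: "0 < q" "q < 1"
  shows "pol_class q (ordered_monomial k * ordered_monomial l) =
    pol_class q (scal (of_real (q powi - int (reorder_exp k l))) (ordered_monomial (\<lambda>i. k i + l i)))"
proof -
  obtain c where c: "pol_class q (ordered_monomial k * ordered_monomial l) =
      pol_class q (scal c (ordered_monomial (\<lambda>i. k i + l i)))"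
    using gen_word_sort[of q "multi_list k @ multi_list l"] q
    by (auto simp: ordered_monomial_def gen_word_simps sort_eq_multi_list letter_count_simps)
  let ?n = "\<lambda>i. k i + l i"
  have "free_op q (ordered_monomial k * ordered_monomial l) (l2_basis (\<lambda>i. 0)) ?n =
     of_real (word_coeff q (multi_list l) (\<lambda>i. 0) * word_coeff q (multi_list k) l)"
    unfolding free_op_mult free_op_monomial_basis
    by (simp add: ordered_monomial_def gen_word_def free_op_single word_op_linear word_op_basis add.commute)
       (simp add: l2_basis_def)
  moreover have "free_op q (scal c (ordered_monomial ?n)) (l2_basis (\<lambda>i. 0)) ?n =
      c * of_real (word_coeff q (multi_list ?n) (\<lambda>i. 0))"
    unfolding free_op_scal free_op_monomial_basis by (simp add: l2_basis_def)
  ultimately have eq: "c * of_real (word_coeff q (multi_list ?n) (\<lambda>i. 0)) =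
      of_real (word_coeff q (multi_list l) (\<lambda>i. 0) * word_coeff q (multi_list k) l)"
    using free_op_class_cong[OF q l2_basis(1) c, of "\<lambda>i. 0"] by simp
  \<comment> \<open>The two vacuum coefficients share all factors except
    q^(\<open>reorder_exp k l\<close>), which occurs only for the ordered monomial; so c is its
    inverse.\<close>
  have eq1: "word_coeff q (multi_list ?n) (\<lambda>i. 0) = qpoch_norm q ?n *
      (q ^ reorder_exp k k * q ^ reorder_exp l l * q ^ reorder_exp k l * q ^ reorder_exp l k)"
    by (simp add: word_coeff_multi_list[OF q] reorder_exp_add power_add)
  have eq2: "word_coeff q (multi_list l) (\<lambda>i. 0) * word_coeff q (multi_list k) l = qpoch_norm q ?n *
      (q ^ reorder_exp k k * q ^ reorder_exp l l * q ^ reorder_exp l k)"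
    using qpoch_norm_pos[OF q, of l] by (simp add: word_coeff_multi_list[OF q] power_add add.commute)
  have "c * of_real (q ^ reorder_exp k l) * of_real (qpoch_norm q ?n *
      (q ^ reorder_exp k k * q ^ reorder_exp l l * q ^ reorder_exp l k)) =
     1 * of_real (qpoch_norm q ?n * (q ^ reorder_exp k k * q ^ reorder_exp l l * q ^ reorder_exp l k))"
    using eq unfolding eq1 eq2 by (simp add: mult_ac)
  then have "c * of_real (q ^ reorder_exp k l) = 1"
    using q qpoch_norm_pos[OF q, of ?n] by (subst (asm) mult_cancel_right) auto
  then have "c = of_real (q powi - int (reorder_exp k l))"
    using q by (simp add: power_int_minus field_simps)
  then show ?thesis using c by simp
qed

section \<open>Ordered polynomials and their products\<close>

definition finsupp :: "('k \<Rightarrow> complex) \<Rightarrow> bool" where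
  "finsupp c \<longleftrightarrow> finite {k. c k \<noteq> 0}"

definition ordered_poly :: "(('n::{finite,linorder} \<Rightarrow> nat) \<Rightarrow> complex) \<Rightarrow> 'n free" where
  "ordered_poly c = (\<Sum>k | c k \<noteq> 0. scal (c k) (ordered_monomial k))"

lemma ordered_poly_superset:
  assumes "finite K" "{k. c k \<noteq> 0} \<subseteq> K"
  shows "ordered_poly c = (\<Sum>k\<in>K. scal (c k) (ordered_monomial k))"
  unfolding ordered_poly_def using assms by (intro sum.mono_neutral_left) (auto simp: scal_simps)

lemma finsupp_add: "finsupp c \<Longrightarrow> finsupp d \<Longrightarrow> finsupp (c + d)"
  unfolding finsupp_def by (rule finite_subset[of _ "{k. c k \<noteq> 0} \<union> {k. d k \<noteq> 0}"]) auto

lemma finsupp_smult: "finsupp c \<Longrightarrow> finsupp (\<lambda>k. a * c k)"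
  unfolding finsupp_def by (rule finite_subset[of _ "{k. c k \<noteq> 0}"]) auto

lemma finsupp_monom: "finsupp (ball_monom k)"
  by (simp add: finsupp_def ball_monom_def)

lemma finsupp_zero: "finsupp 0"
  by (simp add: finsupp_def)

lemma ordered_poly_add:
  assumes "finsupp c" "finsupp d"
  shows "ordered_poly (c + d) = ordered_poly c + ordered_poly d"
proof -
  let ?K = "{k. c k \<noteq> 0} \<union> {k. d k \<noteq> 0}"
  have K: "finite ?K" using assms by (simp add: finsupp_def)
  show ?thesis
    using K by (subst (1 2 3) ordered_poly_superset[of ?K]) (auto simp: scal_simps sum.distrib)
qed

lemma ordered_poly_smult: "finsupp c \<Longrightarrow> ordered_poly (\<lambda>k. a * c k) = scal a (ordered_poly c)"
  by (subst ordered_poly_superset[of "{k. c k \<noteq> 0}"])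
    (auto simp: finsupp_def ordered_poly_def scal_sum scal_simps)

lemma ordered_poly_monom: "ordered_poly (ball_monom k) = ordered_monomial k"
  by (subst ordered_poly_superset[of "{k}"]) (auto simp: ball_monom_def scal_simps split: if_splits)

lemma ball_mult_support:
  "{m. ball_mult q c d m \<noteq> 0} \<subseteq> (\<lambda>p i. fst p i + snd p i) ` ({k. c k \<noteq> 0} \<times> {l. d l \<noteq> 0})"
proof
  fix m assume "m \<in> {m. ball_mult q c d m \<noteq> 0}"
  then obtain p where "(\<lambda>i. fst p i + snd p i) = m" "c (fst p) * d (snd p) \<noteq> 0"
    unfolding ball_mult_alt mem_Collect_eq by (metis (mono_tags, lifting) mem_Collect_eq mult_zero_left sum.neutral)
  then show "m \<in> (\<lambda>p i. fst p i + snd p i) ` ({k. c k \<noteq> 0} \<times> {l. d l \<noteq> 0})"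
    by (auto intro!: image_eqI[of _ _ p] simp: mem_Times_iff)
qed

lemma finsupp_ball_mult: "finsupp c \<Longrightarrow> finsupp d \<Longrightarrow> finsupp (ball_mult q c d)"
  unfolding finsupp_def using ball_mult_support by (rule finite_subset) auto

text \<open>Expanding gives a sum over pairs (k, l), which is regrouped by k + l; pairs outside the
  supports contribute nothing to \<open>ball_mult\<close>.\<close>

lemma ordered_poly_mult:
  assumes q: "0 < q" "q < 1" and c: "finsupp c" and d: "finsupp d"
  shows "pol_class q (ordered_poly c * ordered_poly d) = pol_class q (ordered_poly (ball_mult q c d))"
proof -
  let ?S = "{k. c k \<noteq> 0} \<times> {l. d l \<noteq> 0}" and ?g = "\<lambda>p i. fst p i + snd p i :: nat"
  let ?s = "\<lambda>p. c (fst p) * d (snd p) * of_real (q powi - int (reorder_exp (fst p) (snd p)))"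
  have S: "finite ?S" using c d by (simp add: finsupp_def)
  have "pol_class q (ordered_poly c * ordered_poly d) =
     pol_class q (\<Sum>p\<in>?S. scal (c (fst p) * d (snd p)) (ordered_monomial (fst p) * ordered_monomial (snd p)))"
    unfolding ordered_poly_def sum_product
    by (simp add: sum.cartesian_product case_prod_unfold scal_simps scal_central mult.commute[of "c _"])
  also have "\<dots> = pol_class q (\<Sum>p\<in>?S. scal (?s p) (ordered_monomial (?g p)))"
    by (rule pol_class_sum_cong)
      (use pol_class_scal_cong[OF ordered_monomial_mult[OF q]] in \<open>simp add: scal_simps\<close>)
  also have "(\<Sum>p\<in>?S. scal (?s p) (ordered_monomial (?g p))) =
      (\<Sum>m\<in>?g ` ?S. \<Sum>p\<in>{p \<in> ?S. ?g p = m}. scal (?s p) (ordered_monomial (?g p)))"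
    by (rule sum.group[symmetric]) (use S in auto)
  also have "\<dots> = (\<Sum>m\<in>?g ` ?S. scal (ball_mult q c d m) (ordered_monomial m))"
  proof (rule sum.cong[OF refl])
    fix m
    have "ball_mult q c d m = (\<Sum>p\<in>{p \<in> ?S. ?g p = m}. ?s p)"
      unfolding ball_mult_alt by (rule sum.mono_neutral_right) (auto simp: finite_splitting_pairs)
    then show "(\<Sum>p\<in>{p \<in> ?S. ?g p = m}. scal (?s p) (ordered_monomial (?g p))) =
        scal (ball_mult q c d m) (ordered_monomial m)"
      by (simp add: scal_sum_left)
  qed
  also have "\<dots> = ordered_poly (ball_mult q c d)"
    by (intro ordered_poly_superset[symmetric] finite_imageI S ball_mult_support)
  finally show ?thesis .
qed

section \<open>Coefficients as coordinates on the regular functions\<close>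

definition oreg_elem :: "real \<Rightarrow> (('n::{finite,linorder} \<Rightarrow> nat) \<Rightarrow> complex) \<Rightarrow> 'n free set" where
  "oreg_elem q c = pol_class q (ordered_poly c)"

lemma inj_oreg_elem:
  fixes q :: real
  assumes q: "0 < q" "q < 1"
  shows "inj_on (oreg_elem q :: (('n::{finite,linorder} \<Rightarrow> nat) \<Rightarrow> complex) \<Rightarrow> _) {c. finsupp c}"
proof -
  \<comment> \<open>Since x^k sends the vacuum vector to a multiple of e_k, coordinate m sees only
    the term k = m, and its factor is nonzero.\<close>
  have ev: "free_op q (ordered_poly c) (l2_basis (\<lambda>i. 0)) m = c m * of_real (qpoch_norm q m * q ^ reorder_exp m m)"
    if "finsupp c" for c and m :: "'n \<Rightarrow> nat"
  proof -
    have "finite {k. c k \<noteq> 0}" using that by (simp add: finsupp_def)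
    then have "free_op q (ordered_poly c) (l2_basis (\<lambda>i. 0)) m =
        (\<Sum>k | c k \<noteq> 0. if k = m then c k * of_real (word_coeff q (multi_list k) (\<lambda>i. 0)) else 0)"
      unfolding ordered_poly_def free_op_sum[OF \<open>finite _\<close>] free_op_scal free_op_monomial_basis
      by (intro sum.cong) (auto simp: l2_basis_def)
    also have "\<dots> = c m * of_real (word_coeff q (multi_list m) (\<lambda>i. 0))"
      using \<open>finite _\<close> by (simp add: sum.delta)
    finally show ?thesis by (simp add: word_coeff_multi_list[OF q])
  qed
  show ?thesis
  proof (rule inj_onI, simp)
    fix c d :: "('n \<Rightarrow> nat) \<Rightarrow> complex" assume fs: "finsupp c" "finsupp d" and eq: "oreg_elem q c = oreg_elem q d"
    show "c = d"
    proof
      fix m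
      have "free_op q (ordered_poly c) (l2_basis (\<lambda>i. 0)) m = free_op q (ordered_poly d) (l2_basis (\<lambda>i. 0)) m"
        using free_op_class_cong[OF q l2_basis(1) eq[unfolded oreg_elem_def]] by simp
      then show "c m = d m" using ev fs q qpoch_norm_pos[OF q, of m] by simp
    qed
  qed
qed

lemma oreg_ops [simp]:
  "mult (oreg q) = mult (pol q)" "one (oreg q) = one (pol q)" "add (oreg q) = add (pol q)"
  "zero (oreg q) = zero (pol q)" "smult (oreg q) = smult (pol q)"
  "carrier (oreg q) = subalg_generated (pol q) (range (px q))"
  by (simp_all add: oreg_def)

lemma multi_list_zero: "multi_list (\<lambda>i. 0) = []"
  using length_multi_list[of "\<lambda>i. 0"] by simp

lemma multi_list_single: "multi_list (incr j (\<lambda>i. 0)) = [j]"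
  using sort_eq_multi_list[of "[j]"] by (simp add: letter_count_simps)

lemma oreg_elem_simps:
  assumes q: "0 < q" "q < 1"
  shows "finsupp c \<Longrightarrow> finsupp d \<Longrightarrow> oreg_elem q c \<oplus>\<^bsub>pol q\<^esub> oreg_elem q d = oreg_elem q (c + d)"
    "finsupp c \<Longrightarrow> finsupp d \<Longrightarrow> oreg_elem q c \<otimes>\<^bsub>pol q\<^esub> oreg_elem q d = oreg_elem q (ball_mult q c d)"
    "finsupp c \<Longrightarrow> a \<odot>\<^bsub>pol q\<^esub> oreg_elem q c = oreg_elem q (\<lambda>k. a * c k)"
  using assms by (simp_all add: oreg_elem_def pol_simps ordered_poly_add ordered_poly_smult ordered_poly_mult)

lemma oreg_elem_constants:
  "\<one>\<^bsub>pol q\<^esub> = oreg_elem q (ball_monom (\<lambda>i. 0 :: nat))" "\<zero>\<^bsub>pol q\<^esub> = oreg_elem q 0"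
  "px q j = oreg_elem q (ball_monom (incr j (\<lambda>i. 0)))"
  by (simp_all add: oreg_elem_def pol_simps ordered_poly_monom ordered_monomial_def multi_list_zero
      multi_list_single gen_word_simps px_def) (simp_all add: ordered_poly_def)

lemma gen_word_in_oreg: "pol_class q (gen_word js) \<in> carrier (oreg q)"
proof (induction js)
  case Nil
  show ?case using subalg_generated.one[of "pol q" "range (px q)"] by (simp add: gen_word_simps pol_simps)
next
  case (Cons j js)
  have "px q j \<otimes>\<^bsub>pol q\<^esub> pol_class q (gen_word js) \<in> subalg_generated (pol q) (range (px q))"
    using Cons by (auto intro: subalg_generated.intros)
  then show ?case by (simp add: gen_word_simps px_def pol_simps)
qed

lemma oreg_elem_sum_in_oreg:
  assumes "finite K"
  shows "pol_class q (\<Sum>k\<in>K. scal (c k) (ordered_monomial k)) \<in> carrier (oreg q)"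
  using assms
proof (induction K)
  case empty
  have "0 \<odot>\<^bsub>pol q\<^esub> \<one>\<^bsub>pol q\<^esub> \<in> carrier (oreg q)" by (auto intro: subalg_generated.intros)
  then show ?case by (simp add: pol_simps scal_simps)
next
  case (insert k K)
  have "c k \<odot>\<^bsub>pol q\<^esub> pol_class q (ordered_monomial k) \<oplus>\<^bsub>pol q\<^esub>
      pol_class q (\<Sum>k\<in>K. scal (c k) (ordered_monomial k)) \<in> carrier (oreg q)"
    using insert gen_word_in_oreg[of q "multi_list k"]
    by (auto intro!: subalg_generated.add subalg_generated.smult simp: ordered_monomial_def)
  then show ?case using insert by (simp add: pol_simps)
qed

text \<open>The classes of ordered polynomials contain the unit and the generators and are closed
  under the operations; conversely every ordered monomial is a product of generators.\<close>

lemma carrier_oreg: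
  fixes q :: real
  assumes q: "0 < q" "q < 1"
  shows "carrier (oreg q :: (complex, 'n::{finite,linorder} free set) module) = oreg_elem q ` {c. finsupp c}"
proof
  show "oreg_elem q ` {c. finsupp c} \<subseteq> carrier (oreg q :: (complex, 'n free set) module)"
    using oreg_elem_sum_in_oreg by (auto simp: oreg_elem_def ordered_poly_def finsupp_def simp del: oreg_ops)
  show "carrier (oreg q :: (complex, 'n free set) module) \<subseteq> oreg_elem q ` {c. finsupp c}"
  proof
    fix A :: "'n free set" assume "A \<in> carrier (oreg q)"
    then have "A \<in> subalg_generated (pol q) (range (px q))" by simp
    then show "A \<in> oreg_elem q ` {c. finsupp c}"
    proof induction
      case one
      show ?case by (auto simp: oreg_elem_constants(1) finsupp_monom intro!: imageI)
    next
      case (incl A)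
      then show ?case by (auto simp: oreg_elem_constants(3) finsupp_monom intro!: imageI)
    next
      case (add A B)
      then show ?case by (auto simp: oreg_elem_simps[OF q] finsupp_add intro!: imageI)
    next
      case (mult A B)
      then show ?case by (auto simp: oreg_elem_simps[OF q] finsupp_ball_mult intro!: imageI)
    next
      case (smult A c)
      then show ?case by (auto simp: oreg_elem_simps[OF q] finsupp_smult intro!: imageI)
    qed
  qed
qed

section \<open>Comparison of the norms\<close>

definition rescale :: "real \<Rightarrow> (('n::finite \<Rightarrow> nat) \<Rightarrow> complex) \<Rightarrow> ('n \<Rightarrow> nat) \<Rightarrow> complex" where
  "rescale \<rho> c = (\<lambda>k. of_real (\<rho> ^ total k) * c k)"

lemma finsupp_rescale: "finsupp c \<Longrightarrow> finsupp (rescale \<rho> c)"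
  unfolding finsupp_def rescale_def by (rule finite_subset[of _ "{k. c k \<noteq> 0}"]) auto

lemma finsupp_uminus: "finsupp c \<Longrightarrow> finsupp (- c)"
  by (simp add: finsupp_def)

lemma finsupp_diff: "finsupp c \<Longrightarrow> finsupp d \<Longrightarrow> finsupp (c - d)"
  using finsupp_add[of c "- d"] finsupp_uminus[of d] by simp

lemma rescale_simps:
  "rescale \<rho> (c + d) = rescale \<rho> c + rescale \<rho> d"
  "rescale \<rho> (\<lambda>k. a * c k) = (\<lambda>k. a * rescale \<rho> c k)"
  "rescale \<rho> (ball_mult q c d) = ball_mult q (rescale \<rho> c) (rescale \<rho> d)"
  "rescale \<rho> (ball_monom (\<lambda>i. 0)) = ball_monom (\<lambda>i. 0)"
  "rescale \<rho> (ball_monom (incr j (\<lambda>i. 0))) = (\<lambda>k. of_real \<rho> * ball_monom (incr j (\<lambda>i. 0)) k)"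
  "\<rho> \<noteq> 0 \<Longrightarrow> rescale \<rho> (rescale (inverse \<rho>) c) = c"
proof -
  show "rescale \<rho> (ball_mult q c d) = ball_mult q (rescale \<rho> c) (rescale \<rho> d)"
    unfolding rescale_def ball_mult_alt sum_distrib_left
    by (intro ext sum.cong) (auto simp: power_add sum.distrib mult_ac)
  have "total (incr j (\<lambda>i. 0)) = (\<Sum>i\<in>UNIV. if i = j then 1 else 0)"
    unfolding incr_def by (rule sum.cong) auto
  then have "total (incr j (\<lambda>i. 0)) = 1" by simp
  then show "rescale \<rho> (ball_monom (incr j (\<lambda>i. 0))) = (\<lambda>k. of_real \<rho> * ball_monom (incr j (\<lambda>i. 0)) k)"
    by (auto simp: rescale_def ball_monom_def fun_eq_iff)
qed (auto simp: rescale_def ball_monom_def fun_eq_iff algebra_simps power_mult_distrib[symmetric] simp flip: of_real_mult)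

definition coeffs_of :: "real \<Rightarrow> 'n::{finite,linorder} free set \<Rightarrow> ('n \<Rightarrow> nat) \<Rightarrow> complex" where
  "coeffs_of q = the_inv_into {c. finsupp c} (oreg_elem q)"

lemma coeffs_of_elem: "0 < q \<Longrightarrow> q < 1 \<Longrightarrow> finsupp c \<Longrightarrow> coeffs_of q (oreg_elem q c) = c"
  unfolding coeffs_of_def by (rule the_inv_into_f_f[OF inj_oreg_elem]) auto

text \<open>Rescaling respects products because the total degree is additive; the inverse map
  rescales by 1/\<rho>.\<close>

lemma gamma_exists:
  fixes q \<rho> :: real
  assumes q: "0 < q" "q < 1" and \<rho>: "\<rho> > 0"
  shows "\<exists>g. g \<in> alg_hom (oreg q) (oreg q :: (complex, 'n::{finite,linorder} free set) module) \<and>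
    bij_betw g (carrier (oreg q)) (carrier (oreg q)) \<and>
    (\<forall>i. g (px q i) = of_real \<rho> \<odot>\<^bsub>oreg q\<^esub> px q i)"
proof (intro exI conjI allI)
  let ?g = "\<lambda>s A. oreg_elem q (rescale s (coeffs_of q (A :: 'n free set)))"
  note simps = coeffs_of_elem[OF q] oreg_elem_simps[OF q] finsupp_rescale rescale_simps
    finsupp_add finsupp_smult finsupp_ball_mult finsupp_monom oreg_elem_constants
  show "?g \<rho> \<in> alg_hom (oreg q) (oreg q)"
    unfolding alg_hom_def ring_hom_def carrier_oreg[OF q] by (auto simp: simps)
  have inv: "?g s (?g (inverse s) A) = A" if "s > 0" "A \<in> carrier (oreg q)" for s A
    using that unfolding carrier_oreg[OF q] by (auto simp: simps)
  have mem: "?g s A \<in> carrier (oreg q)" if "A \<in> carrier (oreg q)" for s A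
    using that unfolding carrier_oreg[OF q] by (auto simp: simps)
  show "bij_betw (?g \<rho>) (carrier (oreg q)) (carrier (oreg q))"
    by (rule bij_betw_byWitness[of _ "?g (inverse \<rho>)"])
      (use inv[of \<rho>] inv[of "inverse \<rho>"] \<rho> mem in \<open>simp_all add: image_subset_iff del: oreg_ops\<close>)
  show "?g \<rho> (px q i) = of_real \<rho> \<odot>\<^bsub>oreg q\<^esub> px q i" for i
    by (simp add: simps)
qed

text \<open>A homomorphism is determined by its values on generators, so whatever map the choice in
  \<open>gamma\<close> returns acts on coefficients by rescaling.\<close>

lemma alg_hom_oreg_eq:
  fixes g :: "'n::{finite,linorder} free set \<Rightarrow> 'n free set"
  assumes g: "g \<in> alg_hom (oreg q) (oreg q)" and gx: "\<And>i. g (px q i) = of_real \<rho> \<odot>\<^bsub>oreg q\<^esub> px q i"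
    and c: "finsupp c"
  shows "g (oreg_elem q c) = oreg_elem q (rescale \<rho> c)"
proof -
  let ?O = "carrier (oreg q) :: 'n free set set"
  have add: "g (A \<oplus>\<^bsub>pol q\<^esub> B) = g A \<oplus>\<^bsub>pol q\<^esub> g B"
    and mult: "g (A \<otimes>\<^bsub>pol q\<^esub> B) = g A \<otimes>\<^bsub>pol q\<^esub> g B"
    if "A \<in> ?O" "B \<in> ?O" for A B
    using g that by (auto simp: alg_hom_def ring_hom_def)
  have smult: "g (a \<odot>\<^bsub>pol q\<^esub> A) = a \<odot>\<^bsub>pol q\<^esub> g A" if "A \<in> ?O" for A a
    using g that by (auto simp: alg_hom_def)
  have one: "g (pol_class q 1) = pol_class q 1"
    using g by (auto simp: alg_hom_def ring_hom_def pol_simps)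
  have word: "g (pol_class q (gen_word js)) = pol_class q (scal (of_real (\<rho> ^ length js)) (gen_word js))" for js
  proof (induction js)
    case (Cons j js)
    have "g (px q j \<otimes>\<^bsub>pol q\<^esub> pol_class q (gen_word js)) = g (px q j) \<otimes>\<^bsub>pol q\<^esub> g (pol_class q (gen_word js))"
      using gen_word_in_oreg[of q "[j]"] gen_word_in_oreg[of q js]
      by (intro mult) (simp_all add: px_def gen_word_simps)
    also have "\<dots> = pol_class q (scal (of_real (\<rho> ^ length (j # js))) (gen_word (j # js)))"
      using gx[of j] unfolding Cons by (simp add: px_def pol_simps scal_simps scal_central gen_word_simps mult_ac)
    finally show ?case by (simp add: px_def pol_simps gen_word_simps)
  qed (simp add: gen_word_simps one scal_simps)
  have "g (pol_class q (\<Sum>k\<in>K. scal (c k) (ordered_monomial k))) =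
      pol_class q (\<Sum>k\<in>K. scal (rescale \<rho> c k) (ordered_monomial k))" if "finite K" for K
    using that
  proof (induction K)
    case empty
    have "g (0 \<odot>\<^bsub>pol q\<^esub> pol_class q (gen_word [])) = 0 \<odot>\<^bsub>pol q\<^esub> g (pol_class q (gen_word []))"
      by (intro smult gen_word_in_oreg)
    then show ?case unfolding word by (simp add: pol_simps scal_simps)
  next
    case (insert k K)
    let ?s = "pol_class q (\<Sum>k\<in>K. scal (c k) (ordered_monomial k))"
    have m: "pol_class q (ordered_monomial k) \<in> ?O"
      unfolding ordered_monomial_def by (rule gen_word_in_oreg)
    have "g (c k \<odot>\<^bsub>pol q\<^esub> pol_class q (ordered_monomial k) \<oplus>\<^bsub>pol q\<^esub> ?s) =
      c k \<odot>\<^bsub>pol q\<^esub> g (pol_class q (ordered_monomial k)) \<oplus>\<^bsub>pol q\<^esub> g ?s"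
      using m oreg_elem_sum_in_oreg[OF insert(1), of q c] smult[OF m, of "c k"]
      by (subst add) (auto intro: subalg_generated.smult)
    then show ?case
      using insert word[of "multi_list k"]
      by (simp add: pol_simps ordered_monomial_def scal_simps length_multi_list rescale_def mult_ac)
  qed
  then have "g (oreg_elem q c) = pol_class q (\<Sum>k | c k \<noteq> 0. scal (rescale \<rho> c k) (ordered_monomial k))"
    using c by (simp add: oreg_elem_def ordered_poly_def finsupp_def)
  also have "(\<Sum>k | c k \<noteq> 0. scal (rescale \<rho> c k) (ordered_monomial k)) = ordered_poly (rescale \<rho> c)"
    using c by (intro ordered_poly_superset[symmetric]) (auto simp: finsupp_def rescale_def)
  finally show ?thesis by (simp add: oreg_elem_def)
qed

lemma gamma_elem:
  assumes q: "0 < q" "q < 1" and \<rho>: "\<rho> > 0" and c: "finsupp c"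
  shows "gamma q \<rho> (oreg_elem q c) = oreg_elem q (rescale \<rho> c)"
  using someI_ex[OF gamma_exists[OF q \<rho>]] unfolding gamma_def by (intro alg_hom_oreg_eq[OF _ _ c]) auto

section \<open>The chosen representation on regular functions\<close>

lemma pw_rep_simps:
  fixes a b :: "'n::{finite,linorder} free"
  assumes q: "0 < q" "q < 1"
  shows "l2_bounded_op (pw_rep q (pol_class q a))"
    "f \<in> l2 \<Longrightarrow> pw_rep q (pol_class q (1 :: 'n free)) f = f"
    "f \<in> l2 \<Longrightarrow> pw_rep q (pol_class q (a + b)) f = (\<lambda>k. pw_rep q (pol_class q a) f k + pw_rep q (pol_class q b) f k)"
    "f \<in> l2 \<Longrightarrow> pw_rep q (pol_class q (a * b)) f = pw_rep q (pol_class q a) (pw_rep q (pol_class q b) f)"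
    "f \<in> l2 \<Longrightarrow> pw_rep q (pol_class q (scal c a)) f = (\<lambda>k. c * pw_rep q (pol_class q a) f k)"
    "pw_rep q (pol_class q (fX j :: 'n free)) (l2_basis k) = (\<lambda>m. of_real (pw_coeff q j k) * l2_basis (incr j k) m)"
proof -
  have rep: "l2_star_rep (pol q :: (complex, 'n free set) module) pol_star (pw_rep q)"
    and x: "pw_rep q (px q j) (l2_basis k) = (\<lambda>m. of_real (sqrt (1 - q^2) * sqrt (qint (q^2) (k j + 1)) * q ^ (\<Sum>i | i > j. k i))
            * l2_basis (k(j := k j + 1)) m)"
    using is_pw_rep_pw_rep[OF q, where 'a = 'n] by (auto simp: is_pw_rep_def)
  have carr: "pol_class q a \<in> carrier (pol q)" for a :: "'n free" by (simp add: pol_simps)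
  show "l2_bounded_op (pw_rep q (pol_class q a))"
    using rep carr[of a] by (simp add: l2_star_rep_def)
  show "pw_rep q (pol_class q (1 :: 'n free)) f = f" if "f \<in> l2"
    using rep that by (simp add: l2_star_rep_def pol_simps)
  show "pw_rep q (pol_class q (a + b)) f = (\<lambda>k. pw_rep q (pol_class q a) f k + pw_rep q (pol_class q b) f k)"
    "pw_rep q (pol_class q (a * b)) f = pw_rep q (pol_class q a) (pw_rep q (pol_class q b) f)"
    "pw_rep q (pol_class q (scal c a)) f = (\<lambda>k. c * pw_rep q (pol_class q a) f k)" if "f \<in> l2"
    using rep that carr[of a] carr[of b]
    unfolding pol_simps(4-6)[symmetric] l2_star_rep_def by blast+
  show "pw_rep q (pol_class q (fX j :: 'n free)) (l2_basis k) = (\<lambda>m. of_real (pw_coeff q j k) * l2_basis (incr j k) m)"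
    using x unfolding creation_coefficient[OF q] px_def incr_def .
qed

lemma pw_rep_word:
  assumes q: "0 < q" "q < 1"
  shows "pw_rep q (pol_class q (gen_word js)) (l2_basis m) =
    (\<lambda>l. of_real (word_coeff q js m) * l2_basis (\<lambda>i. m i + letter_count js i) l)"
proof (induction js)
  case Nil
  show ?case by (simp add: gen_word_simps pw_rep_simps[OF q] l2_basis letter_count_simps)
next
  case (Cons j js)
  obtain B where B: "op_bounded_by (pw_rep q (pol_class q (fX j))) B"
    using pw_rep_simps(1)[OF q, of "fX j"] by (auto simp: l2_bounded_op_iff)
  have "incr j (\<lambda>i. m i + letter_count js i) = (\<lambda>i. m i + letter_count (j # js) i)"
    by (auto simp: letter_count_simps incr_def)
  then show ?case
    by (simp add: gen_word_simps pw_rep_simps[OF q] l2_basis Cons op_bounded_byD(5)[OF B] mult_ac)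
qed

lemma pw_rep_sum:
  assumes q: "0 < q" "q < 1" and f: "f \<in> l2" and K: "finite K"
  shows "pw_rep q (pol_class q (\<Sum>k\<in>K. scal (c k) (a k))) f = (\<lambda>l. \<Sum>k\<in>K. c k * pw_rep q (pol_class q (a k)) f l)"
  using K
proof (induction K)
  case empty
  have "pw_rep q (pol_class q (scal 0 1)) f = (\<lambda>l. 0)" unfolding pw_rep_simps(5)[OF q f] by simp
  then show ?case by (simp add: scal_simps)
qed (simp add: pw_rep_simps(3,5)[OF q f])

definition monomial_op :: "real \<Rightarrow> ('n::{finite,linorder} \<Rightarrow> nat) \<Rightarrow> ('n \<Rightarrow> nat) l2_op" where
  "monomial_op q k = wshift (\<lambda>m i. m i + k i) (word_coeff q (multi_list k))"

definition poly_op :: "real \<Rightarrow> (('n::{finite,linorder} \<Rightarrow> nat) \<Rightarrow> complex) \<Rightarrow> ('n \<Rightarrow> nat) l2_op" where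
  "poly_op q c f = (\<lambda>l. \<Sum>k | c k \<noteq> 0. c k * monomial_op q k f l)"

lemma inj_shift: "inj (\<lambda>m i. m i + k i :: nat)"
  by (rule injI) (simp add: fun_eq_iff)

lemma qpoch_norm_mono:
  assumes q: "0 < q" "q < 1" shows "qpoch_norm q (\<lambda>i. m i + k i) \<le> qpoch_norm q m"
proof -
  have t: "0 < q^2" "q^2 < 1" using q by (auto simp: power_less_one_iff)
  show ?thesis unfolding qpoch_norm_def
    by (intro real_sqrt_le_mono prod_mono) (auto intro: qpoch_mono[OF t] less_imp_le[OF qpoch_pos[OF t]])
qed

text \<open>Adding k to m can only decrease the Pochhammer factors, and the mixed power of q is at
  most 1; what remains is the power belonging to k alone.\<close>

lemma word_coeff_bound:
  assumes q: "0 < q" "q < 1"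
  shows "\<bar>word_coeff q (multi_list k) m\<bar> \<le> q ^ reorder_exp k k"
proof -
  have "qpoch_norm q (\<lambda>i. m i + k i) / qpoch_norm q m \<le> 1"
    using qpoch_norm_mono[OF q] qpoch_norm_pos[OF q, of m] by simp
  moreover have "q ^ reorder_exp m k \<le> 1" using q by (simp add: power_le_one)
  ultimately have "qpoch_norm q (\<lambda>i. m i + k i) / qpoch_norm q m * q ^ reorder_exp m k \<le> 1"
    using q by (intro mult_le_one) auto
  from mult_right_mono[OF this, of "q ^ reorder_exp k k"] show ?thesis
    using q qpoch_norm_pos[OF q, of m] qpoch_norm_pos[OF q, of "\<lambda>i. m i + k i"]
    by (simp add: word_coeff_multi_list[OF q] power_add mult.assoc abs_mult abs_of_pos)
qed

lemma poly_op_bound: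
  assumes q: "0 < q" "q < 1" and c: "finsupp c"
  shows "op_bounded_by (poly_op q c) (\<Sum>k | c k \<noteq> 0. cmod (c k) * q ^ reorder_exp k k)"
  unfolding poly_op_def[abs_def] monomial_op_def using c
  by (intro op_bounded_by_sum op_bounded_by_smult op_bounded_by_wshift inj_shift word_coeff_bound[OF q])
    (simp add: finsupp_def)

text \<open>The representation is specified on basis vectors; boundedness of both sides extends the
  formula as a sum of weighted shifts to all of \<open>l2\<close>.\<close>

lemma pw_rep_elem:
  assumes q: "0 < q" "q < 1" and c: "finsupp c" and f: "f \<in> l2"
  shows "pw_rep q (oreg_elem q c) f = poly_op q c f"
proof -
  obtain B where B: "op_bounded_by (pw_rep q (oreg_elem q c)) B"
    using pw_rep_simps(1)[OF q] by (auto simp: l2_bounded_op_iff oreg_elem_def)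
  have "finite {k. c k \<noteq> 0}" using c by (simp add: finsupp_def)
  then have "pw_rep q (oreg_elem q c) (l2_basis m) = poly_op q c (l2_basis m)" for m
    unfolding oreg_elem_def ordered_poly_def poly_op_def
    by (simp add: pw_rep_sum[OF q l2_basis(1)] ordered_monomial_def pw_rep_word[OF q]
        monomial_op_def wshift_basis inj_shift)
  from op_eq_on_basis[OF B poly_op_bound[OF q c] this f] show ?thesis .
qed

lemma norm_inf_elem:
  assumes q: "0 < q" "q < 1" and \<rho>: "\<rho> > 0" and c: "finsupp c"
  shows "norm_inf q \<rho> (oreg_elem q c) = l2_opnorm (poly_op q (rescale \<rho> c))"
  unfolding norm_inf_def op_norm_def gamma_elem[OF q \<rho> c]
  by (rule l2_opnorm_cong) (rule pw_rep_elem[OF q finsupp_rescale[OF c]])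

lemma norm_inf_add:
  assumes q: "0 < q" "q < 1" and \<rho>: "\<rho> > 0" and c: "finsupp c" and d: "finsupp d"
  shows "norm_inf q \<rho> (oreg_elem q (c + d)) \<le> norm_inf q \<rho> (oreg_elem q c) + norm_inf q \<rho> (oreg_elem q d)"
proof -
  let ?p = "\<lambda>c. pw_rep q (oreg_elem q (rescale \<rho> c))"
  have "norm_inf q \<rho> (oreg_elem q (c + d)) = l2_opnorm (\<lambda>f k. ?p c f k + ?p d f k)"
    unfolding norm_inf_def op_norm_def gamma_elem[OF q \<rho> finsupp_add[OF c d]]
    using c d q by (intro l2_opnorm_cong)
      (simp add: rescale_simps oreg_elem_def ordered_poly_add finsupp_rescale pw_rep_simps)
  also have "\<dots> \<le> l2_opnorm (?p c) + l2_opnorm (?p d)"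
    by (intro l2_opnorm_add) (simp_all add: oreg_elem_def pw_rep_simps[OF q])
  finally show ?thesis by (simp add: norm_inf_def op_norm_def gamma_elem[OF q \<rho>] c d)
qed

lemma norm_inf_uminus:
  assumes q: "0 < q" "q < 1" and \<rho>: "\<rho> > 0" and c: "finsupp c"
  shows "norm_inf q \<rho> (oreg_elem q (- c)) = norm_inf q \<rho> (oreg_elem q c)"
proof -
  have c': "finsupp (- c)" using c by (rule finsupp_uminus)
  have "poly_op q (rescale \<rho> (- c)) = (\<lambda>f k. - poly_op q (rescale \<rho> c) f k)"
    by (simp add: poly_op_def fun_eq_iff rescale_def sum_negf)
  then show ?thesis by (simp add: norm_inf_elem[OF q \<rho>] c c' l2_opnorm_uminus)
qed

lemma norm_inf_diff:
  assumes q: "0 < q" "q < 1" and \<rho>: "\<rho> > 0" and c: "finsupp c" and d: "finsupp d"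
  shows "\<bar>norm_inf q \<rho> (oreg_elem q c) - norm_inf q \<rho> (oreg_elem q d)\<bar> \<le> norm_inf q \<rho> (oreg_elem q (c - d))"
proof -
  have cd: "finsupp (c - d)" using c d by (rule finsupp_diff)
  then have "finsupp (- (c - d))" by (rule finsupp_uminus)
  from norm_inf_add[OF q \<rho> this c] norm_inf_add[OF q \<rho> cd d] norm_inf_uminus[OF q \<rho> cd]
  show ?thesis by simp
qed

section \<open>Domination of the norms in both directions\<close>

definition ball_wt :: "real \<Rightarrow> real \<Rightarrow> ('n::{finite,linorder} \<Rightarrow> nat) \<Rightarrow> real" where
  "ball_wt q \<rho> k = ball_weight q k * \<rho> ^ total k"

lemma ball_norm_weighted: "ball_norm q \<rho> c = weighted_norm (ball_wt q \<rho>) c"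
  by (simp add: ball_norm_def weighted_norm_def ball_wt_def mult.assoc)

lemma ball_wt_pos: "0 < q \<Longrightarrow> q < 1 \<Longrightarrow> \<rho> > 0 \<Longrightarrow> ball_wt q \<rho> k > 0"
  by (simp add: ball_wt_def ball_weight_pos)

text \<open>The triangle inequality over the monomials costs no radius in this direction.\<close>

lemma norm_inf_le:
  assumes q: "0 < q" "q < 1" and \<rho>: "\<rho> > 0"
  obtains C where "C > 0" "\<And>c :: ('n::{finite,linorder} \<Rightarrow> nat) \<Rightarrow> complex. finsupp c \<Longrightarrow>
    norm_inf q \<rho> (oreg_elem q c) \<le> C * weighted_norm (ball_wt q \<rho>) c"
proof -
  obtain b where b: "b > 0" "\<And>k::'n \<Rightarrow> nat. b * q ^ reorder_exp k k \<le> ball_weight q k"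
    using ball_weight_bounds[OF q, where 'n = 'n] by metis
  show thesis
  proof
    fix c :: "('n \<Rightarrow> nat) \<Rightarrow> complex" assume c: "finsupp c"
    let ?K = "{k. rescale \<rho> c k \<noteq> 0}"
    have K: "finite ?K" using finsupp_rescale[OF c] by (simp add: finsupp_def)
    have "norm_inf q \<rho> (oreg_elem q c) \<le> (\<Sum>k\<in>?K. cmod (rescale \<rho> c k) * q ^ reorder_exp k k)"
      unfolding norm_inf_elem[OF q \<rho> c] by (intro l2_opnorm_le poly_op_bound q finsupp_rescale c)
    also have "\<dots> \<le> (\<Sum>k\<in>?K. inverse b * (cmod (c k) * ball_wt q \<rho> k))"
    proof (rule sum_mono)
      fix k :: "'n \<Rightarrow> nat"
      have "q ^ reorder_exp k k \<le> inverse b * ball_weight q k"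
        using b by (simp add: field_simps)
      then have "cmod (c k) * \<rho> ^ total k * q ^ reorder_exp k k \<le> cmod (c k) * \<rho> ^ total k * (inverse b * ball_weight q k)"
        using \<rho> by (intro mult_left_mono) auto
      then show "cmod (rescale \<rho> c k) * q ^ reorder_exp k k \<le> inverse b * (cmod (c k) * ball_wt q \<rho> k)"
        using \<rho> by (simp add: rescale_def norm_mult norm_power ball_wt_def mult_ac)
    qed
    also have "\<dots> \<le> inverse b * weighted_norm (ball_wt q \<rho>) c"
      unfolding sum_distrib_left[symmetric] using b K c less_imp_le[OF ball_wt_pos[OF q \<rho>]]
      by (intro mult_left_mono weighted_sum_le weighted_finite_support) (auto simp: finsupp_def)
    finally show "norm_inf q \<rho> (oreg_elem q c) \<le> inverse b * weighted_norm (ball_wt q \<rho>) c" .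
  qed (use b in simp)
qed

text \<open>Coordinate k of the image of the vacuum vector contains only the k-th coefficient and is
  at most the operator norm. The constant is the same for all radii, since \<rho> enters both sides
  through the rescaled coefficients.\<close>

lemma coeff_le_norm_inf:
  assumes q: "0 < q" "q < 1"
  obtains C where "C > 0" "\<And>\<rho> (c :: ('n::{finite,linorder} \<Rightarrow> nat) \<Rightarrow> complex) k. \<rho> > 0 \<Longrightarrow> finsupp c \<Longrightarrow>
    cmod (c k) * ball_wt q \<rho> k \<le> C * norm_inf q \<rho> (oreg_elem q c)"
proof -
  obtain b where b: "b > 0" "\<And>k::'n \<Rightarrow> nat. ball_weight q k \<le> b * q ^ reorder_exp k k"
    using ball_weight_bounds[OF q, where 'n = 'n] by metis
  have t: "0 < q^2" "q^2 < 1" using q by (auto simp: power_less_one_iff)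
  obtain P where P: "P > 0" "\<And>m. P \<le> qpoch (q^2) m" using qpoch_bounded_below[OF t] by auto
  \<comment> \<open>A lower bound for \<open>qpoch_norm\<close>, which is the square root of a
    product of n Pochhammer symbols, each at least P.\<close>
  define p where "p = sqrt (P ^ CARD('n))"
  have p: "p > 0" using P by (simp add: p_def)
  have pN: "p \<le> qpoch_norm q k" for k :: "'n \<Rightarrow> nat"
    unfolding p_def qpoch_norm_def
    using P prod_mono[of UNIV "\<lambda>_. P" "\<lambda>i. qpoch (q^2) (k i)"] by (intro real_sqrt_le_mono) auto
  show thesis
  proof
    show "b / p > 0" using b p by simp
    fix \<rho> :: real and c :: "('n \<Rightarrow> nat) \<Rightarrow> complex" and k assume \<rho>: "\<rho> > 0" and c: "finsupp c"
    let ?d = "rescale \<rho> c"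
    have fin: "finite {k. ?d k \<noteq> 0}" using finsupp_rescale[OF c] by (simp add: finsupp_def)
    have "poly_op q ?d (l2_basis (\<lambda>i. 0)) k = (\<Sum>j | ?d j \<noteq> 0. if j = k then ?d j * of_real (word_coeff q (multi_list j) (\<lambda>i. 0)) else 0)"
      unfolding poly_op_def monomial_op_def wshift_basis[OF inj_shift]
      by (intro sum.cong) (auto simp: l2_basis_def)
    also have "\<dots> = ?d k * of_real (qpoch_norm q k * q ^ reorder_exp k k)"
      using fin by (auto simp: sum.delta word_coeff_multi_list[OF q])
    finally have "cmod (?d k) * (qpoch_norm q k * q ^ reorder_exp k k) = cmod (poly_op q ?d (l2_basis (\<lambda>i. 0)) k)"
      using q qpoch_norm_pos[OF q, of k] by (simp add: norm_mult norm_power)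
    also have "\<dots> \<le> l2_norm (poly_op q ?d (l2_basis (\<lambda>i. 0)))"
      using op_bounded_byD(2)[OF poly_op_bound[OF q finsupp_rescale[OF c]] l2_basis(1)] by (rule cmod_le_l2_norm)
    also have "\<dots> \<le> norm_inf q \<rho> (oreg_elem q c)"
      unfolding norm_inf_elem[OF q \<rho> c]
      using poly_op_bound[OF q finsupp_rescale[OF c]]
      by (intro l2_norm_le_opnorm) (auto simp: l2_bounded_op_iff l2_basis)
    finally have N: "cmod (?d k) * (qpoch_norm q k * q ^ reorder_exp k k) \<le> norm_inf q \<rho> (oreg_elem q c)" .
    have "ball_weight q k \<le> b * q ^ reorder_exp k k" by (rule b)
    also have "\<dots> \<le> b / p * (qpoch_norm q k * q ^ reorder_exp k k)"
      using pN[of k] b p q by (simp add: field_simps mult_right_mono)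
    finally have "cmod (?d k) * ball_weight q k \<le> cmod (?d k) * (b / p * (qpoch_norm q k * q ^ reorder_exp k k))"
      by (intro mult_left_mono) auto
    also have "\<dots> \<le> b / p * norm_inf q \<rho> (oreg_elem q c)"
      using mult_left_mono[OF N, of "b / p"] b p by (simp add: mult_ac)
    finally show "cmod (c k) * ball_wt q \<rho> k \<le> b / p * norm_inf q \<rho> (oreg_elem q c)"
      using \<rho> by (simp add: rescale_def norm_mult norm_power ball_wt_def mult_ac)
  qed
qed

lemma geometric_sum_bound:
  fixes t :: real
  assumes t: "0 \<le> t" "t < 1" and F: "finite (F :: ('n::finite \<Rightarrow> nat) set)"
  shows "(\<Sum>k\<in>F. t ^ total k) \<le> (1 / (1 - t)) ^ CARD('n)"
proof -
  \<comment> \<open>A crude bound exceeding every entry of every index in F. On the cube of this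
    side the sum factors into n geometric sums.\<close>
  define M where "M = Suc (\<Sum>k\<in>F. total k)"
  have "k i < M" if "k \<in> F" for k i
  proof -
    have "k i \<le> total k" by (rule member_le_sum) auto
    also have "\<dots> \<le> (\<Sum>k\<in>F. total k)" using that F by (intro member_le_sum) auto
    finally show ?thesis by (simp add: M_def)
  qed
  then have "F \<subseteq> Pi\<^sub>E (UNIV :: 'n set) (\<lambda>_. {..<M})" by auto
  then have "(\<Sum>k\<in>F. t ^ total k) \<le> (\<Sum>k\<in>Pi\<^sub>E (UNIV :: 'n set) (\<lambda>_. {..<M}). t ^ total k)"
    using t by (intro sum_mono2 finite_PiE) auto
  also have "\<dots> = (\<Prod>i\<in>(UNIV :: 'n set). \<Sum>j<M. t ^ j)"
    by (subst prod_sum_PiE) (auto simp: power_sum)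
  also have "\<dots> = (\<Sum>j<M. t ^ j) ^ CARD('n)" by simp
  also have "\<dots> \<le> (1 / (1 - t)) ^ CARD('n)"
  proof (rule power_mono)
    show "(\<Sum>j<M. t ^ j) \<le> 1 / (1 - t)" using t by (subst sum_gp_strict) (auto simp: divide_right_mono)
  qed (use t in \<open>auto intro: sum_nonneg\<close>)
  finally show ?thesis .
qed

lemma ball_norm_le_norm_inf:
  assumes q: "0 < q" "q < 1" and \<rho>: "0 < \<rho>" "\<rho> < \<sigma>"
  obtains C where "C > 0" "\<And>c :: ('n::{finite,linorder} \<Rightarrow> nat) \<Rightarrow> complex. finsupp c \<Longrightarrow>
    weighted_norm (ball_wt q \<rho>) c \<le> C * norm_inf q \<sigma> (oreg_elem q c)"
proof -
  obtain C where C: "C > 0" "\<And>\<rho> (c :: ('n \<Rightarrow> nat) \<Rightarrow> complex) k. \<rho> > 0 \<Longrightarrow> finsupp c \<Longrightarrow>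
    cmod (c k) * ball_wt q \<rho> k \<le> C * norm_inf q \<rho> (oreg_elem q c)"
    using coeff_le_norm_inf[OF q] by blast
  define t where "t = \<rho> / \<sigma>"
  have t: "0 \<le> t" "t < 1" using \<rho> by (auto simp: t_def)
  define G where "G = (1 / (1 - t)) ^ CARD('n)"
  have G: "G > 0" using t by (simp add: G_def)
  show thesis
  proof
    show "C * G > 0" using C G by simp
    fix c :: "('n \<Rightarrow> nat) \<Rightarrow> complex" assume c: "finsupp c"
    let ?N = "norm_inf q \<sigma> (oreg_elem q c)"
    \<comment> \<open>Nonnegativity is read off from the coefficient estimate at the zero
      index.\<close>
    have N: "C * ?N \<ge> 0"
    proof -
      have "0 \<le> cmod (c (\<lambda>i. 0)) * ball_wt q \<sigma> ((\<lambda>i. 0) :: 'n \<Rightarrow> nat)"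
        using ball_wt_pos[OF q, of \<sigma> "(\<lambda>i. 0) :: 'n \<Rightarrow> nat"] \<rho> by (intro mult_nonneg_nonneg) auto
      also have "\<dots> \<le> C * ?N" using \<rho> c by (intro C(2)) auto
      finally show ?thesis .
    qed
    have "(\<Sum>k\<in>F. cmod (c k) * ball_wt q \<rho> k) \<le> C * G * ?N" if F: "finite F" for F
    proof -
      have "(\<Sum>k\<in>F. cmod (c k) * ball_wt q \<rho> k) = (\<Sum>k\<in>F. cmod (c k) * ball_wt q \<sigma> k * t ^ total k)"
        using \<rho> by (intro sum.cong) (auto simp: ball_wt_def t_def power_divide)
      also have "\<dots> \<le> (\<Sum>k\<in>F. C * ?N * t ^ total k)"
        using C(2)[of \<sigma> c] c \<rho> t by (intro sum_mono mult_right_mono) auto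
      also have "\<dots> \<le> C * ?N * G"
        unfolding sum_distrib_left[symmetric] G_def using N geometric_sum_bound[OF t F] by (intro mult_left_mono)
      finally show ?thesis by (simp add: mult_ac)
    qed
    then show "weighted_norm (ball_wt q \<rho>) c \<le> C * G * ?N"
      using less_imp_le[OF ball_wt_pos[OF q \<rho>(1)]] by (intro weighted_boundI(2))
  qed
qed

text \<open>The embedding reads off the coefficients with respect to the ordered monomials.\<close>

lemma dense_embedding_oreg:
  fixes q :: real and r :: ereal
  assumes q: "0 < q" "q < 1" and r: "0 < r"
  shows "dense_embedding
    (oreg_normed q r :: 'n::{finite,linorder} free set seminormed_alg)
    (quantum_ball q r :: (('n \<Rightarrow> nat) \<Rightarrow> complex) seminormed_alg) (coeffs_of q)"
proof -
  let ?A = "oreg_normed q r :: 'n free set seminormed_alg"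
  let ?B = "quantum_ball q r :: (('n \<Rightarrow> nat) \<Rightarrow> complex) seminormed_alg"
  let ?I = "{\<rho>. 0 < \<rho> \<and> ereal \<rho> < r}"
  let ?W = "ball_wt q :: real \<Rightarrow> ('n \<Rightarrow> nat) \<Rightarrow> real"
  let ?e = "oreg_elem q :: (('n \<Rightarrow> nat) \<Rightarrow> complex) \<Rightarrow> _"
  note coeffs [simp] = coeffs_of_elem[OF q]
  note elem [simp] = oreg_elem_simps[OF q]
  note [simp] = finsupp_add finsupp_diff finsupp_smult finsupp_ball_mult finsupp_monom finsupp_zero
  have A [simp]: "carrier ?A = ?e ` {c. finsupp c}" "mult ?A = mult (pol q)" "one ?A = one (pol q)"
    "add ?A = add (pol q)" "zero ?A = zero (pol q)" "smult ?A = smult (pol q)" "idx ?A = ?I" "nrm ?A = norm_inf q"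
    using carrier_oreg[OF q, where 'n = 'n] by (simp_all add: oreg_normed_def)
  have A_diff [simp]: "alg_diff ?A (?e c) (?e d) = ?e (c - d)" if "finsupp c" "finsupp d" for c d
  proof -
    have "c + (\<lambda>k. - d k) = c - d" by auto
    then show ?thesis using that finsupp_smult[of d "-1"] by (simp add: alg_diff_def)
  qed
  have B [simp]: "carrier ?B = {c. \<forall>\<rho>\<in>?I. weighted_summable (?W \<rho>) c}" "mult ?B = ball_mult q"
    "one ?B = ball_monom (\<lambda>i. 0)" "zero ?B = 0" "add ?B = (+)" "smult ?B = (\<lambda>a c k. a * c k)"
    "idx ?B = ?I" "nrm ?B \<rho> c = weighted_norm (?W \<rho>) c" for \<rho> c
    by (auto simp: quantum_ball_def ball_carrier_def weighted_summable_def ball_wt_def mult.assoc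
        ball_norm_weighted fun_eq_iff)
  have W: "?W \<rho> k \<ge> 0" if "\<rho> \<in> ?I" for \<rho> k using ball_wt_pos[OF q, of \<rho> k] that by (simp add: less_imp_le)
  have fin: "weighted_summable (?W \<rho>) c" if "finsupp c" for \<rho> c
    using that by (intro weighted_finite_support) (simp add: finsupp_def)
  \<comment> \<open>One admissible radius is enough to separate points and to control every
    coordinate, because its weights are all positive.\<close>
  obtain \<rho>\<^sub>0 where \<rho>0: "\<rho>\<^sub>0 \<in> ?I" using r ereal_dense2[of 0 r] by (auto simp: zero_ereal_def)
  have Wpos: "?W \<rho> k > 0" if "\<rho> \<in> ?I" for \<rho> k using ball_wt_pos[OF q, of \<rho> k] that by simp
  obtain C where C: "C > 0" and ball_mult: "\<And>\<rho> c d. \<rho> \<in> ?I \<Longrightarrow>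
      weighted_summable (?W \<rho>) c \<Longrightarrow> weighted_summable (?W \<rho>) d \<Longrightarrow>
      weighted_summable (?W \<rho>) (ball_mult q c d) \<and>
      weighted_norm (?W \<rho>) (ball_mult q c d) \<le> C * weighted_norm (?W \<rho>) c * weighted_norm (?W \<rho>) d"
  proof -
    obtain C where C: "C > 0" "\<And>k l :: 'n \<Rightarrow> nat. q powi (- int (reorder_exp k l)) * ball_weight q (\<lambda>i. k i + l i)
        \<le> C * (ball_weight q k * ball_weight q l)"
      using ball_weight_mult[OF q, where 'n = 'n] by blast
    have W_mult: "q powi (- int (reorder_exp k l)) * ?W \<rho> (\<lambda>i. k i + l i) \<le> C * (?W \<rho> k * ?W \<rho> l)"
      if "\<rho> \<in> ?I" for \<rho> k l
      using mult_right_mono[OF C(2)[of k l], of "\<rho> ^ (total k + total l)"] that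
      by (simp add: ball_wt_def sum.distrib power_add mult_ac)
    show thesis
    proof (rule that[OF C(1)])
      fix \<rho> and c d :: "('n \<Rightarrow> nat) \<Rightarrow> complex"
      assume "\<rho> \<in> ?I" and "weighted_summable (?W \<rho>) c" "weighted_summable (?W \<rho>) d"
      with weighted_ball_mult[of "?W \<rho>" q C c d] W[of \<rho>] q(1) W_mult[of \<rho>] C(1)
      show "weighted_summable (?W \<rho>) (ball_mult q c d) \<and>
          weighted_norm (?W \<rho>) (ball_mult q c d) \<le> C * weighted_norm (?W \<rho>) c * weighted_norm (?W \<rho>) d"
        by simp
    qed
  qed
  have add: "weighted_summable (?W \<rho>) (c + d)"
      "weighted_norm (?W \<rho>) (c + d) \<le> weighted_norm (?W \<rho>) c + weighted_norm (?W \<rho>) d"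
    if "\<rho> \<in> ?I" "weighted_summable (?W \<rho>) c" "weighted_summable (?W \<rho>) d" for \<rho> c d
    using that weighted_add[of "?W \<rho>" c d] W by auto
  have smult_minus: "(\<lambda>k. - x k) = - x" "(\<lambda>k. a * (x k - y k)) = (\<lambda>k. a * x k) - (\<lambda>k. a * y k)"
    for x y :: "('n \<Rightarrow> nat) \<Rightarrow> complex" and a by (auto simp: algebra_simps)
  have alg_diff_B: "alg_diff ?B c d = c - d" for c d
    by (simp add: alg_diff_def smult_minus)
  have complete: "\<exists>x\<in>carrier ?B. \<forall>\<rho>\<in>?I. ((\<lambda>y. weighted_norm (?W \<rho>) (y - x)) \<longlongrightarrow> 0) F"
    if F: "F \<in> Cauchy_filters ?B" for F
  proof -
    have F': "F \<noteq> bot" "\<forall>\<^sub>F c in F. c \<in> carrier ?B"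
      and Cauchy: "\<And>\<rho> \<epsilon>. \<rho> \<in> ?I \<Longrightarrow> \<epsilon> > 0 \<Longrightarrow> \<forall>\<^sub>F (c, d) in F \<times>\<^sub>F F. weighted_norm (?W \<rho>) (c - d) < \<epsilon>"
      using F unfolding Cauchy_filters_def alg_diff_B le_principal by auto
    have "\<exists>z. ((\<lambda>c. c k) \<longlongrightarrow> z) F" for k
    proof -
      have "cauchy_filter (filtermap (\<lambda>c. c k) F)"
        unfolding cauchy_filter_metric_filtermap
      proof (intro allI impI)
        fix e :: real assume e: "e > 0"
        then have "\<forall>\<^sub>F (c, d) in F \<times>\<^sub>F F. weighted_norm (?W \<rho>\<^sub>0) (c - d) < e * ?W \<rho>\<^sub>0 k"
          using Wpos[OF \<rho>0] \<rho>0 by (intro Cauchy) auto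
        then obtain P where P: "eventually P F"
            "\<And>c d. P c \<Longrightarrow> P d \<Longrightarrow> weighted_norm (?W \<rho>\<^sub>0) (c - d) < e * ?W \<rho>\<^sub>0 k"
          unfolding eventually_prod_same by auto
        have "dist (c k) (d k) < e" if "P c \<and> c \<in> carrier ?B" "P d \<and> d \<in> carrier ?B" for c d
        proof -
          have "weighted_summable (?W \<rho>\<^sub>0) (c - d)"
            using that \<rho>0 by (intro weighted_diff W) auto
          from weighted_term_le[OF W[OF \<rho>0] this, of k]
          have "cmod (c k - d k) * ?W \<rho>\<^sub>0 k < e * ?W \<rho>\<^sub>0 k" using P(2)[of c d] that by simp
          then show ?thesis using Wpos[OF \<rho>0, of k] by (simp add: dist_norm)
        qed
        moreover have "\<forall>\<^sub>F c in F. P c \<and> c \<in> carrier ?B" using P(1) F'(2) by (rule eventually_conj)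
        ultimately show "\<exists>P. eventually P F \<and> (\<forall>x y. P x \<and> P y \<longrightarrow> dist (x k) (y k) < e)" by blast
      qed
      moreover have "filtermap (\<lambda>c. c k) F \<noteq> bot" using F'(1) by (simp add: filtermap_bot_iff)
      ultimately obtain z where "filtermap (\<lambda>c. c k) F \<le> nhds z"
        using complete_uniform[of "UNIV::complex set"] complete_UNIV by auto
      then show ?thesis by (auto simp: filterlim_def)
    qed
    then obtain x where x: "\<And>k. ((\<lambda>c. c k) \<longlongrightarrow> x k) F" by metis
    have "weighted_summable (?W \<rho>) x \<and> ((\<lambda>y. weighted_norm (?W \<rho>) (y - x)) \<longlongrightarrow> 0) F" if \<rho>: "\<rho> \<in> ?I" for \<rho>
    proof -
      have "\<forall>\<^sub>F c in F. weighted_summable (?W \<rho>) c"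
        using F'(2) by (rule eventually_mono) (use \<rho> in auto)
      from weighted_complete[OF W[OF \<rho>] this F'(1) x Cauchy[OF \<rho>]] show ?thesis by blast
    qed
    then show ?thesis by (intro bexI[of _ x]) auto
  qed
  have dense: "\<exists>F. F \<noteq> bot \<and> F \<le> principal (carrier ?A) \<and>
      (\<forall>\<rho>\<in>?I. ((\<lambda>a. weighted_norm (?W \<rho>) (coeffs_of q a - x)) \<longlongrightarrow> 0) F)" if x: "x \<in> carrier ?B" for x
  proof (intro exI conjI ballI)
    \<comment> \<open>The approximating filter is the image of the finite index sets, ordered by
      inclusion, under truncation of x.\<close>
    let ?f = "\<lambda>K. ?e (truncate x K)"
    have fs: "finsupp (truncate x K)" if "finite K" for K
      unfolding finsupp_def by (rule finite_subset[OF _ that]) (auto simp: truncate_def)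
    have ev: "\<forall>\<^sub>F K in finite_subsets_at_top UNIV. finite K"
      by (auto simp: eventually_finite_subsets_at_top intro: exI[of _ "{}"])
    show "filtermap ?f (finite_subsets_at_top UNIV) \<noteq> bot" by (simp add: filtermap_bot_iff)
    show "filtermap ?f (finite_subsets_at_top UNIV) \<le> principal (carrier ?A)"
      using ev by (auto simp: le_principal eventually_filtermap fs elim!: eventually_mono)
    fix \<rho> assume \<rho>: "\<rho> \<in> ?I"
    have "((\<lambda>K. weighted_norm (?W \<rho>) (truncate x K - x)) \<longlongrightarrow> 0) (finite_subsets_at_top UNIV)"
      using x \<rho> by (intro weighted_truncate) auto
    moreover have "\<forall>\<^sub>F K in finite_subsets_at_top UNIV. weighted_norm (?W \<rho>) (truncate x K - x) =
        weighted_norm (?W \<rho>) (coeffs_of q (?f K) - x)"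
      using ev by (rule eventually_mono) (simp add: fs)
    ultimately show "((\<lambda>a. weighted_norm (?W \<rho>) (coeffs_of q a - x)) \<longlongrightarrow> 0) (filtermap ?f (finite_subsets_at_top UNIV))"
      unfolding filterlim_filtermap by (rule Lim_transform_eventually)
  qed
  have le1: "\<exists>\<sigma>\<in>?I. \<exists>C>0. \<forall>a\<in>carrier ?A. norm_inf q \<rho> a \<le> C * weighted_norm (?W \<sigma>) (coeffs_of q a)"
    if \<rho>: "\<rho> \<in> ?I" for \<rho>
  proof -
    obtain C where "C > 0" "\<And>c :: ('n \<Rightarrow> nat) \<Rightarrow> complex. finsupp c \<Longrightarrow>
        norm_inf q \<rho> (oreg_elem q c) \<le> C * weighted_norm (ball_wt q \<rho>) c"
      using norm_inf_le[OF q, of \<rho>, where 'n = 'n] \<rho> by blast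
    then show ?thesis using \<rho> by (intro bexI[of _ \<rho>] exI[of _ C]) auto
  qed
  have le2: "\<exists>\<sigma>\<in>?I. \<exists>C>0. \<forall>a\<in>carrier ?A. weighted_norm (?W \<rho>) (coeffs_of q a) \<le> C * norm_inf q \<sigma> a"
    if \<rho>: "\<rho> \<in> ?I" for \<rho>
  proof -
    \<comment> \<open>The range of radii has no largest element, which provides the room lost in the
      comparison.\<close>
    obtain \<sigma> where \<sigma>: "\<rho> < \<sigma>" "ereal \<sigma> < r" using ereal_dense2[of "ereal \<rho>" r] \<rho> by auto
    obtain C where "C > 0" "\<And>c :: ('n \<Rightarrow> nat) \<Rightarrow> complex. finsupp c \<Longrightarrow>
        weighted_norm (ball_wt q \<rho>) c \<le> C * norm_inf q \<sigma> (oreg_elem q c)"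
      using ball_norm_le_norm_inf[OF q _ \<sigma>(1), where 'n = 'n] \<rho> by blast
    then show ?thesis using \<rho> \<sigma> by (intro bexI[of _ \<sigma>] exI[of _ C]) auto
  qed
  show ?thesis
  \<comment> \<open>The numbers count the individual facts among the locale assumptions, in their
    order of declaration.\<close>
  proof (unfold_locales, goal_cases)
    case 2 then show ?case using \<rho>0 by auto
  next
    case (8 \<rho> a b)
    then show ?case using norm_inf_add[OF q] by auto
  next
    case (9 \<rho> a b)
    then show ?case using norm_inf_diff[OF q] by auto
  next
    case 11
    show ?case using fin by simp
  next
    case 12
    show ?case using fin by simp
  next
    case (14 x y)
    then show ?case using add by simp
  next
    case (15 x y)
    then show ?case using ball_mult by simp
  next
    case (16 c x)
    then show ?case using weighted_smult(1) by auto
  next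
    case (21 \<rho>)
    show ?case by (simp add: weighted_norm_def)
  next
    case (22 \<rho> x y)
    then show ?case using add by simp
  next
    case (24 \<rho>)
    then show ?case using ball_mult by (intro exI[of _ C]) simp
  next
    case (25 x)
    have "x k = 0" for k
      using weighted_term_le[of "?W \<rho>\<^sub>0" x k, OF W[OF \<rho>0]] Wpos[OF \<rho>0, of k] 25 \<rho>0
      by (auto simp: mult_le_0_iff)
    then show ?case by auto
  next
    case (26 F)
    then show ?case using complete by simp
  next
    case 27
    show ?case by (auto simp: alg_hom_def ring_hom_def oreg_elem_constants fin)
  next
    case (29 x)
    then show ?case using dense by simp
  next
    case (30 \<rho>)
    then show ?case using le1 by simp
  next
    case (31 \<rho>)
    then show ?case using le2 by simp
  qed (auto simp: oreg_elem_constants smult_minus ball_mult_diff weighted_smult(2))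
qed

theorem theorem5p1:
  fixes q :: real and r :: ereal
  assumes "0 < q" and "q < 1" and "0 < r"
  shows "topologically_isomorphic
    (alg_completion (oreg_normed q r :: 'n::{finite,linorder} free set seminormed_alg))
    (quantum_ball q r :: (('n \<Rightarrow> nat) \<Rightarrow> complex) seminormed_alg)"
  using dense_embedding.completion_isomorphic[OF dense_embedding_oreg[OF assms]] .

end
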